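(* Let $a=\partial\Omega_1$ and $b=\partial\Omega_2$ be the boundaries of nested convex compact domains $\Omega_1\Subset\Omega_2\Subset\mathbb R^2$, both being piecewise $C^4$-smooth Jordan curves, and suppose the billiard transformations of $\Omega_1$ and $\Omega_2$ commute. Then $a$ and $b$ are confocal ellipses.
   Context: For a convex compact domain $\Omega\subset\mathbb R^2$ with piecewise smooth boundary, the billiard transformation acts on the space of oriented lines in $\mathbb R^2$: it fixes every oriented line disjoint from $\Omega$, and sends an oriented line $l$ intersecting $\Omega$ to the line obtained by reflecting $l$ from the tangent line to $\partial\Omega$ at the last intersection point $x$ of $l$ with $\partial\Omega$ (in the sense of the orientation of $l$, so the orienting arrow at $x$ points out of $\Omega$), the reflected line being oriented by a tangent vector at $x$ pointing into $\Omega$. *)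

theory Defs
  imports "HOL-Analysis.Analysis"
begin

definition vderiv_iter :: "nat \<Rightarrow> (real \<Rightarrow> complex) \<Rightarrow> real \<Rightarrow> complex" where
  "vderiv_iter j f = ((\<lambda>g t. vector_derivative g (at t)) ^^ j) f"

definition Ck_on :: "nat \<Rightarrow> (real \<Rightarrow> complex) \<Rightarrow> real set \<Rightarrow> bool" where
  "Ck_on k f U \<longleftrightarrow>
     (\<forall>j<k. \<forall>t\<in>U. vderiv_iter j f differentiable (at t)) \<and>
     (\<forall>j\<le>k. continuous_on U (vderiv_iter j f))"

definition piecewise_Ck_Jordan :: "nat \<Rightarrow> complex set \<Rightarrow> bool" where
  "piecewise_Ck_Jordan k C \<longleftrightarrow>
     (\<exists>\<gamma>::real \<Rightarrow> complex. simple_path \<gamma> \<and> pathstart \<gamma> = pathfinish \<gamma> \<and> path_image \<gamma> = C \<and>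
       (\<exists>(n::nat) (t::nat \<Rightarrow> real). t 0 = 0 \<and> t n = 1 \<and> (\<forall>i<n. t i < t (Suc i)) \<and>
          (\<forall>i<n. \<exists>g U. open U \<and> {t i..t (Suc i)} \<subseteq> U \<and> Ck_on k g U \<and>
                 (\<forall>s\<in>{t i..t (Suc i)}. g s = \<gamma> s \<and> vector_derivative g (at s) \<noteq> 0))))"

definition convex_compact_domain :: "complex set \<Rightarrow> bool" where
  "convex_compact_domain \<Omega> \<longleftrightarrow> convex \<Omega> \<and> compact \<Omega> \<and> interior \<Omega> \<noteq> {}"

text \<open>Oriented lines: a pair (d, c) with |d| = 1 represents the line
  {x. Im (cnj d * x) = c} oriented by the unit direction vector d.
  This is a bijective parametrisation of the space of oriented lines.\<close>
type_synonym oline = "complex \<times> real"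

definition is_oline :: "oline \<Rightarrow> bool" where
  "is_oline l \<longleftrightarrow> cmod (fst l) = 1"

definition line_points :: "oline \<Rightarrow> complex set" where
  "line_points l = {x. Im (cnj (fst l) * x) = snd l}"

definition is_exit_point :: "complex set \<Rightarrow> oline \<Rightarrow> complex \<Rightarrow> bool" where
  "is_exit_point \<Omega> l x \<longleftrightarrow> x \<in> \<Omega> \<inter> line_points l \<and>
     (\<forall>y\<in>\<Omega> \<inter> line_points l. Re (cnj (fst l) * y) \<le> Re (cnj (fst l) * x))"

definition exit_point :: "complex set \<Rightarrow> oline \<Rightarrow> complex" where
  "exit_point \<Omega> l = (THE x. is_exit_point \<Omega> l x)"

text \<open>Outer unit normals of supporting lines of \<Omega> at x. The tangent line to the
  boundary of the convex domain at x exists iff this set is a singleton {n};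
  it is then the line through x with direction i*n.\<close>
definition support_normals :: "complex set \<Rightarrow> complex \<Rightarrow> complex set" where
  "support_normals \<Omega> x = {n. cmod n = 1 \<and> (\<forall>y\<in>\<Omega>. Re (cnj n * (y - x)) \<le> 0)}"

text \<open>The billiard transformation (partial: undefined (None) when the last
  intersection point is a point where the boundary has no tangent line).
  Reflection of the direction d in a line with unit direction \<tau> = i n is \<tau>^2 * cnj d.\<close>
definition billiard_map :: "complex set \<Rightarrow> oline \<Rightarrow> oline option" where
  "billiard_map \<Omega> l =
     (if \<Omega> \<inter> line_points l = {} then Some l
      else (let x = exit_point \<Omega> l in
            if (\<exists>!n. n \<in> support_normals \<Omega> x)
            then (let n = (THE n. n \<in> support_normals \<Omega> x);
                      d' = - (n ^ 2) * cnj (fst l)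
                  in Some (d', Im (cnj d' * x)))
            else None))"

definition billiards_commute :: "complex set \<Rightarrow> complex set \<Rightarrow> bool" where
  "billiards_commute \<Omega>1 \<Omega>2 \<longleftrightarrow>
     (\<forall>l m1 m2 p1 p2. is_oline l \<and>
        billiard_map \<Omega>1 l = Some m1 \<and> billiard_map \<Omega>2 m1 = Some p1 \<and>
        billiard_map \<Omega>2 l = Some m2 \<and> billiard_map \<Omega>1 m2 = Some p2 \<longrightarrow> p1 = p2)"

definition ellipse :: "complex \<Rightarrow> complex \<Rightarrow> real \<Rightarrow> complex set" where
  "ellipse f1 f2 s = {z. cmod (z - f1) + cmod (z - f2) = s}"

definition confocal_ellipses :: "complex set \<Rightarrow> complex set \<Rightarrow> bool" where
  "confocal_ellipses a b \<longleftrightarrow>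
     (\<exists>f1 f2 s1 s2. cmod (f1 - f2) < s1 \<and> cmod (f1 - f2) < s2 \<and>
        a = ellipse f1 f2 s1 \<and> b = ellipse f1 f2 s2)"

end

theory Submission
  imports Defs
begin

text \<open>
  An oriented line that misses \<open>\<Omega>1\<close> is fixed by the inner billiard, so by commutation its reflection in
  the outer boundary does not cross \<open>\<Omega>1\<close> either. Hence the normal of \<open>\<Omega>2\<close> at a boundary point \<open>y\<close>
  bisects the cone under which \<open>\<Omega>1\<close> is seen from \<open>y\<close>, which also rules out corners of \<open>\<Omega>2\<close>.

  Commutation on a line that leaves \<open>\<Omega>1\<close> at \<open>x\<close> yields a quadrilateral \<open>x y x' y'\<close> with \<open>x, x'\<close> on the inner
  and \<open>y, y'\<close> on the outer boundary, obeying the reflection law at all vertices. By the first variation,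
  \<open>|xy| + |yx'| = |xy'| + |y'x'|\<close>, and therefore the tangents at \<open>x\<close>, \<open>x'\<close> and \<open>y\<close> are concurrent. For fixed
  \<open>y\<close> this says that \<open>1 / \<rho> + 1 / \<rho>'\<close> is constant, where \<open>\<rho>\<close> and \<open>\<rho>'\<close> are the distances of \<open>x\<close> and \<open>x'\<close>
  to the tangent at \<open>y\<close>: a projective map sending that tangent to infinity makes \<open>\<Omega>1\<close> centrally symmetric.

  Two such symmetries, for the tangents of \<open>\<Omega>2\<close> perpendicular to a diameter of \<open>\<Omega>1\<close>, compose to a map that
  contracts towards one end of the diameter and preserves a pencil of conics touching at both ends. As the
  boundary has a 2-jet at that end, it lies on a single conic of the pencil, so \<open>\<Omega>1\<close> is an ellipse. Finally
  the normal of \<open>\<Omega>2\<close> bisects the angle of the tangents to this ellipse, hence of the rays to its foci, so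
  the sum of the distances to the foci is constant along the boundary of \<open>\<Omega>2\<close>.
\<close>

section \<open>Convex bodies and reflected lines\<close>

text \<open>The billiard maps are partial: a line that leaves a domain at a corner has no image, and
  commutation says nothing about it. Hence normals are handled as sets of support normals, defined
  at every boundary point, and corners are reached only as limits of smooth points, by rotating a
  line about a point. Where constancy is wanted, a zero derivative off a finite set is combined with
  continuity. The smoothness of \<Omega>2 is settled at all its points; that of \<Omega>1 is
  transported only from \<open>x\<close> to the opposite vertex \<open>x'\<close>.

  The variational part does not parametrize the boundaries: a convex boundary is flat to first order
  at a smooth point, and exit points depend on the line in a Lipschitz way, which suffices to
  differentiate lengths. The difference of the two lengths is 0 because, when the line turns about
  \<open>x\<close> until it is tangent there, \<open>y\<close> and \<open>y'\<close> merge.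

  Concurrency eliminates \<open>y'\<close>. What remains can be used with \<open>y\<close> fixed and
  becomes the vanishing of a derivative with respect to the slope of the line through
  \<open>y\<close>.\<close>

lemma Re_cnj_mult: "Re (cnj a * b) = a \<bullet> b"
  by (simp add: inner_complex_def)

text \<open>For a unit \<open>n\<close> the mirror is the line orthogonal to \<open>n\<close>: the
  component along \<open>n\<close> changes sign. In the complex form only \<open>n\<^sup>2\<close>
  matters, and rotations pass through it with the opposite angle.\<close>

definition reflect :: "complex \<Rightarrow> complex \<Rightarrow> complex" where
  "reflect n d = - (n\<^sup>2) * cnj d"

lemma mult_cnj_unit: "norm (n::complex) = 1 \<Longrightarrow> n * cnj n = 1"
  by (metis complex_norm_square mult.commute of_real_1 power_one)

lemma reflect_eq:
  assumes "norm n = 1"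
  shows "reflect n d = d - (2 * (n \<bullet> d)) *\<^sub>R n"
proof -
  have "(2 * (n \<bullet> d)) *\<^sub>R n = (cnj n * d + n * cnj d) * n"
    by (simp add: complex_eq_iff inner_complex_def algebra_simps)
  also have "\<dots> = (n * cnj n) * d + n\<^sup>2 * cnj d"
    by (simp add: algebra_simps power2_eq_square)
  finally show ?thesis
    using mult_cnj_unit[OF assms] by (simp add: reflect_def)
qed

lemma norm_reflect: "norm n = 1 \<Longrightarrow> norm (reflect n d) = norm d"
  by (simp add: reflect_def norm_mult norm_power)

lemma reflect_reflect: "norm n = 1 \<Longrightarrow> reflect n (reflect n d) = d"
  using mult_cnj_unit[of n] by (simp add: reflect_def power2_eq_square algebra_simps)

lemma inner_unit: "norm n = 1 \<Longrightarrow> n \<bullet> n = (1::real)"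
  by (simp add: dot_square_norm)

lemma inner_reflect:
  assumes "norm n = 1"
  shows "n \<bullet> reflect n d = - (n \<bullet> d)"
  using inner_unit[OF assms] by (simp add: reflect_eq[OF assms] inner_diff_right)

lemma reflect_cis: "reflect n (cis \<theta> * d) = cis (- \<theta>) * reflect n d"
  by (simp add: reflect_def cis_cnj)

lemma reflect_scaleR: "reflect n (t *\<^sub>R d) = t *\<^sub>R reflect n d"
  by (simp add: reflect_def scaleR_conv_of_real)

lemma tendsto_reflect [tendsto_intros]:
  "(f \<longlongrightarrow> n) F \<Longrightarrow> (g \<longlongrightarrow> d) F \<Longrightarrow> ((\<lambda>x. reflect (f x) (g x)) \<longlongrightarrow> reflect n d) F"
  unfolding reflect_def by (intro tendsto_intros)

text \<open>The base point can slide along the line (\<open>oriented_line_shift\<close>), so each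
  billiard map is evaluated at the boundary point where the line is reflected.\<close>

definition oriented_line :: "complex \<Rightarrow> complex \<Rightarrow> oline" where
  "oriented_line x d = (d, Im (cnj d * x))"

lemma unit_decomp:
  assumes "norm d = 1"
  shows "z = ((d \<bullet> z) *\<^sub>R d) + (((\<i> * d) \<bullet> z) *\<^sub>R (\<i> * d))"
proof -
  have d: "(Re d)\<^sup>2 + (Im d)\<^sup>2 = 1"
    using assms by (metis cmod_power2 power_one)
  have "Re d * (Re d * Re z + Im d * Im z) + Im d * (Im d * Re z - Re d * Im z) = ((Re d)\<^sup>2 + (Im d)\<^sup>2) * Re z"
       "Im d * (Re d * Re z + Im d * Im z) - Re d * (Im d * Re z - Re d * Im z) = ((Re d)\<^sup>2 + (Im d)\<^sup>2) * Im z"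
    by algebra+
  then show ?thesis
    unfolding d by (simp add: complex_eq_iff inner_complex_def algebra_simps)
qed

lemma line_points_oriented_line:
  assumes "norm d = 1"
  shows "z \<in> line_points (oriented_line x d) \<longleftrightarrow> (\<exists>t. z = x + t *\<^sub>R d)"
proof -
  have "Im (cnj d * z) = Im (cnj d * x) \<longleftrightarrow> (\<i> * d) \<bullet> (z - x) = 0"
    by (auto simp: inner_complex_def algebra_simps)
  moreover have "(\<i> * d) \<bullet> (z - x) = 0 \<longleftrightarrow> (\<exists>t. z = x + t *\<^sub>R d)"
  proof
    assume "(\<i> * d) \<bullet> (z - x) = 0"
    then have "z - x = (d \<bullet> (z - x)) *\<^sub>R d"
      using unit_decomp[OF assms, of "z - x"] by simp
    then show "\<exists>t. z = x + t *\<^sub>R d"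
      by (metis add.commute diff_add_cancel)
  next
    assume "\<exists>t. z = x + t *\<^sub>R d"
    then show "(\<i> * d) \<bullet> (z - x) = 0"
      by (auto simp: inner_complex_def algebra_simps)
  qed
  ultimately show ?thesis
    by (simp add: line_points_def oriented_line_def)
qed

lemma oriented_line_shift: "norm d = 1 \<Longrightarrow> oriented_line (x + t *\<^sub>R d) d = oriented_line x d"
  using mult_cnj_unit[of d]
  by (simp add: oriented_line_def distrib_left mult.commute[of "cnj d"] scaleR_conv_of_real mult.assoc)

lemma oriented_line_eqD:
  assumes "oriented_line x d = oriented_line x' d'" "norm d = 1"
  shows "d = d' \<and> (\<exists>t. x' = x + t *\<^sub>R d)"
proof -
  have d: "d = d'" using assms(1) by (simp add: oriented_line_def)
  have "x' = x' + 0 *\<^sub>R d'" by simp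
  then have "x' \<in> line_points (oriented_line x' d')"
    using line_points_oriented_line[of d' x' x'] assms(2) d by blast
  then have "x' \<in> line_points (oriented_line x d)" using assms(1) by simp
  then show ?thesis using line_points_oriented_line[OF assms(2)] d by blast
qed

text \<open>Unlike in \<open>is_exit_point\<close>, the direction is not normalised, so that
  \<open>n + \<sigma> *\<^sub>R \<tau>\<close> with a varying slope can be used; for unit directions
  \<open>exit_point_eq\<close> gives the link.\<close>

definition exits :: "complex set \<Rightarrow> complex \<Rightarrow> complex \<Rightarrow> bool" where
  "exits K x d \<longleftrightarrow> x \<in> K \<and> (\<forall>t>0. x + t *\<^sub>R d \<notin> K)"

lemma exits_le:
  assumes "exits K (p + t *\<^sub>R d) d" "p + s *\<^sub>R d \<in> K"
  shows "s \<le> t"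
proof (rule ccontr)
  assume "\<not> s \<le> t"
  then have "s - t > 0" by simp
  moreover have "(p + t *\<^sub>R d) + (s - t) *\<^sub>R d = p + s *\<^sub>R d"
    by (simp add: algebra_simps)
  ultimately show False
    using assms unfolding exits_def by metis
qed

lemma exits_unique:
  assumes "exits K (p + s *\<^sub>R d) d" "exits K (p + t *\<^sub>R d) d"
  shows "s = t"
  using exits_le[OF assms(1), of t] exits_le[OF assms(2), of s] assms
  by (auto simp: exits_def)

lemma exits_scale: "c > 0 \<Longrightarrow> exits K x (c *\<^sub>R d) \<longleftrightarrow> exits K x d"
  unfolding exits_def
proof (intro conj_cong refl iffI allI impI)
  fix t :: real
  assume "c > 0" "\<forall>t>0. x + t *\<^sub>R c *\<^sub>R d \<notin> K" "t > 0"
  then show "x + t *\<^sub>R d \<notin> K"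
    by (auto dest: spec[of _ "t / c"])
qed auto

lemma support_normals_iff:
  "n \<in> support_normals K x \<longleftrightarrow> norm n = 1 \<and> (\<forall>y\<in>K. n \<bullet> (y - x) \<le> 0)"
  by (simp add: support_normals_def inner_complex_def)

lemma exit_point_eq:
  assumes "norm d = 1" "exits K x d"
  shows "exit_point K (oriented_line x d) = x"
  unfolding exit_point_def
proof (rule the_equality)
  have key: "Re (cnj d * (x + t *\<^sub>R d)) = Re (cnj d * x) + t" for t
    using inner_unit[OF assms(1)] unfolding Re_cnj_mult by (simp add: inner_add_right)
  have x: "x \<in> line_points (oriented_line x d)"
    using line_points_oriented_line[OF assms(1), of x x] by (metis add.right_neutral scaleR_zero_left)
  show "is_exit_point K (oriented_line x d) x"
    unfolding is_exit_point_def
  proof (intro conjI ballI)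
    show "x \<in> K \<inter> line_points (oriented_line x d)"
      using x assms by (auto simp: exits_def)
    fix y assume y: "y \<in> K \<inter> line_points (oriented_line x d)"
    then obtain t where t: "y = x + t *\<^sub>R d"
      using line_points_oriented_line[OF assms(1)] by blast
    with y assms(2) have "t \<le> 0"
      by (auto simp: exits_def) (meson not_le)
    then show "Re (cnj (fst (oriented_line x d)) * y) \<le> Re (cnj (fst (oriented_line x d)) * x)"
      using key t by (simp add: oriented_line_def)
  qed
  fix z assume z: "is_exit_point K (oriented_line x d) z"
  then obtain t where t: "z = x + t *\<^sub>R d"
    unfolding is_exit_point_def using line_points_oriented_line[OF assms(1)] by blast
  have "t \<le> 0"
    using z t assms(2) unfolding is_exit_point_def exits_def by (meson IntD1 not_le)
  moreover have "Re (cnj d * x) \<le> Re (cnj d * z)"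
    using z x assms(2) unfolding is_exit_point_def exits_def by (auto simp: oriented_line_def)
  ultimately have "t = 0" using key t by simp
  then show "z = x" using t by simp
qed

lemma billiard_map_hit:
  assumes "norm d = 1" "exits K x d" "support_normals K x = {n}"
  shows "billiard_map K (oriented_line x d) = Some (oriented_line x (reflect n d))"
proof -
  have "x \<in> K \<inter> line_points (oriented_line x d)"
    using assms line_points_oriented_line[OF assms(1), of x x]
    by (auto simp: exits_def intro: exI[of _ 0])
  then have "K \<inter> line_points (oriented_line x d) \<noteq> {}" by blast
  then show ?thesis
    using exit_point_eq[OF assms(1,2)] assms(3)
    by (simp add: billiard_map_def Let_def oriented_line_def reflect_def algebra_simps del: complex_cnj_power)
qed

lemma billiard_map_miss:
  assumes "norm d = 1" "\<And>t. x + t *\<^sub>R d \<notin> K"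
  shows "billiard_map K (oriented_line x d) = Some (oriented_line x d)"
proof -
  have "K \<inter> line_points (oriented_line x d) = {}"
    using assms line_points_oriented_line[OF assms(1)] by auto
  then show ?thesis by (simp add: billiard_map_def)
qed

text \<open>The base point only fixes the line: \<open>t\<close> runs through all reals, so
  \<open>p\<close> may lie before, inside or beyond \<open>K\<close>. The value is meaningful only
  if the line meets \<open>K\<close>.\<close>

definition hit :: "complex set \<Rightarrow> complex \<Rightarrow> complex \<Rightarrow> complex" where
  "hit K p d = (THE x. exits K x d \<and> (\<exists>t. x = p + t *\<^sub>R d))"

lemma hit_eq: "exits K (p + t *\<^sub>R d) d \<Longrightarrow> hit K p d = p + t *\<^sub>R d"
  unfolding hit_def using exits_unique by (intro the_equality) blast+

text \<open>A choice among the support normals, hence available at corners too.\<close>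

definition normal :: "complex set \<Rightarrow> complex \<Rightarrow> complex" where
  "normal K x = (SOME n. n \<in> support_normals K x)"

lemma normal_eq: "support_normals K x = {n} \<Longrightarrow> normal K x = n"
  by (simp add: normal_def)

text \<open>The condition under which \<open>billiard_map\<close> is defined on a line leaving
  \<open>K\<close> at \<open>x\<close>.\<close>

definition smooth_at :: "complex set \<Rightarrow> complex \<Rightarrow> bool" where
  "smooth_at K x \<longleftrightarrow> (\<exists>n. support_normals K x = {n})"

lemma smooth_at_normal: "smooth_at K x \<Longrightarrow> support_normals K x = {normal K x}"
  using normal_eq by (auto simp: smooth_at_def)

section \<open>Support normals of a convex body\<close>

locale convex_body =
  fixes K :: "complex set"
  assumes convex_K: "convex K" and compact_K: "compact K" and interior_K: "interior K \<noteq> {}"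
begin

lemma closed_K: "closed K"
  using compact_K compact_imp_closed by blast

lemma frontier_subset: "frontier K \<subseteq> K"
  using closed_K frontier_subset_eq by blast

lemma closure_interior_K: "closure (interior K) = K"
  using convex_closure_interior[OF convex_K interior_K] closure_closed[OF closed_K] by (rule trans)

lemma support_normals_interior:
  assumes n: "n \<in> support_normals K x" and z: "z \<in> interior K"
  shows "n \<bullet> (z - x) < 0"
proof -
  obtain e where e: "e > 0" "cball z e \<subseteq> K"
    using z by (auto simp: mem_interior_cball)
  have "norm n = 1" using n by (simp add: support_normals_iff)
  then have "z + e *\<^sub>R n \<in> K"
    using e by (intro subsetD[OF e(2)]) (simp add: dist_norm)
  then have "n \<bullet> (z + e *\<^sub>R n - x) \<le> 0"
    using n by (simp add: support_normals_iff)
  then have "n \<bullet> (z - x) + e \<le> 0"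
    using inner_unit[OF \<open>norm n = 1\<close>] by (simp add: inner_diff_right inner_add_right)
  then show ?thesis using e(1) by simp
qed

lemma support_normals_nonempty:
  assumes "x \<in> frontier K"
  shows "support_normals K x \<noteq> {}"
proof -
  have "interior K \<inter> {x} = {}" using assms by (auto simp: frontier_def)
  then obtain a b where ab: "a \<noteq> 0" "\<forall>z\<in>{x}. a \<bullet> z \<le> b" "\<forall>z\<in>interior K. a \<bullet> z \<ge> b"
    using separating_hyperplane_sets[of "{x}" "interior K"] interior_K convex_K convex_interior
    by (metis convex_singleton inf_commute insert_not_empty)
  have "a \<bullet> z \<ge> b" if "z \<in> K" for z
  proof -
    have "closure (interior K) \<subseteq> {z. a \<bullet> z \<ge> b}"
      using ab(3) by (intro closure_minimal closed_halfspace_ge) auto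
    then show ?thesis using that closure_interior_K by auto
  qed
  then have "(- (1 / norm a) *\<^sub>R a) \<bullet> (z - x) \<le> 0" if "z \<in> K" for z
    using that ab(1,2) by (force simp: inner_diff_right divide_simps)
  moreover have "norm (- (1 / norm a) *\<^sub>R a) = 1"
    using ab(1) by simp
  ultimately show ?thesis
    unfolding support_normals_iff ex_in_conv[symmetric] by blast
qed

lemma normal_in: "x \<in> frontier K \<Longrightarrow> normal K x \<in> support_normals K x"
  unfolding normal_def using support_normals_nonempty by (simp add: some_in_eq)

lemma exits_frontier:
  assumes "exits K x d" "d \<noteq> 0"
  shows "x \<in> frontier K"
proof -
  have "x \<notin> interior K"
  proof
    assume "x \<in> interior K"
    then obtain e where e: "e > 0" "cball x e \<subseteq> K"
      by (auto simp: mem_interior_cball)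
    then have "x + (e / norm d) *\<^sub>R d \<in> K"
      using assms(2) by (intro subsetD[OF e(2)]) (simp add: dist_norm)
    then show False using assms e(1) unfolding exits_def by auto
  qed
  then show ?thesis
    using assms closed_K by (simp add: frontier_def exits_def)
qed

lemma exits_exists:
  assumes "p + s *\<^sub>R d \<in> K" "d \<noteq> 0"
  shows "\<exists>t. exits K (p + t *\<^sub>R d) d"
proof -
  let ?T = "(\<lambda>t. p + t *\<^sub>R d) -` K"
  have "closed ?T"
    by (intro continuous_closed_vimage closed_K continuous_intros)
  moreover have "bounded ?T"
  proof -
    obtain B where B: "\<And>z. z \<in> K \<Longrightarrow> norm z \<le> B"
      using compact_K compact_imp_bounded bounded_iff by metis
    have "norm t \<le> (B + norm p) / norm d" if "t \<in> ?T" for t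
    proof -
      have "norm (t *\<^sub>R d) \<le> norm (p + t *\<^sub>R d) + norm p"
        by (metis add.commute add_diff_cancel_left' norm_triangle_ineq4)
      also have "\<dots> \<le> B + norm p" using B that by simp
      finally show ?thesis using assms(2) by (simp add: divide_simps)
    qed
    then show ?thesis unfolding bounded_iff by blast
  qed
  ultimately have "compact ?T" by (simp add: compact_eq_bounded_closed)
  then obtain t where t: "t \<in> ?T" "\<forall>u\<in>?T. u \<le> t"
    using compact_attains_sup[of ?T] assms(1) by auto
  have "exits K (p + t *\<^sub>R d) d"
    unfolding exits_def
  proof (intro conjI allI impI notI)
    show "p + t *\<^sub>R d \<in> K" using t by simp
    fix u :: real assume "u > 0" "p + t *\<^sub>R d + u *\<^sub>R d \<in> K"
    then have "t + u \<in> ?T" by (simp add: scaleR_add_left add.assoc)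
    then show False using t(2) \<open>u > 0\<close> by force
  qed
  then show ?thesis by blast
qed

lemma exits_hit:
  assumes "p + s *\<^sub>R d \<in> K" "d \<noteq> 0"
  shows "exits K (hit K p d) d" "\<exists>t. hit K p d = p + t *\<^sub>R d"
  using exits_exists[OF assms] hit_eq by force+

lemma exits_transversal:
  assumes "exits K x d" "x + s *\<^sub>R d \<in> interior K" "n \<in> support_normals K x"
  shows "s < 0 \<and> n \<bullet> d > 0"
proof -
  have "n \<bullet> (s *\<^sub>R d) < 0"
    using support_normals_interior[OF assms(3,2)] by simp
  moreover have "s \<le> 0"
    using assms(1,2) interior_subset unfolding exits_def by (meson not_le subsetD)
  ultimately show ?thesis
    by (auto simp: mult_less_0_iff)
qed

lemma exits_smooth:
  assumes "x \<in> K" "n \<in> support_normals K x" "n \<bullet> d > 0"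
  shows "exits K x d"
  using assms unfolding exits_def support_normals_iff
  by (metis add_diff_cancel_left' inner_scaleR_right mult_pos_pos not_le)

text \<open>Separate the line from the interior. A functional bounded above on a whole line is
  constant along it, which gives \<open>a \<bullet> d = 0\<close>.\<close>

lemma line_misses_interior:
  assumes "\<And>t. p + t *\<^sub>R d \<notin> interior K"
  obtains a where "norm a = 1" "a \<bullet> d = 0" "\<And>z. z \<in> K \<Longrightarrow> a \<bullet> (z - p) \<ge> 0"
proof -
  let ?S = "range (\<lambda>t. p + t *\<^sub>R d)"
  have "?S = (\<lambda>z. p + z) ` (\<lambda>t. t *\<^sub>R d) ` UNIV" by auto
  moreover have "linear (\<lambda>t::real. t *\<^sub>R d)"
    by (simp add: linear_iff scaleR_left.add)
  ultimately have "convex ?S"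
    by (metis convex_UNIV convex_linear_image convex_translation)
  moreover have "?S \<inter> interior K = {}" using assms by auto
  ultimately obtain a b where ab: "a \<noteq> 0" "\<forall>z\<in>?S. a \<bullet> z \<le> b" "\<forall>z\<in>interior K. a \<bullet> z \<ge> b"
    using separating_hyperplane_sets[of ?S "interior K"] interior_K convex_K convex_interior
    by blast
  have ge: "a \<bullet> z \<ge> b" if "z \<in> K" for z
  proof -
    have "closure (interior K) \<subseteq> {z. a \<bullet> z \<ge> b}"
      using ab(3) by (intro closure_minimal closed_halfspace_ge) auto
    then show ?thesis using that closure_interior_K by auto
  qed
  have line: "a \<bullet> p + t * (a \<bullet> d) \<le> b" for t
    using ab(2) by (auto simp: inner_add_right)
  have ad: "a \<bullet> d = 0"
  proof (rule ccontr)
    assume "a \<bullet> d \<noteq> 0"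
    then show False using line[of "(b + 1 - a \<bullet> p) / (a \<bullet> d)"] by simp
  qed
  show thesis
  proof (rule that[of "a /\<^sub>R norm a"])
    fix z assume "z \<in> K"
    then have "a \<bullet> (z - p) \<ge> 0" using ge line[of 0] by (force simp: inner_diff_right)
    then show "(a /\<^sub>R norm a) \<bullet> (z - p) \<ge> 0" by simp
  qed (use ab(1) ad in auto)
qed

text \<open>Otherwise separation yields a support normal at \<open>x\<close> orthogonal to
  \<open>d\<close>; by smoothness it is \<open>n\<close>, which is not orthogonal to
  \<open>d\<close>.\<close>

lemma transversal_meets_interior:
  assumes "x \<in> K" "support_normals K x = {n}" "n \<bullet> d \<noteq> 0"
  shows "\<exists>t. x + t *\<^sub>R d \<in> interior K"
proof (rule ccontr)
  assume "\<nexists>t. x + t *\<^sub>R d \<in> interior K"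
  then obtain a where a: "norm a = 1" "a \<bullet> d = 0" "\<And>z. z \<in> K \<Longrightarrow> a \<bullet> (z - x) \<ge> 0"
    using line_misses_interior[of x d] by blast
  then have "- a \<in> support_normals K x" by (simp add: support_normals_iff)
  then have "n = - a" using assms(2) by auto
  then show False using a(2) assms(3) by simp
qed

text \<open>The defining inequalities are closed in the point and in the normal. This closed graph,
  together with compactness of the unit circle, is the source of all continuity of normals.\<close>

lemma support_normals_closed:
  assumes "(z \<longlongrightarrow> z0) F" "(m \<longlongrightarrow> E) F" "\<forall>\<^sub>F x in F. m x \<in> support_normals K (z x)" "F \<noteq> bot"
  shows "E \<in> support_normals K z0"
  unfolding support_normals_iff
proof (intro conjI ballI)
  have "((\<lambda>x. norm (m x)) \<longlongrightarrow> norm E) F" by (intro tendsto_intros assms)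
  moreover have "((\<lambda>x. norm (m x)) \<longlongrightarrow> 1) F"
    by (rule tendsto_eventually) (use assms(3) in \<open>auto elim!: eventually_mono simp: support_normals_iff\<close>)
  ultimately show "norm E = 1" by (rule tendsto_unique[OF assms(4)])
  fix y assume "y \<in> K"
  show "E \<bullet> (y - z0) \<le> 0"
  proof (rule tendsto_upperbound)
    show "((\<lambda>x. m x \<bullet> (y - z x)) \<longlongrightarrow> E \<bullet> (y - z0)) F"
      by (intro tendsto_intros assms)
    show "\<forall>\<^sub>F x in F. m x \<bullet> (y - z x) \<le> 0"
      using assms(3) by (rule eventually_mono) (use \<open>y \<in> K\<close> in \<open>auto simp: support_normals_iff\<close>)
  qed (rule assms(4))
qed

text \<open>Normals at points converging to \<open>z0\<close> but staying away from \<open>n\<close>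
  would accumulate at a second support normal of \<open>z0\<close>.\<close>

lemma normals_close:
  assumes "support_normals K z0 \<subseteq> {n}" "\<epsilon> > 0"
  shows "\<exists>\<delta>>0. \<forall>z m. dist z z0 < \<delta> \<longrightarrow> m \<in> support_normals K z \<longrightarrow> dist m n < \<epsilon>"
proof (rule ccontr)
  assume "\<not> ?thesis"
  then have "\<forall>k. \<exists>z m. dist z z0 < inverse (real (Suc k)) \<and> m \<in> support_normals K z \<and> \<not> dist m n < \<epsilon>"
    by (metis inverse_positive_iff_positive of_nat_0_less_iff zero_less_Suc)
  then obtain z m where zm: "\<And>k. dist (z k) z0 < inverse (real (Suc k))"
    "\<And>k. m k \<in> support_normals K (z k)" "\<And>k. \<not> dist (m k) n < \<epsilon>"
    by metis
  have "m k \<in> sphere 0 1" for k using zm(2) by (simp add: support_normals_iff)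
  then obtain l r where l: "l \<in> sphere 0 1" "strict_mono r" "(m \<circ> r) \<longlonglongrightarrow> l"
    using compact_sphere[of "0::complex" 1] unfolding compact_def by metis
  have "z \<longlonglongrightarrow> z0"
  proof (rule metric_LIMSEQ_I)
    fix e :: real assume "e > 0"
    then obtain N where "inverse (real (Suc N)) < e" using reals_Archimedean by blast
    then have "dist (z k) z0 < e" if "k \<ge> N" for k
      using zm(1)[of k] that
      by (smt (verit) inverse_le_imp_le inverse_positive_iff_positive le_imp_inverse_le of_nat_0_less_iff of_nat_mono Suc_le_mono zero_less_Suc)
    then show "\<exists>no. \<forall>n\<ge>no. dist (z n) z0 < e" by blast
  qed
  then have zr: "(\<lambda>k. z (r k)) \<longlonglongrightarrow> z0"
    using LIMSEQ_subseq_LIMSEQ[OF _ l(2)] by (auto simp: o_def)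
  have "l \<in> support_normals K z0"
    by (rule support_normals_closed[OF zr l(3)]) (use zm(2) in \<open>auto simp: o_def\<close>)
  then have "l = n" using assms(1) by blast
  then have "(\<lambda>k. dist (m (r k)) n) \<longlonglongrightarrow> 0"
    using l(3) by (auto simp: o_def intro: tendsto_dist_iff[THEN iffD1])
  then have "\<forall>\<^sub>F k in sequentially. dist (m (r k)) n < \<epsilon>"
    using assms(2) by (rule order_tendstoD)
  then show False using zm(3) by (auto simp: eventually_sequentially)
qed

lemma normals_tendsto:
  assumes "support_normals K z0 \<subseteq> {n}" "(z \<longlongrightarrow> z0) F"
    and "\<forall>\<^sub>F x in F. m x \<in> support_normals K (z x)"
  shows "(m \<longlongrightarrow> n) F"
proof (rule tendstoI)
  fix e :: real assume "e > 0"
  then obtain \<delta> where d: "\<delta> > 0" "\<And>z m. dist z z0 < \<delta> \<Longrightarrow> m \<in> support_normals K z \<Longrightarrow> dist m n < e"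
    using normals_close[OF assms(1)] by metis
  show "\<forall>\<^sub>F x in F. dist (m x) n < e"
    using tendstoD[OF assms(2) d(1)] assms(3) by eventually_elim (use d(2) in blast)
qed

text \<open>First-order contact with the tangent, obtained from two support lines: the one at
  \<open>z0\<close> bounds \<open>n \<bullet> (z - z0)\<close> from above, the one at
  \<open>z\<close> bounds it from below, up to the small difference of the two normals.\<close>

lemma frontier_flat:
  assumes "z0 \<in> K" "support_normals K z0 = {n}" "\<epsilon> > 0"
  shows "\<exists>\<delta>>0. \<forall>z\<in>frontier K. dist z z0 < \<delta> \<longrightarrow> \<bar>n \<bullet> (z - z0)\<bar> \<le> \<epsilon> * norm (z - z0)"
proof -
  obtain \<delta> where d: "\<delta> > 0" "\<And>z m. dist z z0 < \<delta> \<Longrightarrow> m \<in> support_normals K z \<Longrightarrow> dist m n < \<epsilon>"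
    using normals_close[of z0 n] assms by force
  have "\<bar>n \<bullet> (z - z0)\<bar> \<le> \<epsilon> * norm (z - z0)" if z: "z \<in> frontier K" "dist z z0 < \<delta>" for z
  proof -
    obtain m where m: "m \<in> support_normals K z" using support_normals_nonempty[OF z(1)] by blast
    have "m \<bullet> (z0 - z) \<le> 0" using m assms(1) by (simp add: support_normals_iff)
    moreover have "n \<bullet> (z - z0) \<le> 0" using assms(2) z(1) frontier_subset
      by (metis insertI1 subsetD support_normals_iff)
    moreover have "\<bar>(n - m) \<bullet> (z - z0)\<bar> \<le> norm (n - m) * norm (z - z0)"
      by (rule Cauchy_Schwarz_ineq2)
    moreover have "norm (n - m) * norm (z - z0) \<le> \<epsilon> * norm (z - z0)"
      using d(2)[OF z(2) m] by (intro mult_right_mono) (auto simp: dist_norm norm_minus_commute)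
    ultimately show ?thesis
      by (simp add: inner_diff_left inner_diff_right)
  qed
  then show ?thesis using d(1) by blast
qed

end

section \<open>First-order calculus along curves that are Lipschitz at one parameter\<close>

definition lipschitz_at :: "(real \<Rightarrow> 'a::real_normed_vector) \<Rightarrow> real \<Rightarrow> bool" where
  "lipschitz_at z t0 \<longleftrightarrow> (\<exists>C. \<forall>\<^sub>F t in at t0. norm (z t - z t0) \<le> C * \<bar>t - t0\<bar>)"

lemma lipschitz_atE:
  assumes "lipschitz_at z t0"
  obtains C where "C > 0" "\<forall>\<^sub>F t in at t0. norm (z t - z t0) \<le> C * \<bar>t - t0\<bar>"
proof -
  obtain C where C: "\<forall>\<^sub>F t in at t0. norm (z t - z t0) \<le> C * \<bar>t - t0\<bar>"
    using assms by (auto simp: lipschitz_at_def)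
  have "\<forall>\<^sub>F t in at t0. norm (z t - z t0) \<le> (\<bar>C\<bar> + 1) * \<bar>t - t0\<bar>"
    using C by eventually_elim (metis abs_ge_self abs_ge_zero add_increasing2 mult_right_mono order_trans zero_le_one)
  then show thesis using that[of "\<bar>C\<bar> + 1"] by simp
qed

lemma lipschitz_at_tendsto:
  assumes "lipschitz_at z t0"
  shows "(z \<longlongrightarrow> z t0) (at t0)"
proof -
  obtain C where C: "C > 0" "\<forall>\<^sub>F t in at t0. norm (z t - z t0) \<le> C * \<bar>t - t0\<bar>"
    using assms by (rule lipschitz_atE)
  have "((\<lambda>t. C * \<bar>t - t0\<bar>) \<longlongrightarrow> C * \<bar>t0 - t0\<bar>) (at t0)"
    by (intro tendsto_intros)
  then have "((\<lambda>t. C * \<bar>t - t0\<bar>) \<longlongrightarrow> 0) (at t0)" by simp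
  then have "((\<lambda>t. z t - z t0) \<longlongrightarrow> 0) (at t0)"
    by (rule Lim_null_comparison[OF C(2)])
  then show ?thesis by (simp add: LIM_zero_iff)
qed

lemma lipschitz_at_const: "lipschitz_at (\<lambda>_. c) t0"
  by (auto simp: lipschitz_at_def intro!: exI[of _ 0])

lemma lipschitz_at_le:
  assumes "lipschitz_at f t0" "\<forall>\<^sub>F t in at t0. norm (g t - g t0) \<le> M * norm (f t - f t0)"
  shows "lipschitz_at g t0"
proof -
  obtain C where C: "C > 0" "\<forall>\<^sub>F t in at t0. norm (f t - f t0) \<le> C * \<bar>t - t0\<bar>"
    using assms(1) by (rule lipschitz_atE)
  have "\<forall>\<^sub>F t in at t0. norm (g t - g t0) \<le> (\<bar>M\<bar> * C) * \<bar>t - t0\<bar>"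
    using C(2) assms(2)
  proof eventually_elim
    case (elim t)
    have "M * norm (f t - f t0) \<le> \<bar>M\<bar> * norm (f t - f t0)"
      by (intro mult_right_mono) auto
    also have "\<dots> \<le> \<bar>M\<bar> * (C * \<bar>t - t0\<bar>)"
      using elim by (intro mult_left_mono) auto
    finally show ?case using elim by (simp add: mult.assoc)
  qed
  then show ?thesis by (auto simp: lipschitz_at_def)
qed

lemma lipschitz_at_le2:
  fixes f :: "real \<Rightarrow> 'a::real_normed_vector" and h :: "real \<Rightarrow> 'b::real_normed_vector"
    and g :: "real \<Rightarrow> 'c::real_normed_vector"
  assumes "lipschitz_at f t0" "lipschitz_at h t0"
    and "\<forall>\<^sub>F t in at t0. norm (g t - g t0) \<le> M * (norm (f t - f t0) + norm (h t - h t0))"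
  shows "lipschitz_at g t0"
proof -
  obtain C where C: "C > 0" "\<forall>\<^sub>F t in at t0. norm (f t - f t0) \<le> C * \<bar>t - t0\<bar>"
    using assms(1) by (rule lipschitz_atE)
  obtain D where D: "D > 0" "\<forall>\<^sub>F t in at t0. norm (h t - h t0) \<le> D * \<bar>t - t0\<bar>"
    using assms(2) by (rule lipschitz_atE)
  have "\<forall>\<^sub>F t in at t0. norm (g t - g t0) \<le> (\<bar>M\<bar> * (C + D)) * \<bar>t - t0\<bar>"
    using C(2) D(2) assms(3)
  proof eventually_elim
    case (elim t)
    have "M * (norm (f t - f t0) + norm (h t - h t0)) \<le> \<bar>M\<bar> * (norm (f t - f t0) + norm (h t - h t0))"
      by (intro mult_right_mono) auto
    also have "\<dots> \<le> \<bar>M\<bar> * (C * \<bar>t - t0\<bar> + D * \<bar>t - t0\<bar>)"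
      using elim by (intro mult_left_mono) auto
    finally show ?case using elim by (simp add: mult.assoc distrib_right)
  qed
  then show ?thesis by (auto simp: lipschitz_at_def)
qed

lemma lipschitz_at_diff:
  assumes "lipschitz_at f t0" "lipschitz_at g t0"
  shows "lipschitz_at (\<lambda>t. f t - g t) t0"
proof (rule lipschitz_at_le2[OF assms, where M=1], intro always_eventually allI)
  fix t
  have eq: "f t - g t - (f t0 - g t0) = (f t - f t0) - (g t - g t0)" by simp
  show "norm (f t - g t - (f t0 - g t0)) \<le> 1 * (norm (f t - f t0) + norm (g t - g t0))"
    unfolding eq mult_1 by (rule norm_triangle_ineq4)
qed

lemma lipschitz_at_mult:
  fixes f g :: "real \<Rightarrow> complex"
  assumes "lipschitz_at f t0" "lipschitz_at g t0"
  shows "lipschitz_at (\<lambda>t. f t * g t) t0"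
proof (rule lipschitz_at_le2[OF assms])
  let ?M = "norm (f t0) + norm (g t0) + 1"
  have "\<forall>\<^sub>F t in at t0. norm (g t - g t0) < 1"
    using tendstoD[OF lipschitz_at_tendsto[OF assms(2)], of 1] by (simp add: dist_norm)
  then show "\<forall>\<^sub>F t in at t0. norm (f t * g t - f t0 * g t0) \<le> ?M * (norm (f t - f t0) + norm (g t - g t0))"
  proof eventually_elim
    case (elim t)
    have "f t * g t - f t0 * g t0 = (f t - f t0) * g t + f t0 * (g t - g t0)"
      by (simp add: algebra_simps)
    then have "norm (f t * g t - f t0 * g t0) \<le> norm (f t - f t0) * norm (g t) + norm (f t0) * norm (g t - g t0)"
      by (metis norm_mult norm_triangle_ineq)
    also have "\<dots> \<le> norm (f t - f t0) * ?M + ?M * norm (g t - g t0)"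
    proof (intro add_mono mult_left_mono mult_right_mono)
      show "norm (g t) \<le> ?M"
        using elim norm_triangle_sub[of "g t" "g t0"] norm_ge_zero[of "f t0"] by linarith
      show "norm (f t0) \<le> ?M" using norm_ge_zero[of "g t0"] by linarith
    qed auto
    finally show ?case by (simp add: algebra_simps)
  qed
qed

lemma lipschitz_at_cnj:
  assumes "lipschitz_at f t0"
  shows "lipschitz_at (\<lambda>t. cnj (f t)) t0"
  by (rule lipschitz_at_le[OF assms, where M=1]) (simp flip: complex_cnj_diff)

lemma lipschitz_at_reflect:
  assumes "lipschitz_at f t0" "lipschitz_at g t0"
  shows "lipschitz_at (\<lambda>t. reflect (f t) (g t)) t0"
proof -
  have "lipschitz_at (\<lambda>t. (- 1) * ((f t * f t) * cnj (g t))) t0"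
    by (intro lipschitz_at_mult lipschitz_at_cnj assms lipschitz_at_const)
  then show ?thesis by (simp add: reflect_def power2_eq_square)
qed

lemma lipschitz_at_deriv:
  assumes "(f has_vector_derivative D) (at t0)"
  shows "lipschitz_at f t0"
proof -
  obtain d where d: "d > 0" "\<And>t. norm (t - t0) < d \<Longrightarrow> norm (f t - f t0 - (t - t0) *\<^sub>R D) \<le> 1 * norm (t - t0)"
    using assms unfolding has_vector_derivative_def has_derivative_at_alt by (meson zero_less_one)
  have "norm (f t - f t0) \<le> (norm D + 1) * \<bar>t - t0\<bar>" if "norm (t - t0) < d" for t
  proof -
    have "norm (f t - f t0) \<le> norm (f t - f t0 - (t - t0) *\<^sub>R D) + norm ((t - t0) *\<^sub>R D)"
      using norm_triangle_sub[of "f t - f t0" "(t - t0) *\<^sub>R D"] by linarith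
    also have "\<dots> \<le> 1 * norm (t - t0) + \<bar>t - t0\<bar> * norm D"
      using d(2)[OF that] by (intro add_mono) auto
    finally show ?thesis by (simp add: algebra_simps)
  qed
  then have "\<forall>\<^sub>F t in at t0. norm (f t - f t0) \<le> (norm D + 1) * \<bar>t - t0\<bar>"
    using d(1) by (auto simp: eventually_at dist_norm)
  then show ?thesis by (auto simp: lipschitz_at_def)
qed

lemma has_real_derivative_zeroI:
  fixes f :: "real \<Rightarrow> real"
  assumes "\<And>\<epsilon>. \<epsilon> > 0 \<Longrightarrow> \<forall>\<^sub>F t in at t0. \<bar>f t - f t0\<bar> \<le> \<epsilon> * \<bar>t - t0\<bar>"
  shows "(f has_real_derivative 0) (at t0)"
  unfolding has_field_derivative_iff
proof (rule tendstoI)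
  fix e :: real assume "e > 0"
  then have "\<forall>\<^sub>F t in at t0. \<bar>f t - f t0\<bar> \<le> (e / 2) * \<bar>t - t0\<bar>"
    using assms[of "e / 2"] by simp
  moreover have "\<forall>\<^sub>F t in at t0. t \<noteq> t0"
    by (simp add: eventually_at_filter)
  ultimately show "\<forall>\<^sub>F t in at t0. dist ((f t - f t0) / (t - t0)) 0 < e"
  proof eventually_elim
    case (elim t)
    then have "\<bar>f t - f t0\<bar> / \<bar>t - t0\<bar> \<le> e / 2" by (simp add: divide_simps)
    then have "\<bar>f t - f t0\<bar> / \<bar>t - t0\<bar> < e" using \<open>e > 0\<close> by linarith
    then show ?case by (simp add: abs_divide)
  qed
qed

text \<open>A chain rule that makes no use of a derivative of \<open>z\<close>: on \<open>S\<close>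
  the increment of \<open>f\<close> is of smaller order than \<open>norm (w - z t0)\<close>, and
  along \<open>z\<close> this distance is at most a multiple of
  \<open>\<bar>t - t0\<bar>\<close>.\<close>

lemma has_real_derivative_zero_compose:
  fixes f :: "'a::real_normed_vector \<Rightarrow> real"
  assumes z: "lipschitz_at z t0"
    and f: "\<And>\<epsilon>. \<epsilon> > 0 \<Longrightarrow> \<exists>\<delta>>0. \<forall>w\<in>S. dist w (z t0) < \<delta> \<longrightarrow> \<bar>f w - f (z t0)\<bar> \<le> \<epsilon> * norm (w - z t0)"
    and S: "\<forall>\<^sub>F t in at t0. z t \<in> S"
  shows "((\<lambda>t. f (z t)) has_real_derivative 0) (at t0)"
proof (rule has_real_derivative_zeroI)
  fix \<epsilon> :: real assume "\<epsilon> > 0"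
  obtain C where C: "C > 0" "\<forall>\<^sub>F t in at t0. norm (z t - z t0) \<le> C * \<bar>t - t0\<bar>"
    using z by (rule lipschitz_atE)
  obtain \<delta> where d: "\<delta> > 0" "\<And>w. w \<in> S \<Longrightarrow> dist w (z t0) < \<delta> \<Longrightarrow> \<bar>f w - f (z t0)\<bar> \<le> (\<epsilon> / C) * norm (w - z t0)"
    using f[of "\<epsilon> / C"] \<open>\<epsilon> > 0\<close> C(1) by auto
  have "\<forall>\<^sub>F t in at t0. dist (z t) (z t0) < \<delta>"
    using tendstoD[OF lipschitz_at_tendsto[OF z] d(1)] .
  with C(2) S show "\<forall>\<^sub>F t in at t0. \<bar>f (z t) - f (z t0)\<bar> \<le> \<epsilon> * \<bar>t - t0\<bar>"
  proof eventually_elim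
    case (elim t)
    then have "\<bar>f (z t) - f (z t0)\<bar> \<le> (\<epsilon> / C) * norm (z t - z t0)" using d(2) by blast
    also have "\<dots> \<le> (\<epsilon> / C) * (C * \<bar>t - t0\<bar>)"
      using elim \<open>\<epsilon> > 0\<close> C(1) by (intro mult_left_mono) auto
    finally show ?case using C(1) by simp
  qed
qed

lemma norm_first_order:
  fixes w0 :: complex
  assumes "w0 \<noteq> 0" "\<epsilon> > 0"
  shows "\<exists>\<delta>>0. \<forall>w. dist w w0 < \<delta> \<longrightarrow>
    \<bar>(norm w - (w0 /\<^sub>R norm w0) \<bullet> w) - (norm w0 - (w0 /\<^sub>R norm w0) \<bullet> w0)\<bar> \<le> \<epsilon> * norm (w - w0)"
proof -
  have "(norm has_derivative (\<lambda>h. sgn w0 \<bullet> h)) (at w0)"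
    using has_derivative_norm[OF assms(1)] by (simp add: inner_commute)
  then obtain \<delta> where d: "\<delta> > 0" "\<And>w. norm (w - w0) < \<delta> \<Longrightarrow> norm (norm w - norm w0 - sgn w0 \<bullet> (w - w0)) \<le> \<epsilon> * norm (w - w0)"
    using assms(2) unfolding has_derivative_at_alt by blast
  then show ?thesis
    by (intro exI[of _ \<delta>]) (auto simp: dist_norm sgn_div_norm inner_diff_right algebra_simps)
qed

text \<open>First variation of a length. The linear part \<open>u \<bullet> w t\<close> is
  subtracted and not differentiated; the linear parts of all sides of a polygon are collected later,
  where the reflection law turns them into normals.\<close>

lemma norm_compose_derivative:
  fixes w :: "real \<Rightarrow> complex"
  assumes "lipschitz_at w t0" "w t0 = c *\<^sub>R u" "norm u = 1" "c > 0"
  shows "((\<lambda>t. norm (w t) - u \<bullet> w t) has_real_derivative 0) (at t0)"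
proof -
  have u: "u = w t0 /\<^sub>R norm (w t0)" and "w t0 \<noteq> 0" using assms by auto
  show ?thesis
    by (rule has_real_derivative_zero_compose[OF assms(1), where S=UNIV])
       (use norm_first_order[OF \<open>w t0 \<noteq> 0\<close>] u in auto)
qed

text \<open>Every sequence tending to 0 has a subsequence with convergent values, and all such
  limits agree. The sequences compared may approach 0 from different sides, which makes the limit
  two-sided.\<close>

lemma limit_exists_compact:
  fixes f :: "real \<Rightarrow> complex"
  assumes S: "compact S" and f: "\<forall>\<^sub>F t in at 0. f t \<in> S"
    and uniq: "\<And>s s' E E'. \<lbrakk>filterlim s (at 0) sequentially; filterlim s' (at 0) sequentially;
      (\<lambda>k. f (s k)) \<longlonglongrightarrow> E; (\<lambda>k. f (s' k)) \<longlonglongrightarrow> E'\<rbrakk> \<Longrightarrow> E = E'"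
  shows "\<exists>E. (f \<longlongrightarrow> E) (at 0)"
proof -
  have sub: "\<exists>r E. strict_mono (r :: nat \<Rightarrow> nat) \<and> (\<lambda>k. f (s (r k))) \<longlonglongrightarrow> E"
    if "filterlim s (at 0) sequentially" for s :: "nat \<Rightarrow> real"
  proof -
    have "\<forall>\<^sub>F k in sequentially. f (s k) \<in> S"
      using f that by (rule eventually_compose_filterlim)
    then obtain N where N: "\<And>k. k \<ge> N \<Longrightarrow> f (s k) \<in> S"
      by (auto simp: eventually_sequentially)
    then have "\<forall>k. f (s (k + N)) \<in> S" by simp
    then obtain r E where r: "strict_mono r" "((\<lambda>k. f (s (k + N))) \<circ> r) \<longlonglongrightarrow> E"
      using S unfolding compact_def by meson
    have "strict_mono (\<lambda>k. r k + N)" using r(1) by (simp add: strict_mono_def)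
    then show ?thesis using r(2) by (auto simp: o_def)
  qed
  have seq0: "filterlim (\<lambda>k. inverse (real (Suc k))) (at 0) sequentially"
    using LIMSEQ_inverse_real_of_nat by (simp add: filterlim_at)
  obtain r E where rE: "strict_mono r" "(\<lambda>k. f (inverse (real (Suc (r k))))) \<longlonglongrightarrow> E"
    using sub[OF seq0] by auto
  have s1: "filterlim (\<lambda>k. inverse (real (Suc (r k)))) (at 0) sequentially"
    using filterlim_compose[OF seq0 filterlim_subseq[OF rE(1)]] .
  have "(f \<longlongrightarrow> E) (at 0)"
    unfolding tendsto_at_iff_sequentially
  proof (intro allI impI, rule ccontr)
    fix s :: "nat \<Rightarrow> real"
    assume s: "\<forall>i. s i \<in> UNIV - {0}" "s \<longlonglongrightarrow> 0" and not: "\<not> (f \<circ> s) \<longlonglongrightarrow> E"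
    have s2: "filterlim s (at 0) sequentially" using s by (simp add: filterlim_at)
    obtain e where e: "e > 0" "\<exists>\<^sub>F k in sequentially. \<not> dist (f (s k)) E < e"
      using not by (auto simp: tendsto_iff not_eventually)
    then have "infinite {k. \<not> dist (f (s k)) E < e}"
      by (simp add: frequently_cofinite cofinite_eq_sequentially[symmetric])
    then obtain q :: "nat \<Rightarrow> nat" where "strict_mono q" "\<forall>k. q k \<in> {k. \<not> dist (f (s k)) E < e}"
      using infinite_enumerate by blast
    then have q: "strict_mono q" "\<And>k. \<not> dist (f (s (q k))) E < e" by auto
    have s3: "filterlim (\<lambda>k. s (q k)) (at 0) sequentially"
      using filterlim_compose[OF s2 filterlim_subseq[OF q(1)]] .
    obtain r' E' where r': "strict_mono r'" "(\<lambda>k. f (s (q (r' k)))) \<longlonglongrightarrow> E'"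
      using sub[OF s3] by auto
    have "filterlim (\<lambda>k. s (q (r' k))) (at 0) sequentially"
      using filterlim_compose[OF s3 filterlim_subseq[OF r'(1)]] .
    then have "E = E'" using uniq[OF s1 _ rE(2) r'(2)] by blast
    then have "\<forall>\<^sub>F k in sequentially. dist (f (s (q (r' k)))) E < e"
      using r'(2) e(1) tendstoD by blast
    then show False using q(2) by (auto simp: eventually_sequentially)
  qed
  then show ?thesis by blast
qed

text \<open>The limit \<open>z0\<close> may itself be exceptional; it is excluded because
  \<open>z\<close> leaves it, the other points of \<open>A\<close> because they keep a positive
  distance.\<close>

lemma eventually_avoid_finite:
  fixes z :: "real \<Rightarrow> complex"
  assumes "finite A" "(z \<longlongrightarrow> z0) F" "\<forall>\<^sub>F \<theta> in F. z \<theta> \<noteq> z0"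
  shows "\<forall>\<^sub>F \<theta> in F. z \<theta> \<notin> A"
proof -
  have "\<forall>\<^sub>F \<theta> in F. z \<theta> \<noteq> a" for a
  proof (cases "a = z0")
    case False
    then show ?thesis
      using tendsto_imp_eventually_ne[OF assms(2), of a] by blast
  qed (use assms(3) in simp)
  then have "\<forall>\<^sub>F \<theta> in F. \<forall>a\<in>A. z \<theta> \<noteq> a"
    using assms(1) by (intro eventually_ball_finite) auto
  then show ?thesis by (rule eventually_mono) blast
qed

lemma tendsto_cis: "(f \<longlongrightarrow> a) F \<Longrightarrow> ((\<lambda>x. cis (f x)) \<longlongrightarrow> cis a) F"
  unfolding cis_conv_exp by (intro tendsto_intros)

lemma cis_ray_injective:
  assumes "cis \<theta> * w = c *\<^sub>R w" "w \<noteq> 0" "\<bar>\<theta>\<bar> < pi"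
  shows "\<theta> = 0"
proof -
  have "cis \<theta> = of_real c"
    using assms(1,2) by (simp add: scaleR_conv_of_real)
  then have "sin \<theta> = 0" by (auto simp: complex_eq_iff)
  then show ?thesis using assms(3) sin_zero_pi_iff by blast
qed

text \<open>Distinct lines through \<open>p\<close> meet only in \<open>p\<close>. Hence a rotated
  line meets a boundary away from the original point, as \<open>eventually_avoid_finite\<close>
  demands.\<close>

lemma rotated_ray_ne:
  assumes "w \<noteq> 0"
  shows "\<forall>\<^sub>F \<theta> in at (0::real). \<forall>s t. t \<noteq> 0 \<longrightarrow> p + s *\<^sub>R (cis \<theta> * w) \<noteq> p + t *\<^sub>R w"
proof -
  have "\<forall>\<^sub>F \<theta> in at (0::real). \<bar>\<theta>\<bar> < pi"
    using tendstoD[OF tendsto_ident_at, of pi "0::real" UNIV] by (simp add: dist_real_def)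
  moreover have "\<forall>\<^sub>F \<theta> in at (0::real). \<theta> \<noteq> 0" by (simp add: eventually_at_filter)
  ultimately show ?thesis
  proof (eventually_elim, intro allI impI notI)
    fix \<theta> s t :: real assume th: "\<bar>\<theta>\<bar> < pi" "\<theta> \<noteq> 0" "t \<noteq> 0" and eq: "p + s *\<^sub>R (cis \<theta> * w) = p + t *\<^sub>R w"
    have "s \<noteq> 0" using eq th(3) assms by auto
    then have "cis \<theta> * w = (t / s) *\<^sub>R w"
      using eq by (metis add_left_cancel divide_inverse_commute inverse_nonzero_iff_nonzero real_vector_eq_affinity scaleR_one scaleR_scaleR left_inverse)
    then show False using cis_ray_injective assms th by blast
  qed
qed

lemma reverse_rotated_ray_ne:
  assumes "w \<noteq> 0"
  shows "\<forall>\<^sub>F \<theta> in at (0::real). \<forall>s t. t \<noteq> 0 \<longrightarrow> p + s *\<^sub>R (cis (- \<theta>) * w) \<noteq> p + t *\<^sub>R w"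
proof -
  have "filterlim uminus (at 0) (at (0::real))"
    using filtermap_at_minus[of "0::real"] by (simp add: filterlim_def)
  from eventually_compose_filterlim[OF rotated_ray_ne[OF assms, of p] this] show ?thesis .
qed

section \<open>Dependence of the exit point on the line\<close>

context convex_body
begin

text \<open>Continuity needs the limit line to cross the interior. Points shortly before the exit
  are then interior and stay in \<open>K\<close> for nearby lines; a point after it stays outside
  the closed set \<open>K\<close>, and by convexity a nearby line cannot re-enter later.\<close>

lemma exit_time_tendsto:
  assumes p: "(p \<longlongrightarrow> p0) F" and d: "(d \<longlongrightarrow> d0) F"
    and int: "p0 + t1 *\<^sub>R d0 \<in> interior K" and ex0: "exits K (p0 + t0 *\<^sub>R d0) d0"
    and ex: "\<forall>\<^sub>F x in F. exits K (p x + t x *\<^sub>R d x) (d x)"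
  shows "(t \<longlongrightarrow> t0) F"
proof -
  have d0: "d0 \<noteq> 0" using ex0 unfolding exits_def by (metis add.right_neutral scaleR_zero_right zero_less_one)
  have "t1 \<le> t0" using exits_le[OF ex0] int interior_subset by blast
  moreover have "t1 \<noteq> t0" using exits_frontier[OF ex0 d0] int by (auto simp: frontier_def)
  ultimately have t10: "t1 < t0" by simp
  have inside: "p0 + u *\<^sub>R d0 \<in> interior K" if "t1 < u" "u < t0" for u
  proof -
    let ?e = "(t0 - u) / (t0 - t1)"
    have "(p0 + t0 *\<^sub>R d0) - ?e *\<^sub>R ((p0 + t0 *\<^sub>R d0) - (p0 + t1 *\<^sub>R d0)) \<in> interior K"
      using that ex0 by (intro mem_interior_convex_shrink[OF convex_K int]) (auto simp: exits_def)
    also have "(p0 + t0 *\<^sub>R d0) - (p0 + t1 *\<^sub>R d0) = (t0 - t1) *\<^sub>R d0" by (simp add: algebra_simps)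
    also have "?e *\<^sub>R (t0 - t1) *\<^sub>R d0 = (t0 - u) *\<^sub>R d0"
      using t10 by simp
    also have "(p0 + t0 *\<^sub>R d0) - (t0 - u) *\<^sub>R d0 = p0 + u *\<^sub>R d0"
      by (simp add: algebra_simps)
    finally show ?thesis .
  qed
  have lim: "((\<lambda>x. p x + u *\<^sub>R d x) \<longlongrightarrow> p0 + u *\<^sub>R d0) F" for u
    by (intro tendsto_intros p d)
  have inK: "\<forall>\<^sub>F x in F. p x + u *\<^sub>R d x \<in> K" if "t1 < u" "u < t0" for u
    using topological_tendstoD[OF lim open_interior inside[OF that]]
    by (rule eventually_mono) (use interior_subset in blast)
  have lower: "\<forall>\<^sub>F x in F. u < t x" if "u < t0" for u
  proof -
    have "max u t1 < t0" using that t10 by simp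
    then obtain u' where "max u t1 < u'" "u' < t0" using dense by blast
    then have u': "t1 < u'" "u < u'" "u' < t0" by auto
    show ?thesis using inK[OF u'(1,3)] ex
      by eventually_elim (use exits_le u'(2) in fastforce)
  qed
  show ?thesis
  proof (rule order_tendstoI)
    fix u assume "t0 < u"
    then have "p0 + u *\<^sub>R d0 \<in> - K" using exits_le[OF ex0] by fastforce
    then have 1: "\<forall>\<^sub>F x in F. p x + u *\<^sub>R d x \<in> - K"
      using closed_K by (intro topological_tendstoD[OF lim]) auto
    obtain u' where u': "t1 < u'" "u' < t0" using dense t10 by blast
    show "\<forall>\<^sub>F x in F. t x < u"
      using 1 inK[OF u'] ex
    proof eventually_elim
      case (elim x)
      show "t x < u"
      proof (rule ccontr)
        assume "\<not> t x < u"
        then have tx: "u \<le> t x" by simp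
        define e where "e = (u - u') / (t x - u')"
        have "u' < t x" using tx u' \<open>t0 < u\<close> by simp
        then have e: "0 \<le> e" "e \<le> 1" using tx u' \<open>t0 < u\<close> by (auto simp: e_def)
        have "(1 - e) *\<^sub>R (p x + u' *\<^sub>R d x) + e *\<^sub>R (p x + t x *\<^sub>R d x) \<in> K"
          using elim e by (intro convexD_alt[OF convex_K]) (auto simp: exits_def)
        also have "(1 - e) *\<^sub>R (p x + u' *\<^sub>R d x) + e *\<^sub>R (p x + t x *\<^sub>R d x)
            = p x + (u' + e * (t x - u')) *\<^sub>R d x"
          by (simp add: algebra_simps)
        also have "u' + e * (t x - u') = u" using \<open>u' < t x\<close> by (simp add: e_def)
        finally show False using elim by simp
      qed
    qed
  qed (rule lower)
qed

lemma eventually_exits_hit: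
  assumes p: "(p \<longlongrightarrow> p0) F" and d: "(d \<longlongrightarrow> d0) F" and "d0 \<noteq> 0"
    and int: "p0 + t1 *\<^sub>R d0 \<in> interior K"
  shows "\<forall>\<^sub>F x in F. exits K (hit K (p x) (d x)) (d x) \<and> p x + t1 *\<^sub>R d x \<in> interior K \<and> d x \<noteq> 0
     \<and> (\<exists>t. hit K (p x) (d x) = p x + t *\<^sub>R d x)"
proof -
  have "((\<lambda>x. p x + t1 *\<^sub>R d x) \<longlongrightarrow> p0 + t1 *\<^sub>R d0) F" by (intro tendsto_intros p d)
  then have "\<forall>\<^sub>F x in F. p x + t1 *\<^sub>R d x \<in> interior K"
    by (rule topological_tendstoD[OF _ open_interior int])
  moreover have "\<forall>\<^sub>F x in F. d x \<noteq> 0"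
    by (rule tendsto_imp_eventually_ne[OF d \<open>d0 \<noteq> 0\<close>])
  ultimately show ?thesis
    by eventually_elim (use exits_hit interior_subset in blast)
qed

lemma hit_time:
  assumes p: "(p \<longlongrightarrow> p0) F" and d: "(d \<longlongrightarrow> d0) F" and d0: "d0 \<noteq> 0"
    and int: "p0 + t1 *\<^sub>R d0 \<in> interior K"
  obtains t t0 where "\<forall>\<^sub>F x in F. hit K (p x) (d x) = p x + t x *\<^sub>R d x \<and> exits K (p x + t x *\<^sub>R d x) (d x)"
    "hit K p0 d0 = p0 + t0 *\<^sub>R d0" "exits K (p0 + t0 *\<^sub>R d0) d0" "(t \<longlongrightarrow> t0) F"
proof -
  define t where "t x = (SOME t. hit K (p x) (d x) = p x + t *\<^sub>R d x)" for x
  have ev: "\<forall>\<^sub>F x in F. hit K (p x) (d x) = p x + t x *\<^sub>R d x \<and> exits K (p x + t x *\<^sub>R d x) (d x)"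
    using eventually_exits_hit[OF p d d0 int]
  proof eventually_elim
    case (elim x)
    then have "hit K (p x) (d x) = p x + t x *\<^sub>R d x"
      unfolding t_def by (metis (mono_tags, lifting) someI_ex)
    then show ?case using elim by simp
  qed
  obtain t0 where t0: "hit K p0 d0 = p0 + t0 *\<^sub>R d0" "exits K (p0 + t0 *\<^sub>R d0) d0"
    using exits_hit[of p0 t1 d0] int d0 interior_subset by (metis subsetD)
  have "(t \<longlongrightarrow> t0) F"
    by (rule exit_time_tendsto[OF p d int t0(2)]) (use ev in \<open>auto elim: eventually_mono\<close>)
  then show thesis using that ev t0 by blast
qed

lemma hit_tendsto:
  assumes p: "(p \<longlongrightarrow> p0) F" and d: "(d \<longlongrightarrow> d0) F" and d0: "d0 \<noteq> 0"
    and int: "p0 + t1 *\<^sub>R d0 \<in> interior K"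
  shows "((\<lambda>x. hit K (p x) (d x)) \<longlongrightarrow> hit K p0 d0) F"
proof -
  obtain t t0 where t: "\<forall>\<^sub>F x in F. hit K (p x) (d x) = p x + t x *\<^sub>R d x \<and> exits K (p x + t x *\<^sub>R d x) (d x)"
    "hit K p0 d0 = p0 + t0 *\<^sub>R d0" "exits K (p0 + t0 *\<^sub>R d0) d0" "(t \<longlongrightarrow> t0) F"
    using hit_time[OF assms] by blast
  have "((\<lambda>x. p x + t x *\<^sub>R d x) \<longlongrightarrow> hit K p0 d0) F"
    unfolding t(2) by (intro tendsto_intros p d t)
  then show ?thesis
    by (rule Lim_transform_eventually) (use t(1) in \<open>auto elim: eventually_mono\<close>)
qed

text \<open>Transversality against flatness: a change \<open>t x - t0\<close> of the exit time moves
  the point by \<open>n \<bullet> d0 > 0\<close> per unit in the normal direction, while the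
  boundary allows only a small fraction of the displacement there. So the change of time is
  controlled by the displacement \<open>q\<close> of the line.\<close>

lemma hit_lipschitz:
  fixes p d :: "'b \<Rightarrow> complex"
  assumes p: "(p \<longlongrightarrow> p0) F" and d: "(d \<longlongrightarrow> d0) F" and d0: "d0 \<noteq> 0"
    and int: "p0 + t1 *\<^sub>R d0 \<in> interior K"
    and sn: "support_normals K (hit K p0 d0) = {n}"
  shows "\<exists>C. \<forall>\<^sub>F x in F. norm (hit K (p x) (d x) - hit K p0 d0) \<le> C * (norm (p x - p0) + norm (d x - d0))"
proof -
  obtain t t0 where t: "\<forall>\<^sub>F x in F. hit K (p x) (d x) = p x + t x *\<^sub>R d x \<and> exits K (p x + t x *\<^sub>R d x) (d x)"
    "hit K p0 d0 = p0 + t0 *\<^sub>R d0" "exits K (p0 + t0 *\<^sub>R d0) d0" "(t \<longlongrightarrow> t0) F"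
    using hit_time[OF p d d0 int] by blast
  have int': "(p0 + t0 *\<^sub>R d0) + (t1 - t0) *\<^sub>R d0 \<in> interior K"
    using int by (simp add: algebra_simps)
  define k where "k = n \<bullet> d0"
  have k: "k > 0"
    using exits_transversal[OF t(3) int'] sn t(2) by (auto simp: k_def)
  define c where "c = \<bar>t0\<bar> + 2"
  have c: "c \<ge> 2" by (simp add: c_def)
  define e where "e x = norm (p x - p0) + norm (d x - d0)" for x
  have nn: "norm n = 1" using sn by (auto simp: support_normals_iff dest: equalityD2)
  have "norm d0 > 0" using d0 by simp
  \<comment> \<open>Chosen so that flatness costs at most \<open>k / 2\<close> per unit of time,
    half of what transversality yields; the summand 1 also gives
    \<open>\<epsilon> \<le> k\<close>.\<close>
  define \<epsilon> where "\<epsilon> = k / (2 * (1 + norm d0))"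
  have eps: "\<epsilon> > 0" "\<epsilon> \<le> k" "\<epsilon> * norm d0 \<le> k / 2"
  proof -
    show "\<epsilon> > 0" using k by (auto simp: \<epsilon>_def intro!: divide_pos_pos add_pos_nonneg)
    have "\<epsilon> * (1 + norm d0) = k / 2"
      unfolding \<epsilon>_def using norm_ge_zero[of d0] by (simp add: field_simps del: norm_ge_zero)
    then show "\<epsilon> \<le> k" "\<epsilon> * norm d0 \<le> k / 2"
      using \<open>\<epsilon> > 0\<close> k by (simp_all add: distrib_left) (smt (verit) mult_nonneg_nonneg norm_ge_zero)
  qed
  have z0K: "hit K p0 d0 \<in> K" using t(2,3) by (simp add: exits_def)
  obtain \<delta> where dl: "\<delta> > 0" "\<And>z. z \<in> frontier K \<Longrightarrow> dist z (hit K p0 d0) < \<delta> \<Longrightarrow>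
      \<bar>n \<bullet> (z - hit K p0 d0)\<bar> \<le> \<epsilon> * norm (z - hit K p0 d0)"
    using frontier_flat[OF z0K sn eps(1)] by blast
  have "\<forall>\<^sub>F x in F. \<bar>t x - t0\<bar> < 1"
    using tendstoD[OF t(4), of 1] by (simp add: dist_real_def)
  moreover have "\<forall>\<^sub>F x in F. dist (hit K (p x) (d x)) (hit K p0 d0) < \<delta>"
    using tendstoD[OF hit_tendsto[OF p d d0 int] dl(1)] .
  moreover have "\<forall>\<^sub>F x in F. d x \<noteq> 0"
    by (rule tendsto_imp_eventually_ne[OF d \<open>d0 \<noteq> 0\<close>])
  ultimately have "\<forall>\<^sub>F x in F. norm (hit K (p x) (d x) - hit K p0 d0)
      \<le> (c + norm d0 * (2 * (k + 1) * c / k)) * e x"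
    using t(1)
  proof eventually_elim
    case (elim x)
    define z where "z = hit K (p x) (d x)"
    define q where "q = (p x - p0) + t x *\<^sub>R (d x - d0)"
    have zz: "z - hit K p0 d0 = q + (t x - t0) *\<^sub>R d0"
      unfolding z_def q_def using elim t(2) by (simp add: algebra_simps)
    have "norm q \<le> norm (p x - p0) + \<bar>t x\<bar> * norm (d x - d0)"
      unfolding q_def by (metis norm_scaleR norm_triangle_ineq)
    also have "\<dots> \<le> c * norm (p x - p0) + c * norm (d x - d0)"
      using elim c by (intro add_mono mult_right_mono) (auto simp: c_def mult_le_cancel_right1)
    finally have q: "norm q \<le> c * e x" by (simp add: e_def distrib_left)
    have "z \<in> frontier K"
      unfolding z_def using elim exits_frontier by metis
    then have "\<bar>n \<bullet> (z - hit K p0 d0)\<bar> \<le> \<epsilon> * norm (z - hit K p0 d0)"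
      using dl(2) elim z_def by blast
    also have "\<dots> \<le> \<epsilon> * (norm q + \<bar>t x - t0\<bar> * norm d0)"
      unfolding zz using eps(1) by (intro mult_left_mono) (metis norm_scaleR norm_triangle_ineq, simp)
    also have "\<dots> = \<epsilon> * norm q + (\<epsilon> * norm d0) * \<bar>t x - t0\<bar>"
      by (simp add: algebra_simps)
    also have "\<dots> \<le> k * norm q + (k / 2) * \<bar>t x - t0\<bar>"
      using eps by (intro add_mono mult_right_mono) auto
    finally have 1: "\<bar>n \<bullet> (z - hit K p0 d0)\<bar> \<le> k * norm q + (k / 2) * \<bar>t x - t0\<bar>" .
    have 2: "\<bar>n \<bullet> q\<bar> \<le> norm q" using Cauchy_Schwarz_ineq2[of n q] nn by simp
    have 3: "n \<bullet> (z - hit K p0 d0) = n \<bullet> q + (t x - t0) * k"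
      unfolding zz k_def by (simp add: inner_add_right)
    have "k * \<bar>t x - t0\<bar> = \<bar>(t x - t0) * k\<bar>" using k by (simp add: abs_mult)
    also have "\<dots> \<le> \<bar>n \<bullet> (z - hit K p0 d0)\<bar> + \<bar>n \<bullet> q\<bar>" using 3 by linarith
    also have "\<dots> \<le> k * norm q + (k / 2) * \<bar>t x - t0\<bar> + norm q" using 1 2 by linarith
    finally have "(k / 2) * \<bar>t x - t0\<bar> \<le> (k + 1) * norm q" by (simp add: algebra_simps)
    also have "\<dots> \<le> (k + 1) * (c * e x)" using q k by (intro mult_left_mono) auto
    finally have 4: "\<bar>t x - t0\<bar> \<le> (2 * (k + 1) * c / k) * e x"
      using k by (simp add: field_simps)
    have "norm (z - hit K p0 d0) \<le> norm q + \<bar>t x - t0\<bar> * norm d0"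
      unfolding zz by (metis norm_scaleR norm_triangle_ineq)
    also have "\<dots> \<le> c * e x + ((2 * (k + 1) * c / k) * e x) * norm d0"
      using q 4 by (intro add_mono mult_right_mono) auto
    finally show ?case by (simp add: z_def algebra_simps)
  qed
  then show ?thesis unfolding e_def by blast
qed

text \<open>A boundary point is smooth as soon as the normals at the boundary points seen from \<open>p\<close>
  on its two sides have the same limit.\<close>

lemma two_sided_normal_limit:
  assumes z0: "z0 \<in> frontier K" "z0 = p + t0 *\<^sub>R w" "t0 > 0"
    and z: "\<forall>\<^sub>F \<theta> in at 0. z \<theta> = p + t \<theta> *\<^sub>R (cis \<theta> * w)" "(t \<longlongrightarrow> t0) (at 0)"
    and zK: "\<forall>\<^sub>F \<theta> in at 0. z \<theta> \<in> K"
    and m: "\<forall>\<^sub>F \<theta> in at 0. m \<theta> \<in> support_normals K (z \<theta>)" "(m \<longlongrightarrow> E) (at (0::real))"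
    and Ew: "E \<bullet> w \<noteq> 0"
  shows "support_normals K z0 = {E}"
proof -
  have zlim: "(z \<longlongrightarrow> z0) (at 0)"
  proof -
    have "((\<lambda>\<theta>. p + t \<theta> *\<^sub>R (cis \<theta> * w)) \<longlongrightarrow> p + t0 *\<^sub>R (cis 0 * w)) (at 0)"
      by (intro tendsto_intros z(2) tendsto_cis)
    then have "((\<lambda>\<theta>. p + t \<theta> *\<^sub>R (cis \<theta> * w)) \<longlongrightarrow> z0) (at 0)"
      using z0(2) by simp
    then show ?thesis
      by (rule Lim_transform_eventually) (use z(1) in \<open>auto elim: eventually_mono\<close>)
  qed
  have z0K: "z0 \<in> K" using z0(1) frontier_subset by blast
  have E: "E \<in> support_normals K z0"
    by (rule support_normals_closed[OF zlim m(2,1)]) simp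
  have nE: "norm E = 1" using E by (simp add: support_normals_iff)
  define \<tau> where "\<tau> = \<i> * E"
  have "l = E" if l: "l \<in> support_normals K z0" for l
  proof -
    have nl: "norm l = 1" using l by (simp add: support_normals_iff)
    define \<alpha> where "\<alpha> \<theta> = E \<bullet> (z \<theta> - z0)" for \<theta>
    define \<beta> where "\<beta> \<theta> = \<tau> \<bullet> (z \<theta> - z0)" for \<theta>
    have dec: "z \<theta> - z0 = \<alpha> \<theta> *\<^sub>R E + \<beta> \<theta> *\<^sub>R \<tau>" for \<theta>
      using unit_decomp[OF nE, of "z \<theta> - z0"] by (simp add: \<alpha>_def \<beta>_def \<tau>_def)
    text \<open>The ratio \<open>\<alpha> / \<beta>\<close> tends to 0, and \<open>\<beta>\<close> changes sign with \<open>\<theta>\<close>.\<close>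
    have ev: "\<forall>\<^sub>F \<theta> in at 0. \<bar>\<alpha> \<theta>\<bar> * (m \<theta> \<bullet> E) \<le> \<bar>\<beta> \<theta>\<bar> * \<bar>m \<theta> \<bullet> \<tau>\<bar> \<and> \<alpha> \<theta> * (l \<bullet> E) + \<beta> \<theta> * (l \<bullet> \<tau>) \<le> 0
        \<and> \<alpha> \<theta> * (w \<bullet> \<tau>) * (-1) + \<beta> \<theta> * (w \<bullet> E) = t \<theta> * sin \<theta> * (norm w)\<^sup>2"
      using m(1) zK z(1)
    proof eventually_elim
      case (elim \<theta>)
      have a: "\<alpha> \<theta> \<le> 0" using E elim(2) by (simp add: \<alpha>_def support_normals_iff)
      have "m \<theta> \<bullet> (z0 - z \<theta>) \<le> 0" using elim(1) z0K by (simp add: support_normals_iff)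
      then have "m \<theta> \<bullet> (z \<theta> - z0) \<ge> 0" by (simp add: inner_diff_right)
      then have "\<alpha> \<theta> * (m \<theta> \<bullet> E) + \<beta> \<theta> * (m \<theta> \<bullet> \<tau>) \<ge> 0"
        unfolding dec by (simp add: inner_add_right)
      then have "\<bar>\<alpha> \<theta>\<bar> * (m \<theta> \<bullet> E) \<le> \<beta> \<theta> * (m \<theta> \<bullet> \<tau>)" using a by simp
      also have "\<dots> \<le> \<bar>\<beta> \<theta>\<bar> * \<bar>m \<theta> \<bullet> \<tau>\<bar>" by (metis abs_ge_self abs_mult)
      finally have 1: "\<bar>\<alpha> \<theta>\<bar> * (m \<theta> \<bullet> E) \<le> \<bar>\<beta> \<theta>\<bar> * \<bar>m \<theta> \<bullet> \<tau>\<bar>" .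
      have "l \<bullet> (z \<theta> - z0) \<le> 0" using l elim(2) by (simp add: support_normals_iff)
      then have 2: "\<alpha> \<theta> * (l \<bullet> E) + \<beta> \<theta> * (l \<bullet> \<tau>) \<le> 0"
        unfolding dec by (simp add: inner_add_right)
      \<comment> \<open>The cross product with the ray direction has the sign of \<theta>; this is
        how the change of sign of \<open>\<beta>\<close> is detected.\<close>
      have "Im (cnj w * (z \<theta> - z0)) = t \<theta> * sin \<theta> * (norm w)\<^sup>2"
        unfolding elim(3) z0(2) cmod_power2 by (simp add: algebra_simps power2_eq_square)
      moreover have "Im (cnj w * (z \<theta> - z0)) = \<alpha> \<theta> * (w \<bullet> \<tau>) * (-1) + \<beta> \<theta> * (w \<bullet> E)"
        unfolding dec \<tau>_def by (simp add: inner_complex_def algebra_simps)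
      ultimately show ?case using 1 2 by simp
    qed
    have tpos: "\<forall>\<^sub>F \<theta> in at 0. t \<theta> > 0" using order_tendstoD(1)[OF z(2) z0(3)] .
    have w0: "w \<noteq> 0" using Ew by auto
    have mE: "((\<lambda>\<theta>. m \<theta> \<bullet> E) \<longlongrightarrow> 1) (at 0)"
      using tendsto_inner[OF m(2) tendsto_const, of E] inner_unit[OF nE] by simp
    have mt: "((\<lambda>\<theta>. \<bar>m \<theta> \<bullet> \<tau>\<bar>) \<longlongrightarrow> 0) (at 0)"
      using tendsto_rabs[OF tendsto_inner[OF m(2) tendsto_const, of \<tau>]]
      by (simp add: \<tau>_def inner_complex_def mult.commute)
    have small: "\<forall>\<^sub>F \<theta> in at 0. \<bar>\<alpha> \<theta>\<bar> \<le> \<epsilon> * \<bar>\<beta> \<theta>\<bar>" if "\<epsilon> > 0" for \<epsilon>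
    proof -
      have "\<forall>\<^sub>F \<theta> in at 0. m \<theta> \<bullet> E > 1 / 2" using order_tendstoD(1)[OF mE, of "1 / 2"] by simp
      moreover have "\<forall>\<^sub>F \<theta> in at 0. \<bar>m \<theta> \<bullet> \<tau>\<bar> < \<epsilon> / 2" using order_tendstoD(2)[OF mt, of "\<epsilon> / 2"] that by simp
      ultimately show ?thesis using ev
      proof eventually_elim
        case (elim \<theta>)
        have "\<bar>\<alpha> \<theta>\<bar> * (1 / 2) \<le> \<bar>\<alpha> \<theta>\<bar> * (m \<theta> \<bullet> E)" using elim by (intro mult_left_mono) auto
        also have "\<dots> \<le> \<bar>\<beta> \<theta>\<bar> * \<bar>m \<theta> \<bullet> \<tau>\<bar>" using elim by blast
        also have "\<dots> \<le> \<bar>\<beta> \<theta>\<bar> * (\<epsilon> / 2)" using elim by (intro mult_left_mono) auto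
        finally show ?case by (simp add: mult.commute)
      qed
    qed
    have sgn_beta: "\<forall>\<^sub>F \<theta> in at 0. sgn (\<beta> \<theta>) * sgn (w \<bullet> E) = sgn \<theta>"
    proof -
      \<comment> \<open>Small enough that the \<open>\<alpha>\<close> term of the cross product is
        at most half of the \<open>\<beta>\<close> term, which therefore decides the sign.\<close>
      define \<epsilon> where "\<epsilon> = \<bar>w \<bullet> E\<bar> / (2 * (\<bar>w \<bullet> \<tau>\<bar> + 1))"
      have "\<epsilon> > 0" using Ew by (auto simp: \<epsilon>_def inner_commute intro!: divide_pos_pos)
      have e2: "\<epsilon> * \<bar>w \<bullet> \<tau>\<bar> \<le> \<bar>w \<bullet> E\<bar> / 2"
      proof -
        have "\<epsilon> * \<bar>w \<bullet> \<tau>\<bar> \<le> \<epsilon> * (\<bar>w \<bullet> \<tau>\<bar> + 1)" using \<open>\<epsilon> > 0\<close> by simp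
        also have "\<dots> = \<bar>w \<bullet> E\<bar> / 2" by (simp add: \<epsilon>_def field_simps add_nonneg_eq_0_iff)
        finally show ?thesis .
      qed
      have "\<forall>\<^sub>F \<theta> in at 0. \<bar>\<theta>\<bar> < pi"
        using tendstoD[OF tendsto_ident_at, of pi "0::real" UNIV] by (simp add: dist_real_def)
      moreover have "\<forall>\<^sub>F \<theta> in at (0::real). \<theta> \<noteq> 0" by (simp add: eventually_at_filter)
      ultimately show ?thesis using ev tpos small[OF \<open>\<epsilon> > 0\<close>]
      proof eventually_elim
        case (elim \<theta>)
        have ss: "sgn (sin \<theta>) = sgn \<theta>"
        proof (cases "\<theta> > 0")
          case True
          then show ?thesis using elim sin_gt_zero[of \<theta>] by simp
        next
          case False
          then show ?thesis using elim sin_gt_zero[of "- \<theta>"] by simp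
        qed
        have "\<bar>\<alpha> \<theta> * (w \<bullet> \<tau>)\<bar> \<le> \<epsilon> * \<bar>\<beta> \<theta>\<bar> * \<bar>w \<bullet> \<tau>\<bar>"
          unfolding abs_mult using elim by (intro mult_right_mono) auto
        also have "\<dots> = \<bar>\<beta> \<theta>\<bar> * (\<epsilon> * \<bar>w \<bullet> \<tau>\<bar>)" by simp
        also have "\<dots> \<le> \<bar>\<beta> \<theta>\<bar> * (\<bar>w \<bullet> E\<bar> / 2)" using e2 by (intro mult_left_mono) auto
        also have "\<dots> = \<bar>\<beta> \<theta> * (w \<bullet> E)\<bar> / 2" by (simp add: abs_mult)
        finally have 1: "\<bar>\<alpha> \<theta> * (w \<bullet> \<tau>)\<bar> \<le> \<bar>\<beta> \<theta> * (w \<bullet> E)\<bar> / 2" .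
        define s where "s = t \<theta> * sin \<theta> * (norm w)\<^sup>2"
        have s: "sgn s = sgn \<theta>" using elim w0 ss by (simp add: s_def sgn_mult)
        have 2: "\<beta> \<theta> * (w \<bullet> E) = s + \<alpha> \<theta> * (w \<bullet> \<tau>)" using elim by (simp add: s_def)
        have "s \<noteq> 0" using s elim(2) by (metis sgn_0_0)
        then have "sgn (\<beta> \<theta> * (w \<bullet> E)) = sgn s" using 1 2
          by (auto simp: sgn_if abs_if split: if_splits)
        then show ?case using s by (simp add: sgn_mult)
      qed
    qed
    \<comment> \<open>A normal \<open>l\<close> with a tangential component of sign
      \<open>\<sigma>\<close> violates its inequality at points with
      \<open>sgn (\<beta> \<theta>) = \<sigma>\<close>, where the \<open>\<beta>\<close> term
      dominates; such points occur for either sign.\<close>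
    have lt: "\<sigma> * (l \<bullet> \<tau>) \<le> 0" if "\<sigma> \<in> {1, -1::real}" for \<sigma>
    proof (rule ccontr)
      assume "\<not> ?thesis"
      then have pos: "\<sigma> * (l \<bullet> \<tau>) > 0" by simp
      define \<epsilon> where "\<epsilon> = \<sigma> * (l \<bullet> \<tau>) / 2"
      have "\<epsilon> > 0" using pos by (simp add: \<epsilon>_def)
      have "\<forall>\<^sub>F \<theta> in at 0. sgn (\<beta> \<theta>) = \<sigma> \<longrightarrow> False"
        using ev small[OF \<open>\<epsilon> > 0\<close>]
      proof eventually_elim
        case (elim \<theta>)
        show ?case
        proof
          assume sg: "sgn (\<beta> \<theta>) = \<sigma>"
          then have b: "\<beta> \<theta> = \<sigma> * \<bar>\<beta> \<theta>\<bar>" "\<bar>\<beta> \<theta>\<bar> > 0" using that by (auto simp: sgn_if split: if_splits)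
          have "\<bar>l \<bullet> E\<bar> \<le> 1" using Cauchy_Schwarz_ineq2[of l E] nl nE by simp
          then have "\<bar>\<alpha> \<theta> * (l \<bullet> E)\<bar> \<le> \<bar>\<alpha> \<theta>\<bar>" by (simp add: abs_mult mult_left_le)
          also have "\<dots> \<le> \<epsilon> * \<bar>\<beta> \<theta>\<bar>" using elim by blast
          finally have "\<beta> \<theta> * (l \<bullet> \<tau>) \<le> \<epsilon> * \<bar>\<beta> \<theta>\<bar>" using elim by linarith
          moreover have "\<beta> \<theta> * (l \<bullet> \<tau>) = 2 * \<epsilon> * \<bar>\<beta> \<theta>\<bar>"
            by (subst b(1)) (simp add: \<epsilon>_def)
          ultimately show False using b(2) \<open>\<epsilon> > 0\<close> by (simp add: mult_less_0_iff not_le[symmetric])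
        qed
      qed
      then have "\<forall>\<^sub>F \<theta> in at 0. sgn (\<theta>::real) \<noteq> \<sigma> * sgn (w \<bullet> E)"
        using sgn_beta
      proof eventually_elim
        case (elim \<theta>)
        have "sgn (w \<bullet> E) * sgn (w \<bullet> E) = 1" using Ew by (simp add: inner_commute sgn_if)
        then show ?case using elim by (metis mult_cancel_right mult_zero_left zero_neq_one)
      qed
      then obtain d where d: "d > 0" "\<And>\<theta>. \<theta> \<noteq> 0 \<Longrightarrow> \<bar>\<theta>\<bar> < d \<Longrightarrow> sgn \<theta> \<noteq> \<sigma> * sgn (w \<bullet> E)"
        by (auto simp: eventually_at dist_real_def)
      have "\<sigma> * sgn (w \<bullet> E) \<in> {1, -1}" using that Ew by (auto simp: inner_commute sgn_if)
      then show False using d(2)[of "d / 2"] d(2)[of "- (d / 2)"] d(1) by auto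
    qed
    then have "l \<bullet> \<tau> = 0" using lt[of 1] lt[of "-1"] by simp
    then have "l = (E \<bullet> l) *\<^sub>R E"
      using unit_decomp[OF nE, of l] by (simp add: \<tau>_def inner_commute)
    then have "l = E \<or> l = - E"
      using nl nE by (metis abs_eq_iff' abs_minus_cancel mult.right_neutral norm_scaleR scaleR_minus_left scaleR_one abs_one)
    moreover have "l \<noteq> - E"
    proof
      assume "l = - E"
      obtain y where y: "y \<in> interior K" using interior_K by blast
      then show False
        using support_normals_interior[OF E y] support_normals_interior[OF l y] \<open>l = - E\<close> by simp
    qed
    ultimately show "l = E" by blast
  qed
  then show ?thesis using E by blast
qed

end

section \<open>Regularity of the boundary\<close>

lemma piecewise_Jordan_pieces:
  assumes "piecewise_Ck_Jordan 4 C"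
  obtains \<gamma> :: "real \<Rightarrow> complex" and n :: nat and t :: "nat \<Rightarrow> real"
    and g g1 g2 :: "nat \<Rightarrow> real \<Rightarrow> complex"
  where "simple_path \<gamma>" "path_image \<gamma> = C" "t 0 = 0" "t n = 1" "\<forall>i<n. t i < t (Suc i)"
    "\<forall>i<n. \<forall>s\<in>{t i..t (Suc i)}. g i s = \<gamma> s \<and> g1 i s \<noteq> 0
       \<and> (g1 i has_vector_derivative g2 i s) (at s)
       \<and> (\<forall>\<^sub>F u in nhds s. (g i has_vector_derivative g1 i u) (at u))"
proof -
  obtain \<gamma> n t where *: "simple_path \<gamma>" "path_image \<gamma> = C" "t 0 = 0" "t n = 1" "\<forall>i<n. t i < t (Suc i)"
    "\<forall>i<n. \<exists>g U. open U \<and> {t i..t (Suc i)} \<subseteq> U \<and> Ck_on 4 g U \<and>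
       (\<forall>s\<in>{t i..t (Suc i)}. g s = \<gamma> s \<and> vector_derivative g (at s) \<noteq> 0)"
    using assms unfolding piecewise_Ck_Jordan_def by blast
  then obtain g U where g: "\<And>i. i < n \<Longrightarrow> open (U i) \<and> {t i..t (Suc i)} \<subseteq> U i \<and> Ck_on 4 (g i) (U i) \<and>
       (\<forall>s\<in>{t i..t (Suc i)}. g i s = \<gamma> s \<and> vector_derivative (g i) (at s) \<noteq> 0)"
    by metis
  define g1 where "g1 i = (\<lambda>s. vector_derivative (g i) (at s))" for i
  define g2 where "g2 i = (\<lambda>s. vector_derivative (g1 i) (at s))" for i
  have d: "(g i has_vector_derivative g1 i s) (at s)" "(g1 i has_vector_derivative g2 i s) (at s)"
    if "i < n" "s \<in> U i" for i s
  proof -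
    have "\<forall>j<4. vderiv_iter j (g i) differentiable (at s)"
      using g[OF that(1)] that(2) by (auto simp: Ck_on_def)
    then have "vderiv_iter 0 (g i) differentiable (at s)" "vderiv_iter 1 (g i) differentiable (at s)"
      by auto
    then show "(g i has_vector_derivative g1 i s) (at s)" "(g1 i has_vector_derivative g2 i s) (at s)"
      by (simp_all add: vderiv_iter_def g1_def g2_def vector_derivative_works)
  qed
  show thesis
  proof (rule that[OF *(1-4)])
    show "\<forall>i<n. t i < t (Suc i)" using * by blast
    show "\<forall>i<n. \<forall>s\<in>{t i..t (Suc i)}. g i s = \<gamma> s \<and> g1 i s \<noteq> 0
       \<and> (g1 i has_vector_derivative g2 i s) (at s)
       \<and> (\<forall>\<^sub>F u in nhds s. (g i has_vector_derivative g1 i u) (at u))"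
    proof (intro allI impI ballI)
    fix i s assume i: "i < n" "s \<in> {t i..t (Suc i)}"
    then have s: "s \<in> U i" "open (U i)" using g by blast+
    have "\<forall>\<^sub>F u in nhds s. u \<in> U i" using s eventually_nhds by blast
    then have "\<forall>\<^sub>F u in nhds s. (g i has_vector_derivative g1 i u) (at u)"
      by (rule eventually_mono) (use d i in blast)
    then show "g i s = \<gamma> s \<and> g1 i s \<noteq> 0 \<and> (g1 i has_vector_derivative g2 i s) (at s)
       \<and> (\<forall>\<^sub>F u in nhds s. (g i has_vector_derivative g1 i u) (at u))"
      using g[OF i(1)] i d[OF i(1) s(1)] by (auto simp: g1_def)
    qed
  qed
qed

lemma partition_cover:
  fixes t :: "nat \<Rightarrow> real"
  assumes t: "t 0 = 0" "t n = 1" "\<And>i. i < n \<Longrightarrow> t i < t (Suc i)" and s: "s \<in> {0..1}"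
  shows "\<exists>i<n. s \<in> {t i..t (Suc i)}"
proof -
  define k where "k = (LEAST k. s \<le> t k)"
  have sk: "s \<le> t k" "k \<le> n"
    unfolding k_def using assms by (auto intro: LeastI[of _ n] Least_le)
  have n: "n > 0" using t(1,2) by (metis gr0I zero_neq_one)
  show ?thesis
  proof (cases k)
    case 0
    then have "s = 0" using sk t s by simp
    then show ?thesis using n t(1) t(3)[of 0] by (auto intro!: exI[of _ 0])
  next
    case (Suc i)
    then have "\<not> s \<le> t i" using not_less_Least[of i "\<lambda>k. s \<le> t k"] by (auto simp: k_def)
    then show ?thesis using Suc sk by (intro exI[of _ i]) auto
  qed
qed

text \<open>One step of l'Hopital leaves \<open>\<phi>' u / (2 * (u - s))\<close>, whose limit is
  the derivative of \<open>\<phi>'\<close> at the single point \<open>s\<close>.\<close>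

lemma second_order_quotient:
  fixes \<phi> \<phi>' :: "real \<Rightarrow> real"
  assumes "\<forall>\<^sub>F u in nhds s. (\<phi> has_real_derivative \<phi>' u) (at u)"
    and "(\<phi>' has_real_derivative c) (at s)" "\<phi> s = 0" "\<phi>' s = 0"
  shows "((\<lambda>u. \<phi> u / (u - s)\<^sup>2) \<longlongrightarrow> c / 2) (at s)"
proof (rule lhopital[where f' = \<phi>' and g' = "\<lambda>u. 2 * (u - s)"])
  have "isCont \<phi> s" using eventually_nhds_x_imp_x[OF assms(1)] DERIV_isCont by blast
  then show "\<phi> \<midarrow>s\<rightarrow> 0" using assms(3) by (simp add: isCont_def)
  have "(\<lambda>u. (u - s)\<^sup>2) \<midarrow>s\<rightarrow> (s - s)\<^sup>2" by (intro tendsto_intros)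
  then show "(\<lambda>u. (u - s)\<^sup>2) \<midarrow>s\<rightarrow> 0" by simp
  show "\<forall>\<^sub>F x in at s. (x - s)\<^sup>2 \<noteq> 0" "\<forall>\<^sub>F x in at s. 2 * (x - s) \<noteq> 0"
    by (auto simp: eventually_at_filter)
  show "\<forall>\<^sub>F x in at s. (\<phi> has_real_derivative \<phi>' x) (at x)"
    using assms(1) eventually_nhds_conv_at by blast
  show "\<forall>\<^sub>F x in at s. ((\<lambda>u. (u - s)\<^sup>2) has_real_derivative 2 * (x - s)) (at x)"
    by (intro always_eventually allI) (auto intro!: derivative_eq_intros)
  have "((\<lambda>u. (\<phi>' u - \<phi>' s) / (u - s)) \<longlongrightarrow> c) (at s)"
    using assms(2) by (simp add: has_field_derivative_iff)
  then have "((\<lambda>u. (\<phi>' u / (u - s)) / 2) \<longlongrightarrow> c / 2) (at s)"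
    using assms(4) by (intro tendsto_divide) auto
  then show "((\<lambda>u. \<phi>' u / (2 * (u - s))) \<longlongrightarrow> c / 2) (at s)"
    by (simp add: mult.commute)
qed

lemma inner_has_real_derivative:
  "(f has_vector_derivative D) (at s) \<Longrightarrow> ((\<lambda>u. n \<bullet> (f u - c)) has_real_derivative n \<bullet> D) (at s)"
  unfolding has_real_derivative_iff_has_vector_derivative has_vector_derivative_def
  by (auto intro!: derivative_eq_intros)

lemma simple_path_preimage_finite:
  assumes "simple_path \<gamma>"
  shows "finite {s\<in>{0..1}. \<gamma> s = Q}"
proof (cases "\<exists>s0\<in>{0..1}. \<gamma> s0 = Q")
  case True
  then obtain s0 where "s0 \<in> {0..1}" "\<gamma> s0 = Q" by blast
  then have "{s\<in>{0..1}. \<gamma> s = Q} \<subseteq> {s0, 0, 1}"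
    using assms unfolding simple_path_def loop_free_def by fastforce
  then show ?thesis by (rule finite_subset) simp
next
  case False
  then have "{s\<in>{0..1}. \<gamma> s = Q} = {}" by blast
  then show ?thesis by (metis finite.emptyI)
qed

text \<open>If the points \<open>z k\<close> of the curve tend to \<open>Q\<close> and lie on the conic of parameter \<open>f\<close>
  touching the line \<open>v = 0\<close> at \<open>Q\<close>, then \<open>f\<close> is read off the 2-jet at \<open>Q\<close> of one of
  the finitely many pieces of the curve through \<open>Q\<close>.\<close>

lemma conic_parameter_finite:
  assumes C: "piecewise_Ck_Jordan 4 C" and n: "norm n = 1" and D: "D > 0"
  shows "\<exists>L. finite L \<and> (\<forall>f z. (\<forall>k. z k \<in> C \<and> z k \<noteq> Q \<and>
     (n \<bullet> (z k - Q)) * (D - n \<bullet> (z k - Q)) = f * ((\<i> * n) \<bullet> (z k - Q))\<^sup>2) \<longrightarrow> z \<longlonglongrightarrow> Q \<longrightarrow> f \<in> L)"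
proof -
  obtain \<gamma> N t and g g1 g2 :: "nat \<Rightarrow> real \<Rightarrow> complex" where gam: "simple_path \<gamma>" "path_image \<gamma> = C" "t 0 = 0" "t N = 1"
    "\<forall>i<N. t i < t (Suc i)" and
    "\<forall>i<N. \<forall>s\<in>{t i..t (Suc i)}. g i s = \<gamma> s \<and> g1 i s \<noteq> 0
       \<and> (g1 i has_vector_derivative g2 i s) (at s)
       \<and> (\<forall>\<^sub>F u in nhds s. (g i has_vector_derivative g1 i u) (at u))"
    by (rule piecewise_Jordan_pieces[OF C])
  note g = this(6)[rule_format]
  \<comment> \<open>Solve \<open>D * \<phi>'' / 2 = f * \<omega>'\<^sup>2\<close> for
    \<open>f\<close>, with \<phi> and \<omega> the components of a piece along \<open>n\<close> and
    \<open>\<i> * n\<close>: one value for each piece and each parameter over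
    \<open>Q\<close>.\<close>
  define L where "L = (\<lambda>(i, s). D * (n \<bullet> g2 i s) / (2 * ((\<i> * n) \<bullet> g1 i s)\<^sup>2)) ` ({..<N} \<times> {s\<in>{0..1}. \<gamma> s = Q})"
  have "finite L" unfolding L_def using simple_path_preimage_finite[OF gam(1)] by auto
  moreover have "f \<in> L" if z: "\<forall>k. z k \<in> C \<and> z k \<noteq> Q \<and>
     (n \<bullet> (z k - Q)) * (D - n \<bullet> (z k - Q)) = f * ((\<i> * n) \<bullet> (z k - Q))\<^sup>2" and lim: "z \<longlonglongrightarrow> Q"
   for f :: real and z :: "nat \<Rightarrow> complex"
  proof -
    have "\<forall>k. \<exists>s\<in>{0..1}. z k = \<gamma> s" using z gam(2) by (auto simp: path_image_def)
    then obtain \<sigma> where s: "\<And>k. \<sigma> k \<in> {0..1}" "\<And>k. z k = \<gamma> (\<sigma> k)" by metis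
    have "\<forall>k. \<exists>i<N. \<sigma> k \<in> {t i..t (Suc i)}" using partition_cover[OF gam(3,4) gam(5)[rule_format]] s(1) by blast
    then obtain \<iota> where i: "\<And>k. \<iota> k < N" "\<And>k. \<sigma> k \<in> {t (\<iota> k)..t (Suc (\<iota> k))}" by metis
    \<comment> \<open>Pigeonhole and compactness: a subsequence stays on one piece and its
      parameters converge, necessarily to a parameter over \<open>Q\<close>.\<close>
    have "finite (range \<iota>)" using i(1) by (meson finite_lessThan finite_subset image_subsetI lessThan_iff)
    then obtain i0 where "infinite (\<iota> -` {\<iota> i0})"
      using pigeonhole_infinite[of UNIV \<iota>] by (auto simp: vimage_def)
    then obtain r0 :: "nat \<Rightarrow> nat" where "strict_mono r0" "\<forall>k. r0 k \<in> \<iota> -` {\<iota> i0}"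
      using infinite_enumerate by blast
    then have r0: "strict_mono r0" "\<And>k. \<iota> (r0 k) = \<iota> i0" by auto
    define i where "i = \<iota> i0"
    have iN: "i < N" using i(1) by (simp add: i_def)
    have "\<forall>k. \<sigma> (r0 k) \<in> {t i..t (Suc i)}" using i(2) r0(2) i_def by metis
    then obtain l r where r: "l \<in> {t i..t (Suc i)}" "strict_mono r" "((\<lambda>k. \<sigma> (r0 k)) \<circ> r) \<longlonglongrightarrow> l"
      using compact_Icc[of "t i" "t (Suc i)"] unfolding compact_def by metis
    define \<rho> where "\<rho> k = \<sigma> (r0 (r k))" for k
    have rho: "\<rho> \<longlonglongrightarrow> l" "\<And>k. \<rho> k \<in> {t i..t (Suc i)}"
      using r(3) i(2) r0(2) unfolding \<rho>_def i_def o_def by auto (metis atLeastAtMost_iff)+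
    have zr: "(\<lambda>k. z (r0 (r k))) \<longlonglongrightarrow> Q"
      using LIMSEQ_subseq_LIMSEQ[OF LIMSEQ_subseq_LIMSEQ[OF lim r0(1)] r(2)] by (simp add: o_def)
    have zg: "z (r0 (r k)) = g i (\<rho> k)" for k
      using s(2) g[OF iN rho(2)] by (simp add: \<rho>_def)
    note gl = g[OF iN r(1)]
    have dg: "(g i has_vector_derivative g1 i l) (at l)"
      using gl eventually_nhds_x_imp_x by blast
    have "isCont (g i) l" using dg has_vector_derivative_continuous by blast
    then have "(\<lambda>k. g i (\<rho> k)) \<longlonglongrightarrow> g i l" using rho(1) isCont_tendsto_compose by blast
    then have gQ: "g i l = Q" using zr zg LIMSEQ_unique by (metis (no_types, lifting) ext)
    have l01: "l \<in> {0..1}" "\<gamma> l = Q"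
    proof -
      show "l \<in> {0..1}"
      proof -
        have "0 \<le> \<rho> k" "\<rho> k \<le> 1" for k using s(1) by (auto simp: \<rho>_def)
        then have "0 \<le> l" "l \<le> 1"
          using LIMSEQ_le_const[OF rho(1), of 0] LIMSEQ_le_const2[OF rho(1), of 1] by blast+
        then show ?thesis by simp
      qed
      show "\<gamma> l = Q" using gQ gl by simp
    qed
    have ne: "\<rho> k \<noteq> l" for k using z zg gQ by metis
    have filt: "filterlim \<rho> (at l) sequentially"
      using rho(1) ne by (simp add: filterlim_at)
    define \<phi> where "\<phi> u = n \<bullet> (g i u - Q)" for u
    define \<omega> where "\<omega> u = (\<i> * n) \<bullet> (g i u - Q)" for u
    have z0: "\<phi> l = 0" "\<omega> l = 0" by (simp_all add: \<phi>_def \<omega>_def gQ)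
    have eq: "\<phi> (\<rho> k) * (D - \<phi> (\<rho> k)) = f * (\<omega> (\<rho> k))\<^sup>2" for k
      using z zg unfolding \<phi>_def \<omega>_def by metis
    have der: "(\<phi> has_real_derivative n \<bullet> g1 i l) (at l)" "(\<omega> has_real_derivative (\<i> * n) \<bullet> g1 i l) (at l)"
      unfolding \<phi>_def \<omega>_def using dg by (auto intro: inner_has_real_derivative)
    then have "((\<lambda>u. \<phi> u / (u - l)) \<longlongrightarrow> n \<bullet> g1 i l) (at l)" "((\<lambda>u. \<omega> u / (u - l)) \<longlongrightarrow> (\<i> * n) \<bullet> g1 i l) (at l)"
      using z0 by (simp_all add: has_field_derivative_iff)
    moreover have "(\<phi> \<longlongrightarrow> \<phi> l) (at l)"
      using DERIV_isCont[OF der(1)] by (simp add: isCont_def)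
    ultimately have lims: "(\<lambda>k. \<phi> (\<rho> k) / (\<rho> k - l)) \<longlonglongrightarrow> n \<bullet> g1 i l"
      "(\<lambda>k. \<omega> (\<rho> k) / (\<rho> k - l)) \<longlonglongrightarrow> (\<i> * n) \<bullet> g1 i l" "(\<lambda>k. \<phi> (\<rho> k)) \<longlonglongrightarrow> 0"
      using filterlim_compose[OF _ filt] z0(1) by auto
    have h0: "(\<lambda>k. \<rho> k - l) \<longlonglongrightarrow> 0" using rho(1) by (simp add: LIM_zero)
    \<comment> \<open>Dividing the conic equation once by \<open>\<rho> k - l\<close> shows that the
      tangent of the piece is orthogonal to \<open>n\<close>; only then does division by the square
      have a finite limit.\<close>
    have "(\<lambda>k. (\<phi> (\<rho> k) / (\<rho> k - l)) * (D - \<phi> (\<rho> k))) \<longlonglongrightarrow> (n \<bullet> g1 i l) * (D - 0)"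
      by (intro tendsto_intros lims)
    moreover have "(\<lambda>k. f * (\<omega> (\<rho> k) / (\<rho> k - l))\<^sup>2 * (\<rho> k - l)) \<longlonglongrightarrow> f * ((\<i> * n) \<bullet> g1 i l)\<^sup>2 * 0"
      by (intro tendsto_intros lims h0)
    moreover have "(\<phi> (\<rho> k) / (\<rho> k - l)) * (D - \<phi> (\<rho> k)) = f * (\<omega> (\<rho> k) / (\<rho> k - l))\<^sup>2 * (\<rho> k - l)" for k
      using eq[of k] ne[of k] by (simp add: power2_eq_square)
    ultimately have "(n \<bullet> g1 i l) * (D - 0) = f * ((\<i> * n) \<bullet> g1 i l)\<^sup>2 * 0"
      by (metis (no_types, lifting) ext LIMSEQ_unique)
    then have perp: "n \<bullet> g1 i l = 0" using D by simp
    have om: "(\<i> * n) \<bullet> g1 i l \<noteq> 0"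
      using unit_decomp[OF n, of "g1 i l"] perp gl by auto
    have "((\<lambda>u. \<phi> u / (u - l)\<^sup>2) \<longlongrightarrow> (n \<bullet> g2 i l) / 2) (at l)"
    proof (rule second_order_quotient)
      show "\<forall>\<^sub>F u in nhds l. (\<phi> has_real_derivative n \<bullet> (g1 i u - 0)) (at u)"
        using gl unfolding \<phi>_def by (auto elim!: eventually_mono intro: inner_has_real_derivative)
      show "((\<lambda>u. n \<bullet> (g1 i u - 0)) has_real_derivative n \<bullet> g2 i l) (at l)"
        using gl by (intro inner_has_real_derivative) blast
    qed (use z0 perp in auto)
    then have q2: "(\<lambda>k. \<phi> (\<rho> k) / (\<rho> k - l)\<^sup>2) \<longlonglongrightarrow> (n \<bullet> g2 i l) / 2"
      by (rule filterlim_compose[OF _ filt])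
    have "(\<lambda>k. (\<phi> (\<rho> k) / (\<rho> k - l)\<^sup>2) * (D - \<phi> (\<rho> k))) \<longlonglongrightarrow> ((n \<bullet> g2 i l) / 2) * (D - 0)"
      by (intro tendsto_mult tendsto_diff tendsto_const lims q2)
    moreover have "(\<lambda>k. f * (\<omega> (\<rho> k) / (\<rho> k - l))\<^sup>2) \<longlonglongrightarrow> f * ((\<i> * n) \<bullet> g1 i l)\<^sup>2"
      by (intro tendsto_intros lims)
    moreover have "(\<phi> (\<rho> k) / (\<rho> k - l)\<^sup>2) * (D - \<phi> (\<rho> k)) = f * (\<omega> (\<rho> k) / (\<rho> k - l))\<^sup>2" for k
      using eq[of k] ne[of k] by (simp add: power_divide)
    ultimately have "((n \<bullet> g2 i l) / 2) * (D - 0) = f * ((\<i> * n) \<bullet> g1 i l)\<^sup>2"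
      by (metis (no_types, lifting) ext LIMSEQ_unique)
    then have "f = D * (n \<bullet> g2 i l) / (2 * ((\<i> * n) \<bullet> g1 i l)\<^sup>2)"
      using om by (simp add: field_simps)
    then show ?thesis using iN l01 unfolding L_def by auto
  qed
  ultimately show ?thesis by blast
qed

context convex_body
begin

text \<open>Unit vectors orthogonal to \<open>v\<close> are equal or opposite, and opposite support
  normals would leave \<open>K\<close> no interior.\<close>

lemma normals_perp_unique:
  assumes "n \<in> support_normals K x" "m \<in> support_normals K x" "n \<bullet> v = 0" "m \<bullet> v = 0" "v \<noteq> 0"
  shows "m = n"
proof -
  have nn: "norm n = 1" "norm m = 1" using assms by (auto simp: support_normals_iff)
  have v: "v = ((\<i> * n) \<bullet> v) *\<^sub>R (\<i> * n)" using unit_decomp[OF nn(1), of v] assms(3) by simp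
  then have "((\<i> * n) \<bullet> v) * (m \<bullet> (\<i> * n)) = 0" using assms(4) by (metis inner_scaleR_right)
  then have "m \<bullet> (\<i> * n) = 0" using v assms(5) by auto
  then have "m = (n \<bullet> m) *\<^sub>R n" using unit_decomp[OF nn(1), of m] by (simp add: inner_commute)
  then have "m = n \<or> m = - n"
    using nn by (metis abs_eq_iff' abs_minus_cancel mult.right_neutral norm_scaleR scaleR_minus_left scaleR_one abs_one)
  moreover have "m \<noteq> - n"
  proof
    assume "m = - n"
    obtain y where y: "y \<in> interior K" using interior_K by blast
    then show False
      using support_normals_interior[OF assms(1) y] support_normals_interior[OF assms(2) y] \<open>m = - n\<close> by simp
  qed
  ultimately show ?thesis by blast
qed

text \<open>A support functional is maximal over \<open>K\<close> at the supported point, so its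
  derivative along a curve in \<open>K\<close> vanishes there.\<close>

lemma normal_perp_tangent:
  assumes m: "m \<in> support_normals K (\<gamma> s)" and d: "(\<gamma> has_vector_derivative w) (at s)"
    and K: "\<And>u. \<bar>u - s\<bar> < \<eta> \<Longrightarrow> \<gamma> u \<in> K" and "\<eta> > 0"
  shows "m \<bullet> w = 0"
proof (rule DERIV_local_max)
  show "((\<lambda>u. m \<bullet> (\<gamma> u - \<gamma> s)) has_real_derivative m \<bullet> w) (at s)"
    by (rule inner_has_real_derivative[OF d])
  show "\<forall>u. \<bar>s - u\<bar> < \<eta> \<longrightarrow> m \<bullet> (\<gamma> u - \<gamma> s) \<le> m \<bullet> (\<gamma> s - \<gamma> s)"
    using m K by (auto simp: support_normals_iff abs_minus_commute)
qed (use assms in auto)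

text \<open>All partition parameters go into \<open>S\<close>. Orthogonality is claimed for every
  support normal and not for a chosen one, so that uniqueness of the normal can be deduced from
  it.\<close>

lemma boundary_parametrization:
  assumes C: "piecewise_Ck_Jordan 4 (frontier K)"
  obtains \<gamma> S where "simple_path \<gamma>" "path_image \<gamma> = frontier K" "finite S" "0 \<in> S" "1 \<in> S"
    "\<forall>s\<in>{0..1} - S. \<exists>\<eta>>0. {s - \<eta><..<s + \<eta>} \<subseteq> {0..1} \<and>
       (\<exists>g1 v2. (g1 has_vector_derivative v2) (at s) \<and> g1 s \<noteq> 0 \<and>
        (\<forall>u\<in>{s - \<eta><..<s + \<eta>}. (\<gamma> has_vector_derivative g1 u) (at u) \<and>
           (\<forall>m\<in>support_normals K (\<gamma> u). m \<bullet> g1 u = 0)))"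
proof -
  obtain \<gamma> N t and g g1 g2 :: "nat \<Rightarrow> real \<Rightarrow> complex" where gam: "simple_path \<gamma>" "path_image \<gamma> = frontier K" "t 0 = 0" "t N = 1"
    "\<forall>i<N. t i < t (Suc i)" and
    "\<forall>i<N. \<forall>s\<in>{t i..t (Suc i)}. g i s = \<gamma> s \<and> g1 i s \<noteq> 0
       \<and> (g1 i has_vector_derivative g2 i s) (at s)
       \<and> (\<forall>\<^sub>F u in nhds s. (g i has_vector_derivative g1 i u) (at u))"
    by (rule piecewise_Jordan_pieces[OF C])
  note g = this(6)[rule_format]
  have mono: "t i \<le> t j" if "i \<le> j" "j \<le> N" for i j
    using that
  proof (induction j rule: dec_induct)
    case (step k)
    then show ?case using gam(5)[rule_format, of k] by simp
  qed simp
  let ?S = "t ` {..N}"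
  show thesis
  proof (rule that[OF gam(1,2), of ?S])
    show "0 \<in> ?S" using gam(3) by (metis atMost_iff image_eqI le0)
    show "1 \<in> ?S" using gam(4) by (metis atMost_iff image_eqI le_refl)
    show "\<forall>s\<in>{0..1} - ?S. \<exists>\<eta>>0. {s - \<eta><..<s + \<eta>} \<subseteq> {0..1} \<and>
       (\<exists>g1 v2. (g1 has_vector_derivative v2) (at s) \<and> g1 s \<noteq> 0 \<and>
        (\<forall>u\<in>{s - \<eta><..<s + \<eta>}. (\<gamma> has_vector_derivative g1 u) (at u) \<and>
           (\<forall>m\<in>support_normals K (\<gamma> u). m \<bullet> g1 u = 0)))"
    proof
    fix s assume s: "s \<in> {0..1} - ?S"
    obtain i where i: "i < N" "s \<in> {t i..t (Suc i)}" using partition_cover[OF gam(3,4) gam(5)[rule_format]] s by blast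
    have "s \<noteq> t i" "s \<noteq> t (Suc i)" using s i(1) by (auto simp: Suc_le_eq)
    then have si: "t i < s" "s < t (Suc i)" using i(2) by auto
    define \<eta> where "\<eta> = min (s - t i) (t (Suc i) - s)"
    have eta: "\<eta> > 0" using si by (simp add: \<eta>_def)
    have sub: "{s - \<eta><..<s + \<eta>} \<subseteq> {t i<..<t (Suc i)}" by (auto simp: \<eta>_def min_def split: if_splits)
    have t01: "0 \<le> t i" "t (Suc i) \<le> 1" using mono[of 0 i] mono[of "Suc i" N] gam(3,4) i(1) by auto
    have d: "(\<gamma> has_vector_derivative g1 i u) (at u)" if "u \<in> {t i<..<t (Suc i)}" for u
    proof (rule has_vector_derivative_transform_within_open[where S="{t i<..<t (Suc i)}" and f="g i"])
      show "(g i has_vector_derivative g1 i u) (at u)"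
        using g[OF i(1), of u] that eventually_nhds_x_imp_x by fastforce
      show "g i x = \<gamma> x" if "x \<in> {t i<..<t (Suc i)}" for x using g[OF i(1), of x] that by auto
    qed (use that in auto)
    have perp: "m \<bullet> g1 i u = 0" if u: "u \<in> {t i<..<t (Suc i)}" and m: "m \<in> support_normals K (\<gamma> u)" for u m
    proof (rule normal_perp_tangent[OF m d[OF u], of "min (u - t i) (t (Suc i) - u)"])
      fix x assume "\<bar>x - u\<bar> < min (u - t i) (t (Suc i) - u)"
      then have "x \<in> {0..1}" using t01 by auto
      then show "\<gamma> x \<in> K" using gam(2) frontier_subset by (auto simp: path_image_def)
    qed (use u in auto)
    show "\<exists>\<eta>>0. {s - \<eta><..<s + \<eta>} \<subseteq> {0..1} \<and>
       (\<exists>g1 v2. (g1 has_vector_derivative v2) (at s) \<and> g1 s \<noteq> 0 \<and>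
        (\<forall>u\<in>{s - \<eta><..<s + \<eta>}. (\<gamma> has_vector_derivative g1 u) (at u) \<and>
           (\<forall>m\<in>support_normals K (\<gamma> u). m \<bullet> g1 u = 0)))"
    proof (intro exI[of _ \<eta>] conjI exI[of _ "g1 i"] exI[of _ "g2 i s"] ballI eta)
      show "{s - \<eta><..<s + \<eta>} \<subseteq> {0..1}" using sub t01 by fastforce
      show "(g1 i has_vector_derivative g2 i s) (at s)" "g1 i s \<noteq> 0" using g[OF i] by auto
    qed (use sub d perp in auto)
    qed
  qed auto
qed

text \<open>Lipschitz variation of the normal at one point, over all support normals of nearby
  points since these may be corners. It makes the direction reflected at the outer boundary
  Lipschitz in the incoming line.\<close>

definition regular_at :: "complex \<Rightarrow> bool" where
  "regular_at x \<longleftrightarrow> (\<exists>n M \<delta>. support_normals K x = {n} \<and> \<delta> > 0 \<and>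
     (\<forall>y\<in>frontier K. \<forall>m\<in>support_normals K y. dist y x < \<delta> \<longrightarrow> norm (m - n) \<le> M * norm (y - x)))"

text \<open>Off the partition the tangent \<open>g1\<close> is differentiable at \<open>s\<close>,
  hence Lipschitz there, and \<open>\<bar>u - s\<bar>\<close> is at most a multiple of
  \<open>norm (y - x)\<close> because \<open>g1 s\<close> is nonzero. A unit vector orthogonal to
  \<open>g1 u\<close> is then close to one orthogonal to \<open>g1 s\<close>.\<close>

lemma regular_at_cofinite:
  assumes C: "piecewise_Ck_Jordan 4 (frontier K)"
  shows "\<exists>F. finite F \<and> (\<forall>x\<in>frontier K - F. regular_at x)"
proof -
  obtain \<gamma> S where gam: "simple_path \<gamma>" "path_image \<gamma> = frontier K" "finite S" "0 \<in> S" "1 \<in> S" and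
    "\<forall>s\<in>{0..1} - S. \<exists>\<eta>>0. {s - \<eta><..<s + \<eta>} \<subseteq> {0..1} \<and>
       (\<exists>g1 v2. (g1 has_vector_derivative v2) (at s) \<and> g1 s \<noteq> 0 \<and>
        (\<forall>u\<in>{s - \<eta><..<s + \<eta>}. (\<gamma> has_vector_derivative g1 u) (at u) \<and>
           (\<forall>m\<in>support_normals K (\<gamma> u). m \<bullet> g1 u = 0)))"
    by (rule boundary_parametrization[OF C])
  note reg = this(6)[rule_format]
  have "regular_at x" if x: "x \<in> frontier K - \<gamma> ` S" for x
  proof -
    have "x \<in> \<gamma> ` {0..1}" using x gam(2) by (simp add: path_image_def)
    then obtain s where s: "s \<in> {0..1} - S" "x = \<gamma> s" using x by blast
    then have s01: "s \<noteq> 0" "s \<noteq> 1" using gam(4,5) by auto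
    obtain \<eta> g1 v2 where e: "\<eta> > 0" "{s - \<eta><..<s + \<eta>} \<subseteq> {0..1}" "(g1 has_vector_derivative v2) (at s)" "g1 s \<noteq> 0"
      "\<And>u. u \<in> {s - \<eta><..<s + \<eta>} \<Longrightarrow> (\<gamma> has_vector_derivative g1 u) (at u)"
      "\<And>u m. u \<in> {s - \<eta><..<s + \<eta>} \<Longrightarrow> m \<in> support_normals K (\<gamma> u) \<Longrightarrow> m \<bullet> g1 u = 0"
      using reg[OF s(1)] by blast
    define v where "v = g1 s"
    have xf: "x \<in> frontier K" using x by blast
    obtain n where n: "n \<in> support_normals K x" using support_normals_nonempty[OF xf] by blast
    have nv: "n \<bullet> v = 0" using e(6)[of s n] e(1) n s(2) by (simp add: v_def)
    have sn: "support_normals K x = {n}"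
    proof -
      have "m = n" if m: "m \<in> support_normals K x" for m
      proof -
        have "m \<bullet> v = 0" using e(6)[of s m] e(1) m s(2) by (simp add: v_def)
        then show ?thesis using normals_perp_unique[OF n m nv] e(4) by (simp add: v_def)
      qed
      then show ?thesis using n by blast
    qed
    have nn: "norm n = 1" using n by (simp add: support_normals_iff)
    obtain M where M: "M > 0" "\<forall>\<^sub>F u in at s. norm (g1 u - g1 s) \<le> M * \<bar>u - s\<bar>"
      using lipschitz_at_deriv[OF e(3)] by (rule lipschitz_atE)
    have "(\<gamma> has_vector_derivative v) (at s)" using e(5)[of s] e(1) by (simp add: v_def)
    then obtain d1 where d1: "d1 > 0" "\<And>u. norm (u - s) < d1 \<Longrightarrow> norm (\<gamma> u - \<gamma> s - (u - s) *\<^sub>R v) \<le> (norm v / 2) * norm (u - s)"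
      using e(4) unfolding has_vector_derivative_def has_derivative_at_alt v_def
      by (meson half_gt_zero zero_less_norm_iff)
    obtain d2 where d2: "d2 > 0" "\<And>u. u \<noteq> s \<Longrightarrow> \<bar>u - s\<bar> < d2 \<Longrightarrow> norm (g1 u - g1 s) \<le> M * \<bar>u - s\<bar>"
      using M(2) by (auto simp: eventually_at dist_real_def)
    define h where "h = min \<eta> (min d1 d2)"
    have h: "h > 0" "h \<le> \<eta>" "h \<le> d1" "h \<le> d2" using e(1) d1(1) d2(1) by (auto simp: h_def)
    \<comment> \<open>The rest of the curve is compact and, the curve being simple, misses
      \<open>x\<close>; so boundary points near \<open>x\<close> have parameters near
      \<open>s\<close>.\<close>
    let ?R = "\<gamma> ` ({0..1} - {s - h<..<s + h})"
    have "compact ({0..1} - {s - h<..<s + h})" by (intro compact_diff) auto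
    moreover have "continuous_on ({0..1} - {s - h<..<s + h}) \<gamma>"
      using gam(1) by (auto simp: simple_path_def path_def intro: continuous_on_subset)
    ultimately have "closed ?R" using compact_continuous_image compact_imp_closed by blast
    moreover have "x \<notin> ?R"
    proof
      assume "x \<in> ?R"
      then obtain u where u: "u \<in> {0..1}" "u \<notin> {s - h<..<s + h}" "\<gamma> u = \<gamma> s" using s(2) by auto
      have "s \<in> {0..1}" using s by blast
      then have "u = s" using u gam(1) s01 unfolding simple_path_def loop_free_def by metis
      then show False using u(2) h(1) by simp
    qed
    ultimately have "open (- ?R)" "x \<in> - ?R" by auto
    then obtain d3 where d3: "d3 > 0" "ball x d3 \<subseteq> - ?R" using openE by blast
    \<comment> \<open>Distance below 1 from \<open>n\<close> forces \<open>a > 0\<close> in the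
      decomposition of \<open>m\<close> below and so excludes vectors near \<open>- n\<close>; then
      \<open>1 - a\<close> is bounded by \<open>\<bar>b\<bar>\<close>.\<close>
    obtain d4 where d4: "d4 > 0" "\<And>z m. dist z x < d4 \<Longrightarrow> m \<in> support_normals K z \<Longrightarrow> dist m n < 1"
      using normals_close[of x n 1] sn by auto
    have "norm (m - n) \<le> (4 * M / (norm v)\<^sup>2) * norm (y - x)"
      if y: "y \<in> frontier K" "m \<in> support_normals K y" "dist y x < min d3 d4" for y m
    proof -
      have "y \<in> \<gamma> ` {0..1}" using y(1) gam(2) by (simp add: path_image_def)
      then obtain u where u: "u \<in> {0..1}" "y = \<gamma> u" by blast
      have "y \<notin> ?R" using y(3) d3(2) by (auto simp: dist_commute)
      then have uh: "\<bar>u - s\<bar> < h" using u by force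
      have mu: "m \<bullet> g1 u = 0" using e(6)[of u m] uh h y(2) u(2) by (simp add: abs_less_iff)
      have v0: "norm v > 0" using e(4) by (simp add: v_def)
      have "norm ((u - s) *\<^sub>R v) \<le> norm (\<gamma> u - \<gamma> s) + norm (\<gamma> u - \<gamma> s - (u - s) *\<^sub>R v)"
        by (metis norm_minus_commute norm_triangle_sub add.commute)
      also have "\<dots> \<le> norm (y - x) + (norm v / 2) * \<bar>u - s\<bar>"
        using d1(2)[of u] uh h u(2) s(2) by simp
      finally have "\<bar>u - s\<bar> * norm v \<le> norm (y - x) + (norm v / 2) * \<bar>u - s\<bar>"
        by (simp only: norm_scaleR real_norm_def)
      then have us: "\<bar>u - s\<bar> * norm v \<le> 2 * norm (y - x)" by (simp add: mult.commute)
      have "norm (g1 u - v) \<le> M * \<bar>u - s\<bar>"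
        using d2(2)[of u] uh h by (cases "u = s") (auto simp: v_def)
      moreover have nm: "norm m = 1" using y(2) by (simp add: support_normals_iff)
      ultimately have "\<bar>m \<bullet> (v - g1 u)\<bar> \<le> M * \<bar>u - s\<bar>"
        using Cauchy_Schwarz_ineq2[of m "v - g1 u"] by (simp add: norm_minus_commute)
      then have mv: "\<bar>m \<bullet> v\<bar> \<le> M * \<bar>u - s\<bar>" using mu by (simp add: inner_diff_right)
      define b where "b = (\<i> * n) \<bullet> m"
      define a where "a = n \<bullet> m"
      have m: "m = a *\<^sub>R n + b *\<^sub>R (\<i> * n)" unfolding a_def b_def by (rule unit_decomp[OF nn])
      have ab: "a\<^sup>2 + b\<^sup>2 = 1"
      proof -
        have "m \<bullet> m = a * (n \<bullet> m) + b * ((\<i> * n) \<bullet> m)" by (subst (1) m) (simp add: inner_add_left)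
        then show ?thesis using inner_unit[OF nm] by (simp add: a_def b_def power2_eq_square)
      qed
      have "v = ((\<i> * n) \<bullet> v) *\<^sub>R (\<i> * n)" using unit_decomp[OF nn, of v] nv by simp
      moreover have "norm (\<i> * n) = 1" using nn by (simp add: norm_mult)
      ultimately have vv: "\<bar>(\<i> * n) \<bullet> v\<bar> = norm v" "m \<bullet> v = ((\<i> * n) \<bullet> v) * b"
        by (metis mult.right_neutral norm_scaleR, metis b_def inner_commute inner_scaleR_right)
      then have "\<bar>b\<bar> * norm v = \<bar>m \<bullet> v\<bar>" by (simp add: abs_mult)
      then have "\<bar>b\<bar> * norm v * norm v \<le> (M * \<bar>u - s\<bar>) * norm v"
        using mv by (intro mult_right_mono) auto
      also have "\<dots> \<le> M * (2 * norm (y - x))"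
        using us M(1) by (metis mult.assoc mult_left_mono less_imp_le)
      finally have bb: "\<bar>b\<bar> \<le> (2 * M / (norm v)\<^sup>2) * norm (y - x)"
        using v0 by (simp add: field_simps power2_eq_square)
      have "dist m n < 1" using d4(2)[of y m] y by simp
      then have "(norm (m - n))\<^sup>2 < 1" by (simp add: dist_norm power_less_one_iff abs_square_less_1)
      moreover have "(norm (m - n))\<^sup>2 = 2 - 2 * a"
        using inner_unit[OF nm] inner_unit[OF nn]
        by (simp add: power2_norm_eq_inner inner_diff_left inner_diff_right a_def inner_commute)
      ultimately have a0: "a > 0" by simp
      have "b\<^sup>2 \<le> 1" using ab by (smt (verit) zero_le_power2)
      then have b1': "\<bar>b\<bar> \<le> 1" by (simp add: abs_square_le_1)
      have "a \<le> 1" using ab a0 by (smt (verit) power2_eq_square mult_le_cancel_left1 zero_le_power2)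
      then have "a\<^sup>2 \<le> a" using a0 by (simp add: power2_eq_square mult_left_le)
      then have "1 - a \<le> b\<^sup>2" using ab by simp
      also have "b\<^sup>2 = \<bar>b\<bar> * \<bar>b\<bar>" by (simp add: power2_eq_square)
      also have "\<dots> \<le> \<bar>b\<bar>"
        using mult_left_mono[OF b1' abs_ge_zero[of b]] by (simp only: mult_1_right)
      finally have "1 - a \<le> \<bar>b\<bar>" .
      have "m - n = (a - 1) *\<^sub>R n + b *\<^sub>R (\<i> * n)" by (subst m) (simp add: algebra_simps)
      then have "norm (m - n) \<le> \<bar>a - 1\<bar> * norm n + \<bar>b\<bar> * norm (\<i> * n)"
        by (metis norm_scaleR norm_triangle_ineq)
      also have "\<dots> \<le> 2 * \<bar>b\<bar>" using \<open>1 - a \<le> \<bar>b\<bar>\<close> \<open>a \<le> 1\<close> nn by (simp add: norm_mult)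
      also have "\<dots> \<le> (4 * M / (norm v)\<^sup>2) * norm (y - x)" using bb by simp
      finally show ?thesis .
    qed
    then show ?thesis unfolding regular_at_def using sn d3(1) d4(1)
      by (intro exI[of _ n] exI[of _ "4 * M / (norm v)\<^sup>2"] exI[of _ "min d3 d4"]) auto
  qed
  then show ?thesis using gam(3) by blast
qed

lemma regular_smooth: "regular_at x \<Longrightarrow> smooth_at K x"
  by (auto simp: regular_at_def smooth_at_def)

lemma smooth_at_cofinite:
  assumes "piecewise_Ck_Jordan 4 (frontier K)"
  shows "\<exists>F. finite F \<and> (\<forall>x\<in>frontier K - F. smooth_at K x)"
  using regular_at_cofinite[OF assms] regular_smooth by blast

lemma normal_lipschitz:
  assumes reg: "regular_at (z t0)" and z: "lipschitz_at z t0"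
    and K: "\<forall>\<^sub>F t in at t0. z t \<in> frontier K"
  shows "lipschitz_at (\<lambda>t. normal K (z t)) t0"
proof -
  obtain n M \<delta> where n: "support_normals K (z t0) = {n}" "\<delta> > 0"
    "\<And>y m. y \<in> frontier K \<Longrightarrow> m \<in> support_normals K y \<Longrightarrow> dist y (z t0) < \<delta> \<Longrightarrow> norm (m - n) \<le> M * norm (y - z t0)"
    using reg unfolding regular_at_def by blast
  have "\<forall>\<^sub>F t in at t0. norm (normal K (z t) - normal K (z t0)) \<le> M * norm (z t - z t0)"
    using K tendstoD[OF lipschitz_at_tendsto[OF z] n(2)]
    by eventually_elim (use n normal_in normal_eq in auto)
  then show ?thesis by (rule lipschitz_at_le[OF z])
qed

text \<open>Flatness of the boundary combined with the Lipschitz bound; \<open>z\<close> itself is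
  not assumed differentiable.\<close>

lemma tangential_derivative:
  assumes "z t0 \<in> K" "support_normals K (z t0) = {n}" "lipschitz_at z t0"
    and "\<forall>\<^sub>F t in at t0. z t \<in> frontier K"
  shows "((\<lambda>t. n \<bullet> z t) has_real_derivative 0) (at t0)"
proof (rule has_real_derivative_zero_compose[OF assms(3) _ assms(4)])
  fix \<epsilon> :: real assume "\<epsilon> > 0"
  then show "\<exists>\<delta>>0. \<forall>w\<in>frontier K. dist w (z t0) < \<delta> \<longrightarrow> \<bar>n \<bullet> w - n \<bullet> z t0\<bar> \<le> \<epsilon> * norm (w - z t0)"
    using frontier_flat[OF assms(1,2)] by (simp add: inner_diff_right)
qed

end

section \<open>Reflected directions, missing lines and closed cones\<close>

lemma inner_reflect_adjoint: "a \<bullet> (n\<^sup>2 * cnj u) = (n\<^sup>2 * cnj a) \<bullet> u"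
proof -
  have "a \<bullet> (n\<^sup>2 * cnj u) = Re (cnj a * (n\<^sup>2 * cnj u))" by (simp only: Re_cnj_mult)
  also have "\<dots> = Re (cnj (cnj a * (n\<^sup>2 * cnj u)))" by (simp only: cnj.sel)
  also have "cnj (cnj a * (n\<^sup>2 * cnj u)) = cnj (n\<^sup>2 * cnj a) * u" by (simp add: mult_ac)
  finally show ?thesis by (simp only: Re_cnj_mult)
qed

text \<open>\<open>reflect\<close> sees a normal only through its square; a half-plane known to
  contain the normal removes the sign ambiguity.\<close>

lemma unit_square_eq:
  fixes a b :: complex
  assumes "a\<^sup>2 = b\<^sup>2" "a \<bullet> w > 0" "b \<bullet> w > 0"
  shows "a = b"
  using assms by (auto simp: power2_eq_iff)

context convex_body
begin

text \<open>For a missing line \<open>\<bar>Im (cnj d0 * (z - p))\<bar>\<close> has a positive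
  minimum \<open>c\<close> on \<open>K\<close>. Turning the direction by less than
  \<open>c / R\<close> changes this quantity by less than \<open>c\<close> at points within distance
  \<open>R\<close> of \<open>p\<close>.\<close>

lemma line_miss_open:
  assumes miss: "\<And>t. p + t *\<^sub>R d0 \<notin> K" and d0: "norm d0 = 1" and d: "(d \<longlongrightarrow> d0) F"
  shows "\<forall>\<^sub>F x in F. \<forall>t. p + t *\<^sub>R d x \<notin> K"
proof -
  have K0: "K \<noteq> {}" using interior_K interior_subset by blast
  have "continuous_on K (\<lambda>z. \<bar>Im (cnj d0 * (z - p))\<bar>)" by (intro continuous_intros)
  then obtain z0 where z0: "z0 \<in> K" "\<And>z. z \<in> K \<Longrightarrow> \<bar>Im (cnj d0 * (z0 - p))\<bar> \<le> \<bar>Im (cnj d0 * (z - p))\<bar>"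
    using continuous_attains_inf[OF compact_K K0] by blast
  define c where "c = \<bar>Im (cnj d0 * (z0 - p))\<bar>"
  have "Im (cnj d0 * z0) \<noteq> Im (cnj d0 * p)"
    using line_points_oriented_line[OF d0, of z0 p] miss z0(1)
    by (auto simp: line_points_def oriented_line_def)
  then have c: "c > 0" by (simp add: c_def right_diff_distrib)
  obtain R where R: "R > 0" "\<And>z. z \<in> K \<Longrightarrow> norm (z - p) \<le> R"
  proof -
    have "bounded ((\<lambda>z. z - p) ` K)"
      by (intro compact_imp_bounded compact_continuous_image compact_K continuous_intros)
    then show thesis using that by (auto simp: bounded_pos)
  qed
  have "\<forall>\<^sub>F x in F. dist (d x) d0 < c / R" using tendstoD[OF d] c R(1) by simp
  then show ?thesis
  proof (rule eventually_mono, intro allI notI)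
    fix x t assume x: "dist (d x) d0 < c / R" and K: "p + t *\<^sub>R d x \<in> K"
    let ?z = "p + t *\<^sub>R d x"
    have "Im (cnj (d x) * (?z - p)) = 0" by (simp add: algebra_simps)
    then have "\<bar>Im (cnj d0 * (?z - p))\<bar> = \<bar>Im (cnj (d x - d0) * (?z - p))\<bar>"
      by (simp add: algebra_simps)
    also have "\<dots> \<le> norm (cnj (d x - d0) * (?z - p))" by (rule abs_Im_le_cmod)
    also have "\<dots> \<le> dist (d x) d0 * R"
      unfolding norm_mult complex_mod_cnj dist_norm using R(2)[OF K] by (intro mult_left_mono) auto
    also have "\<dots> < c" using x R(1) by (simp add: field_simps)
    finally show False using z0(2)[OF K] by (simp add: c_def)
  qed
qed

text \<open>Compactness of \<open>K\<close> gives a limit point \<open>w\<close>. It differs from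
  \<open>y0\<close> because \<open>y0\<close> is outside \<open>K\<close>, so the limit factor
  \<open>norm (w - y0) / norm v0\<close> is positive.\<close>

lemma cone_closed:
  assumes y: "y \<longlonglongrightarrow> y0" "y0 \<notin> K" and v: "v \<longlonglongrightarrow> v0" "v0 \<noteq> 0"
    and t: "\<And>k. \<exists>t>0. y k + t *\<^sub>R v k \<in> K"
  shows "\<exists>t>0. y0 + t *\<^sub>R v0 \<in> K"
proof -
  obtain t where t: "\<And>k. t k > 0" "\<And>k. y k + t k *\<^sub>R v k \<in> K" using t by metis
  obtain w r where w: "w \<in> K" "strict_mono r" "((\<lambda>k. y k + t k *\<^sub>R v k) \<circ> r) \<longlonglongrightarrow> w"
    using compact_K t(2) unfolding compact_def by (metis (no_types, lifting))
  have yr: "(\<lambda>k. y (r k)) \<longlonglongrightarrow> y0" and vr: "(\<lambda>k. v (r k)) \<longlonglongrightarrow> v0"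
    using LIMSEQ_subseq_LIMSEQ[OF y(1) w(2)] LIMSEQ_subseq_LIMSEQ[OF v(1) w(2)] by (simp_all add: o_def)
  have d: "(\<lambda>k. t (r k) *\<^sub>R v (r k)) \<longlonglongrightarrow> w - y0"
    using tendsto_diff[OF w(3) yr] by (simp add: o_def)
  have "(\<lambda>k. norm (t (r k) *\<^sub>R v (r k)) / norm (v (r k))) \<longlonglongrightarrow> norm (w - y0) / norm v0"
    by (intro tendsto_intros d vr) (use v(2) in simp)
  moreover have "\<forall>\<^sub>F k in sequentially. norm (t (r k) *\<^sub>R v (r k)) / norm (v (r k)) = t (r k)"
    using tendsto_imp_eventually_ne[OF vr v(2)] by eventually_elim (use t(1) less_imp_le in \<open>simp add: abs_of_pos\<close>)
  ultimately have "(\<lambda>k. t (r k)) \<longlonglongrightarrow> norm (w - y0) / norm v0"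
    by (rule Lim_transform_eventually)
  then have "(\<lambda>k. t (r k) *\<^sub>R v (r k)) \<longlonglongrightarrow> (norm (w - y0) / norm v0) *\<^sub>R v0"
    using vr by (rule tendsto_scaleR)
  then have "(norm (w - y0) / norm v0) *\<^sub>R v0 = w - y0" using d LIMSEQ_unique by blast
  moreover have "w \<noteq> y0" using w(1) y(2) by auto
  ultimately show ?thesis using w(1) v(2)
    by (intro exI[of _ "norm (w - y0) / norm v0"]) auto
qed

end

section \<open>Commuting billiards\<close>

text \<open>The two regularity assumptions differ because directions are reflected at moving points
  of the outer boundary only, so that normals of \<Omega>2 have to vary in a controlled way; at the
  inner boundary first-order flatness is used.\<close>

locale commuting_billiards = A: convex_body \<Omega>1 + B: convex_body \<Omega>2
  for \<Omega>1 \<Omega>2 :: "complex set" +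
  assumes nested: "\<Omega>1 \<subseteq> interior \<Omega>2"
    and commute: "billiards_commute \<Omega>1 \<Omega>2"
    and smooth_A: "\<exists>F. finite F \<and> (\<forall>x\<in>frontier \<Omega>1 - F. smooth_at \<Omega>1 x)"
    and regular_B: "\<exists>F. finite F \<and> (\<forall>x\<in>frontier \<Omega>2 - F. B.regular_at x)"
begin

section \<open>The cone under which the inner domain is seen, and smoothness of the outer
  boundary\<close>

lemma A_in_interior_B: "x \<in> \<Omega>1 \<Longrightarrow> x \<in> interior \<Omega>2"
  using nested by blast

lemma frontier_B_notin_A: "y \<in> frontier \<Omega>2 \<Longrightarrow> y \<notin> \<Omega>1"
  using nested by (auto simp: frontier_def)

lemma inward: "n \<in> support_normals \<Omega>2 y \<Longrightarrow> z \<in> \<Omega>1 \<Longrightarrow> n \<bullet> (z - y) < 0"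
  using B.support_normals_interior nested by blast

lemma A_smooth_eventually:
  assumes z: "(z \<longlongrightarrow> z0) (at (0::real))" and ne: "\<forall>\<^sub>F \<theta> in at 0. z \<theta> \<noteq> z0"
    and K: "\<forall>\<^sub>F \<theta> in at 0. z \<theta> \<in> frontier \<Omega>1"
  shows "\<forall>\<^sub>F \<theta> in at 0. smooth_at \<Omega>1 (z \<theta>)"
proof -
  obtain F where F: "finite F" "\<forall>x\<in>frontier \<Omega>1 - F. smooth_at \<Omega>1 x" using smooth_A by blast
  show ?thesis using eventually_avoid_finite[OF F(1) z ne] K
    by eventually_elim (use F(2) in blast)
qed

text \<open>A line missing \<open>\<Omega>1\<close> is fixed by the inner billiard, hence so is its reflection in the
  outer boundary, which then cannot cross the interior of \<open>\<Omega>1\<close>; small rotations about \<open>y\<close> avoid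
  the corners of \<open>\<Omega>1\<close>.\<close>

lemma caustic_weak:
  assumes y: "y \<in> frontier \<Omega>2" and sn: "support_normals \<Omega>2 y = {n}" and v: "y + v \<in> interior \<Omega>1"
  shows "\<exists>t>0. y + t *\<^sub>R (n\<^sup>2 * cnj v) \<in> \<Omega>1"
proof (rule ccontr)
  assume no: "\<not> ?thesis"
  have nS: "n \<in> support_normals \<Omega>2 y" and nn: "norm n = 1" using sn by (auto simp: support_normals_iff dest: equalityD2)
  have nv: "n \<bullet> v < 0" using inward[OF nS, of "y + v"] v interior_subset by fastforce
  then have v0: "v \<noteq> 0" by auto
  define d2 where "d2 = v /\<^sub>R norm v"
  define d where "d = reflect n d2"
  have d2: "norm d2 = 1" "v = norm v *\<^sub>R d2" "n \<bullet> d2 < 0"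
    using v0 nv by (auto simp: d2_def mult_neg_pos divide_less_0_iff field_simps zero_less_norm_iff)
  have d: "norm d = 1" "n \<bullet> d > 0" "reflect n d = d2"
    using d2 nn by (auto simp: d_def norm_reflect inner_reflect reflect_reflect)
  have "n\<^sup>2 * cnj v = - norm v *\<^sub>R d"
    by (subst d2(2)) (simp add: d_def reflect_def scaleR_conv_of_real)
  then have miss: "y + t *\<^sub>R d \<notin> \<Omega>1" for t
  proof (cases "t < 0")
    case True
    then have "y + (- t / norm v) *\<^sub>R (n\<^sup>2 * cnj v) \<notin> \<Omega>1" using no v0
      by (metis divide_pos_pos neg_0_less_iff_less zero_less_norm_iff)
    then show ?thesis using v0 \<open>n\<^sup>2 * cnj v = - norm v *\<^sub>R d\<close> by simp
  next
    case False
    then have "n \<bullet> (y + t *\<^sub>R d - y) \<ge> 0" using d(2) by simp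
    then show ?thesis using inward[OF nS, of "y + t *\<^sub>R d"] by fastforce
  qed
  \<comment> \<open>Turning \<open>d\<close> by \<open>- \<theta>\<close> turns its reflection
    \<open>d2\<close> by \<theta>. For small nonzero \<theta> the reflected line leaves \<Omega>1 at
    a smooth point.\<close>
  define D where "D \<theta> = cis (- \<theta>) * d" for \<theta>
  define D2 where "D2 \<theta> = cis \<theta> * d2" for \<theta>
  have Dlim: "(D \<longlongrightarrow> d) (at 0)" "(D2 \<longlongrightarrow> d2) (at 0)"
  proof -
    have "(D \<longlongrightarrow> cis (- 0) * d) (at 0)" "(D2 \<longlongrightarrow> cis 0 * d2) (at 0)"
      unfolding D_def D2_def by (intro tendsto_intros tendsto_cis)+
    then show "(D \<longlongrightarrow> d) (at 0)" "(D2 \<longlongrightarrow> d2) (at 0)" by simp_all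
  qed
  have RD: "reflect n (D \<theta>) = D2 \<theta>" for \<theta> unfolding D_def D2_def reflect_cis d(3) by simp
  have ND: "norm (D \<theta>) = 1" "norm (D2 \<theta>) = 1" for \<theta> using d d2 by (auto simp: D_def D2_def norm_mult)
  have int: "y + norm v *\<^sub>R d2 \<in> interior \<Omega>1" using v d2(2) by simp
  have d20: "d2 \<noteq> 0" using d2(1) by auto
  have e1: "\<forall>\<^sub>F \<theta> in at 0. exits \<Omega>1 (hit \<Omega>1 y (D2 \<theta>)) (D2 \<theta>) \<and> y + norm v *\<^sub>R D2 \<theta> \<in> interior \<Omega>1 \<and> D2 \<theta> \<noteq> 0
     \<and> (\<exists>t. hit \<Omega>1 y (D2 \<theta>) = y + t *\<^sub>R D2 \<theta>)"
    by (rule A.eventually_exits_hit[OF tendsto_const Dlim(2) d20 int])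
  have e2: "\<forall>\<^sub>F \<theta> in at 0. \<forall>t. y + t *\<^sub>R D \<theta> \<notin> \<Omega>1"
    by (rule A.line_miss_open[OF miss d(1) Dlim(1)])
  have "((\<lambda>\<theta>. n \<bullet> D \<theta>) \<longlongrightarrow> n \<bullet> d) (at 0)" by (intro tendsto_intros Dlim)
  then have e3: "\<forall>\<^sub>F \<theta> in at 0. n \<bullet> D \<theta> > 0" using d(2) by (rule order_tendstoD)
  have zlim: "((\<lambda>\<theta>. hit \<Omega>1 y (D2 \<theta>)) \<longlongrightarrow> hit \<Omega>1 y d2) (at 0)"
    by (rule A.hit_tendsto[OF tendsto_const Dlim(2) d20 int])
  obtain t0 where t0: "hit \<Omega>1 y d2 = y + t0 *\<^sub>R d2" "exits \<Omega>1 (hit \<Omega>1 y d2) d2"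
    using A.exits_hit[of y "norm v" d2] int d20 interior_subset by blast
  have "t0 \<noteq> 0" using t0 frontier_B_notin_A[OF y] by (auto simp: exits_def)
  have e4: "\<forall>\<^sub>F \<theta> in at 0. hit \<Omega>1 y (D2 \<theta>) \<noteq> hit \<Omega>1 y d2"
    using rotated_ray_ne[OF d20, of y] e1
  proof eventually_elim
    case (elim \<theta>)
    then show ?case using t0(1) \<open>t0 \<noteq> 0\<close> by (metis D2_def)
  qed
  have e5: "\<forall>\<^sub>F \<theta> in at 0. hit \<Omega>1 y (D2 \<theta>) \<in> frontier \<Omega>1"
    using e1 by eventually_elim (use A.exits_frontier in blast)
  have e6: "\<forall>\<^sub>F \<theta> in at 0. smooth_at \<Omega>1 (hit \<Omega>1 y (D2 \<theta>))"
    by (rule A_smooth_eventually[OF zlim e4 e5])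
  have "\<forall>\<^sub>F \<theta> in at (0::real). False"
    using e1 e2 e3 e6
  proof eventually_elim
    case (elim \<theta>)
    obtain t where t: "hit \<Omega>1 y (D2 \<theta>) = y + t *\<^sub>R D2 \<theta>" using elim by blast
    let ?x = "hit \<Omega>1 y (D2 \<theta>)"
    let ?l = "oriented_line y (D \<theta>)"
    have B1: "billiard_map \<Omega>1 ?l = Some ?l"
      using billiard_map_miss[OF ND(1)] elim by blast
    have "exits \<Omega>2 y (D \<theta>)"
      using B.exits_smooth[OF _ nS] y B.frontier_subset elim by blast
    then have B2: "billiard_map \<Omega>2 ?l = Some (oriented_line y (D2 \<theta>))"
      using billiard_map_hit[OF ND(1) _ sn] RD by simp
    have line: "oriented_line y (D2 \<theta>) = oriented_line ?x (D2 \<theta>)"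
      unfolding t using oriented_line_shift[OF ND(2)] by simp
    have sx: "support_normals \<Omega>1 ?x = {normal \<Omega>1 ?x}" using smooth_at_normal elim by blast
    then have "billiard_map \<Omega>1 (oriented_line y (D2 \<theta>)) = Some (oriented_line ?x (reflect (normal \<Omega>1 ?x) (D2 \<theta>)))"
      unfolding line using billiard_map_hit[OF ND(2)] elim by blast
    then have "oriented_line y (D2 \<theta>) = oriented_line ?x (reflect (normal \<Omega>1 ?x) (D2 \<theta>))"
      using commute B1 B2 ND(1) unfolding billiards_commute_def is_oline_def
      by (metis fst_conv oriented_line_def)
    \<comment> \<open>A direction fixed by the reflection is tangent to \<Omega>1 at the exit point,
      although the line crosses the interior.\<close>
    then have "D2 \<theta> = reflect (normal \<Omega>1 ?x) (D2 \<theta>)" using oriented_line_eqD ND(2) by blast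
    moreover have "norm (normal \<Omega>1 ?x) = 1" using sx by (auto simp: support_normals_iff dest: equalityD2)
    ultimately have "normal \<Omega>1 ?x \<bullet> D2 \<theta> = 0" using inner_reflect[of "normal \<Omega>1 ?x" "D2 \<theta>"] by simp
    moreover have "?x + (norm v - t) *\<^sub>R D2 \<theta> \<in> interior \<Omega>1" using elim t by (simp add: algebra_simps)
    then have "normal \<Omega>1 ?x \<bullet> D2 \<theta> > 0" using A.exits_transversal[of ?x "D2 \<theta>" _ "normal \<Omega>1 ?x"] elim sx by blast
    ultimately show ?case by simp
  qed
  then show False by simp
qed

text \<open>The interior is dense in \<Omega>1, and the cone over a compact set avoiding its apex is
  closed.\<close>

lemma caustic_closed:
  assumes y: "y \<in> frontier \<Omega>2" and sn: "support_normals \<Omega>2 y = {n}" and z: "z \<in> \<Omega>1"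
  shows "\<exists>t>0. y + t *\<^sub>R (n\<^sup>2 * cnj (z - y)) \<in> \<Omega>1"
proof -
  have nn: "norm n = 1" using sn by (auto simp: support_normals_iff dest: equalityD2)
  have "z \<in> closure (interior \<Omega>1)" using z A.closure_interior_K by simp
  then obtain w where w: "\<And>k. w k \<in> interior \<Omega>1" "w \<longlonglongrightarrow> z"
    unfolding closure_sequential by blast
  show ?thesis
  proof (rule A.cone_closed[OF tendsto_const frontier_B_notin_A[OF y]])
    show "(\<lambda>k. n\<^sup>2 * cnj (w k - y)) \<longlonglongrightarrow> n\<^sup>2 * cnj (z - y)" by (intro tendsto_intros w)
    show "n\<^sup>2 * cnj (z - y) \<noteq> 0" using nn z frontier_B_notin_A[OF y] by auto
    show "\<exists>t>0. y + t *\<^sub>R (n\<^sup>2 * cnj (w k - y)) \<in> \<Omega>1" for k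
      using caustic_weak[OF y sn, of "w k - y"] w(1) by simp
  qed
qed

text \<open>If the reflected line missed the interior, it would carry a functional that is
  nonnegative on \<Omega>1. By \<open>caustic_closed\<close> its mirror image is nonnegative on
  \<Omega>1 too, yet vanishes at the interior point \<open>y + v\<close>.\<close>

lemma caustic_interior:
  assumes y: "y \<in> frontier \<Omega>2" and sn: "support_normals \<Omega>2 y = {n}" and v: "y + v \<in> interior \<Omega>1"
  shows "\<exists>t. y + t *\<^sub>R (n\<^sup>2 * cnj v) \<in> interior \<Omega>1"
proof (rule ccontr)
  assume no: "\<not> ?thesis"
  have nn: "norm n = 1" using sn by (auto simp: support_normals_iff dest: equalityD2)
  obtain a where a: "norm a = 1" "a \<bullet> (n\<^sup>2 * cnj v) = 0" "\<And>z. z \<in> \<Omega>1 \<Longrightarrow> a \<bullet> (z - y) \<ge> 0"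
    using A.line_misses_interior[of y "n\<^sup>2 * cnj v"] no by blast
  define b where "b = n\<^sup>2 * cnj a"
  have bv: "b \<bullet> v = 0" using a(2) by (simp add: b_def inner_reflect_adjoint)
  have "b \<bullet> (z - y) \<ge> 0" if z: "z \<in> \<Omega>1" for z
  proof -
    obtain t where t: "t > 0" "y + t *\<^sub>R (n\<^sup>2 * cnj (z - y)) \<in> \<Omega>1" using caustic_closed[OF y sn z] by blast
    then have "t * (a \<bullet> (n\<^sup>2 * cnj (z - y))) \<ge> 0" using a(3)[OF t(2)] by simp
    then show ?thesis using t(1) by (simp add: b_def inner_reflect_adjoint zero_le_mult_iff del: complex_cnj_diff)
  qed
  then have "- b \<in> support_normals \<Omega>1 (y + v)"
    using a(1) nn bv by (auto simp: support_normals_iff b_def norm_mult norm_power inner_diff_right inner_add_right)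
  then show False using A.support_normals_interior[OF _ v] by fastforce
qed

text \<open>The two reflections compose to a rotation \<omega> preserving the cone \<open>C\<close>,
  on which \<open>- (e \<bullet> v) \<ge> c * norm v\<close> with \<open>c > 0\<close>. Sums of the
  vectors \<open>\<omega> ^ i * v\<close> would have an unbounded component along \<open>e\<close>,
  but for \<omega> different from 1 the geometric series is bounded. So \<omega> is 1, and
  inwardness excludes \<open>e' = - e\<close>.\<close>

lemma cone_reflections_eq:
  assumes y: "y \<in> frontier \<Omega>2" and e: "e \<in> support_normals \<Omega>2 y" and e': "e' \<in> support_normals \<Omega>2 y"
    and inv: "\<And>z. z \<in> \<Omega>1 \<Longrightarrow> \<exists>t>0. y + t *\<^sub>R (e\<^sup>2 * cnj (z - y)) \<in> \<Omega>1"
    and inv': "\<And>z. z \<in> \<Omega>1 \<Longrightarrow> \<exists>t>0. y + t *\<^sub>R (e'\<^sup>2 * cnj (z - y)) \<in> \<Omega>1"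
  shows "e = e'"
proof -
  define C where "C = {v. \<exists>t>0. y + t *\<^sub>R v \<in> \<Omega>1}"
  have yA: "y \<notin> \<Omega>1" using frontier_B_notin_A[OF y] .
  have nn: "norm e = 1" "norm e' = 1" using e e' by (auto simp: support_normals_iff)
  have A0: "\<Omega>1 \<noteq> {}" using A.interior_K interior_subset by blast
  have step: "e\<^sup>2 * cnj v \<in> C" if v: "v \<in> C" for v
  proof -
    obtain s where s: "s > 0" "y + s *\<^sub>R v \<in> \<Omega>1" using v unfolding C_def by blast
    obtain t where t: "t > 0" "y + t *\<^sub>R (e\<^sup>2 * cnj (s *\<^sub>R v)) \<in> \<Omega>1" using inv[OF s(2)] by auto
    then have "y + (t * s) *\<^sub>R (e\<^sup>2 * cnj v) \<in> \<Omega>1" by (simp add: scaleR_conv_of_real mult_ac)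
    then show ?thesis using s t by (auto simp: C_def intro!: exI[of _ "t * s"])
  qed
  have step': "e'\<^sup>2 * cnj v \<in> C" if v: "v \<in> C" for v
  proof -
    obtain s where s: "s > 0" "y + s *\<^sub>R v \<in> \<Omega>1" using v unfolding C_def by blast
    obtain t where t: "t > 0" "y + t *\<^sub>R (e'\<^sup>2 * cnj (s *\<^sub>R v)) \<in> \<Omega>1" using inv'[OF s(2)] by auto
    then have "y + (t * s) *\<^sub>R (e'\<^sup>2 * cnj v) \<in> \<Omega>1" by (simp add: scaleR_conv_of_real mult_ac)
    then show ?thesis using s t by (auto simp: C_def intro!: exI[of _ "t * s"])
  qed
  define \<omega> where "\<omega> = (e' * cnj e)\<^sup>2"
  have \<omega>C: "\<omega> * v \<in> C" if v: "v \<in> C" for v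
  proof -
    have "e'\<^sup>2 * cnj (e\<^sup>2 * cnj v) \<in> C" using step step' v by blast
    then show ?thesis by (simp add: \<omega>_def power_mult_distrib mult_ac)
  qed
  have "continuous_on \<Omega>1 (\<lambda>z. - (e \<bullet> (z - y)) / norm (z - y))"
    using yA by (intro continuous_intros) auto
  then obtain z0 where z0: "z0 \<in> \<Omega>1" "\<And>z. z \<in> \<Omega>1 \<Longrightarrow> - (e \<bullet> (z0 - y)) / norm (z0 - y) \<le> - (e \<bullet> (z - y)) / norm (z - y)"
    using continuous_attains_inf[OF A.compact_K A0] by blast
  define c where "c = - (e \<bullet> (z0 - y)) / norm (z0 - y)"
  have "norm (z0 - y) > 0" using z0(1) yA by auto
  then have c: "c > 0" using divide_neg_pos[OF inward[OF e z0(1)]] by (simp add: c_def)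
  have Cc: "e \<bullet> v \<le> - c * norm v" if v: "v \<in> C" for v
  proof -
    obtain s where s: "s > 0" "y + s *\<^sub>R v \<in> \<Omega>1" using v unfolding C_def by blast
    have "v \<noteq> 0" using s yA by auto
    have "c \<le> - (e \<bullet> v) / norm v" using z0(2)[OF s(2)] s(1) unfolding c_def by simp
    then show ?thesis using \<open>v \<noteq> 0\<close> by (simp add: field_simps)
  qed
  define v where "v = z0 - y"
  have v: "v \<in> C" "v \<noteq> 0" using z0(1) yA by (auto simp: C_def v_def intro!: exI[of _ 1])
  have pw: "\<omega> ^ k * v \<in> C" for k by (induction k) (use v \<omega>C in \<open>auto simp: mult.assoc\<close>)
  have n\<omega>: "norm \<omega> = 1" using nn by (simp add: \<omega>_def norm_mult norm_power)
  have "\<omega> = 1"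
  proof (rule ccontr)
    assume w1: "\<omega> \<noteq> 1"
    have bound: "real k * (c * norm v) \<le> 2 / norm (\<omega> - 1) * norm v" for k
    proof -
      have "e \<bullet> (\<Sum>i<k. \<omega> ^ i * v) = (\<Sum>i<k. e \<bullet> (\<omega> ^ i * v))" by (rule inner_sum_right)
      also have "\<dots> \<le> (\<Sum>i<k. - c * norm v)"
        using Cc[OF pw] n\<omega> by (intro sum_mono) (simp add: norm_mult norm_power)
      finally have 1: "e \<bullet> (\<Sum>i<k. \<omega> ^ i * v) \<le> - (real k * (c * norm v))" by simp
      have "(\<Sum>i<k. \<omega> ^ i * v) = (\<omega> ^ k - 1) / (\<omega> - 1) * v"
        using geometric_sum[OF w1, of k] by (simp add: sum_distrib_right[symmetric])
      then have "norm (\<Sum>i<k. \<omega> ^ i * v) = norm (\<omega> ^ k - 1) / norm (\<omega> - 1) * norm v"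
        by (simp add: norm_mult norm_divide)
      also have "\<dots> \<le> 2 / norm (\<omega> - 1) * norm v"
        using norm_triangle_ineq4[of "\<omega> ^ k" 1] n\<omega>
        by (intro mult_right_mono divide_right_mono) (auto simp: norm_power)
      finally show ?thesis using 1 Cauchy_Schwarz_ineq2[of e "\<Sum>i<k. \<omega> ^ i * v"] nn by simp
    qed
    have "c * norm v > 0" using c v by simp
    then obtain k where "real k * (c * norm v) > 2 / norm (\<omega> - 1) * norm v"
      using reals_Archimedean3 by blast
    then show False using bound[of k] by simp
  qed
  then have "e' * cnj e = 1 \<or> e' * cnj e = - 1" by (simp add: \<omega>_def power2_eq_1_iff)
  then have "e' = e \<or> e' = - e"
    using mult_cnj_unit[OF nn(1)] by (metis mult.assoc mult.commute mult.right_neutral mult_minus_left mult_1)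
  moreover have "e' \<noteq> - e"
    using inward[OF e z0(1)] inward[OF e' z0(1)] by auto
  ultimately show ?thesis by blast
qed

text \<open>Smooth points near \<open>y0\<close>, reached by turning a ray about an interior point
  \<open>c\<close>, have normals bisecting the cone of \<Omega>1. Their only possible limit is the
  bisector at \<open>y0\<close>, and a common limit from both sides rules out a corner.\<close>

lemma B_smooth:
  assumes y0: "y0 \<in> frontier \<Omega>2"
  shows "smooth_at \<Omega>2 y0"
proof -
  obtain c where c: "c \<in> interior \<Omega>2" using B.interior_K by blast
  define w where "w = y0 - c"
  have w0: "w \<noteq> 0" using y0 c by (auto simp: w_def frontier_def)
  have y0w: "y0 = c + 1 *\<^sub>R w" by (simp add: w_def)
  have pos: "m \<bullet> w > 0" if "m \<in> support_normals \<Omega>2 y0" for m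
    using B.support_normals_interior[OF that c] by (simp add: w_def inner_diff_right)
  obtain m0 where m0: "m0 \<in> support_normals \<Omega>2 y0" using B.support_normals_nonempty[OF y0] by blast
  have ex0: "exits \<Omega>2 y0 w" using B.exits_smooth[OF _ m0 pos[OF m0]] y0 B.frontier_subset by blast
  have hit0: "hit \<Omega>2 c w = y0" using hit_eq[of \<Omega>2 c 1 w] ex0 y0w by simp
  have dlim: "((\<lambda>\<theta>. cis \<theta> * w) \<longlongrightarrow> w) (at 0)"
  proof -
    have "((\<lambda>\<theta>. cis \<theta> * w) \<longlongrightarrow> cis 0 * w) (at 0)" by (intro tendsto_intros tendsto_cis)
    then show ?thesis by simp
  qed
  have int: "c + 0 *\<^sub>R w \<in> interior \<Omega>2" using c by simp
  obtain t t0 where t: "\<forall>\<^sub>F \<theta> in at 0. hit \<Omega>2 c (cis \<theta> * w) = c + t \<theta> *\<^sub>R (cis \<theta> * w) \<and> exits \<Omega>2 (c + t \<theta> *\<^sub>R (cis \<theta> * w)) (cis \<theta> * w)"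
    "hit \<Omega>2 c w = c + t0 *\<^sub>R w" "exits \<Omega>2 (c + t0 *\<^sub>R w) w" "(t \<longlongrightarrow> t0) (at 0)"
    using B.hit_time[OF tendsto_const dlim w0 int] by blast
  have "(t0 - 1) *\<^sub>R w = 0" using t(2) hit0 y0w by (simp add: scaleR_diff_left)
  then have t01: "t0 = 1" using w0 by simp
  define z where "z \<theta> = hit \<Omega>2 c (cis \<theta> * w)" for \<theta>
  define m where "m \<theta> = normal \<Omega>2 (z \<theta>)" for \<theta>
  have zlim: "(z \<longlongrightarrow> y0) (at 0)"
    unfolding z_def using B.hit_tendsto[OF tendsto_const dlim w0 int] hit0 by simp
  have zfr: "\<forall>\<^sub>F \<theta> in at 0. z \<theta> \<in> frontier \<Omega>2"
    using t(1) by eventually_elim (use B.exits_frontier w0 in \<open>force simp: z_def\<close>)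
  have mz: "\<forall>\<^sub>F \<theta> in at 0. m \<theta> \<in> support_normals \<Omega>2 (z \<theta>)"
    using zfr by eventually_elim (simp add: m_def B.normal_in)
  have zne: "\<forall>\<^sub>F \<theta> in at 0. z \<theta> \<noteq> y0"
    using rotated_ray_ne[OF w0, of c] t(1) by eventually_elim (metis y0w z_def zero_neq_one)
  obtain F where F: "finite F" "\<forall>x\<in>frontier \<Omega>2 - F. B.regular_at x" using regular_B by blast
  have smooth: "\<forall>\<^sub>F \<theta> in at 0. support_normals \<Omega>2 (z \<theta>) = {m \<theta>}"
    using eventually_avoid_finite[OF F(1) zlim zne] zfr
    by eventually_elim (use F(2) B.regular_smooth smooth_at_normal in \<open>auto simp: m_def\<close>)
  \<comment> \<open>Every limit of nearby normals inherits by closedness the two properties that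
    \<open>cone_reflections_eq\<close> requires; hence there is only one.\<close>
  have key: "E \<in> support_normals \<Omega>2 y0 \<and> (\<forall>x\<in>\<Omega>1. \<exists>t>0. y0 + t *\<^sub>R (E\<^sup>2 * cnj (x - y0)) \<in> \<Omega>1)"
    if s: "filterlim s (at 0) sequentially" and E: "(\<lambda>k. m (s k)) \<longlonglongrightarrow> E" for s E
  proof
    have zs: "(\<lambda>k. z (s k)) \<longlonglongrightarrow> y0" by (rule filterlim_compose[OF zlim s])
    show En: "E \<in> support_normals \<Omega>2 y0"
      by (rule B.support_normals_closed[OF zs E eventually_compose_filterlim[OF mz s]]) simp
    have "\<forall>\<^sub>F k in sequentially. support_normals \<Omega>2 (z (s k)) = {m (s k)} \<and> z (s k) \<in> frontier \<Omega>2"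
      using eventually_conj[OF eventually_compose_filterlim[OF smooth s] eventually_compose_filterlim[OF zfr s]] .
    then obtain N where N: "\<And>k. k \<ge> N \<Longrightarrow> support_normals \<Omega>2 (z (s k)) = {m (s k)} \<and> z (s k) \<in> frontier \<Omega>2"
      by (auto simp: eventually_sequentially)
    show "\<forall>x\<in>\<Omega>1. \<exists>t>0. y0 + t *\<^sub>R (E\<^sup>2 * cnj (x - y0)) \<in> \<Omega>1"
    proof
      fix x assume x: "x \<in> \<Omega>1"
      have zN: "(\<lambda>k. z (s (k + N))) \<longlonglongrightarrow> y0" and EN: "(\<lambda>k. m (s (k + N))) \<longlonglongrightarrow> E"
        using zs E by (auto intro: LIMSEQ_ignore_initial_segment)
      show "\<exists>t>0. y0 + t *\<^sub>R (E\<^sup>2 * cnj (x - y0)) \<in> \<Omega>1"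
      proof (rule A.cone_closed[OF zN frontier_B_notin_A[OF y0]])
        show "(\<lambda>k. (m (s (k + N)))\<^sup>2 * cnj (x - z (s (k + N)))) \<longlonglongrightarrow> E\<^sup>2 * cnj (x - y0)"
          by (intro tendsto_intros zN EN)
        show "E\<^sup>2 * cnj (x - y0) \<noteq> 0"
          using En x frontier_B_notin_A[OF y0] by (auto simp: support_normals_iff)
        show "\<exists>t>0. z (s (k + N)) + t *\<^sub>R ((m (s (k + N)))\<^sup>2 * cnj (x - z (s (k + N)))) \<in> \<Omega>1" for k
          using caustic_closed N[of "k + N"] x by simp
      qed
    qed
  qed
  have "\<exists>E. (m \<longlongrightarrow> E) (at 0)"
  proof (rule limit_exists_compact[OF compact_sphere[of 0 1]])
    show "\<forall>\<^sub>F \<theta> in at 0. m \<theta> \<in> sphere 0 1" using mz by eventually_elim (simp add: support_normals_iff)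
    fix s s' E E' assume "filterlim s (at 0) sequentially" "filterlim s' (at 0) sequentially"
      "(\<lambda>k. m (s k)) \<longlonglongrightarrow> E" "(\<lambda>k. m (s' k)) \<longlonglongrightarrow> E'"
    then show "E = E'" using key cone_reflections_eq[OF y0] by blast
  qed
  then obtain E where E: "(m \<longlongrightarrow> E) (at 0)" by blast
  have "E \<in> support_normals \<Omega>2 y0" by (rule B.support_normals_closed[OF zlim E mz]) simp
  then have "E \<bullet> w \<noteq> 0" using pos by fastforce
  then have "support_normals \<Omega>2 y0 = {E}"
    using t t01 y0w zfr B.frontier_subset
    by (intro B.two_sided_normal_limit[OF y0 y0w _ _ _ _ mz E])
       (auto simp: z_def elim: eventually_mono)
  then show ?thesis by (auto simp: smooth_at_def)
qed

lemma B_normal: "y \<in> frontier \<Omega>2 \<Longrightarrow> support_normals \<Omega>2 y = {normal \<Omega>2 y}"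
  using B_smooth smooth_at_normal by blast

text \<open>The reflected line crosses \<Omega>1 and does not merely touch it, which makes the next
  exit point depend continuously on the line.\<close>

lemma reflected_meets_interior:
  assumes "y \<in> frontier \<Omega>2" "y + u *\<^sub>R d \<in> interior \<Omega>1"
  shows "\<exists>s. y + s *\<^sub>R reflect (normal \<Omega>2 y) d \<in> interior \<Omega>1"
proof -
  obtain t where "y + t *\<^sub>R ((normal \<Omega>2 y)\<^sup>2 * cnj (u *\<^sub>R d)) \<in> interior \<Omega>1"
    using caustic_interior[OF assms(1) B_normal[OF assms(1)] assms(2)] by blast
  then show ?thesis
    by (intro exI[of _ "- (t * u)"]) (simp add: reflect_def scaleR_conv_of_real mult_ac)
qed

text \<open>Inner billiard first, the line runs along \<open>x y'\<close> and then leaves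
  \<open>y'\<close>; outer first, along \<open>y x'\<close> and then leaves \<open>x'\<close>.
  Equality of the resulting oriented lines contains an equality of directions and an
  incidence.\<close>

lemma commuting_reflections:
  assumes d: "norm d = 1" and x: "exits \<Omega>1 x d" "smooth_at \<Omega>1 x"
    and y: "exits \<Omega>2 y d" "y = x + r *\<^sub>R d"
    and x': "exits \<Omega>1 x' (reflect (normal \<Omega>2 y) d)" "x' = y + s *\<^sub>R reflect (normal \<Omega>2 y) d" "smooth_at \<Omega>1 x'"
  defines "d1 \<equiv> reflect (normal \<Omega>1 x) d"
  defines "y' \<equiv> hit \<Omega>2 x d1"
  shows "reflect (normal \<Omega>2 y') d1 = reflect (normal \<Omega>1 x') (reflect (normal \<Omega>2 y) d)"
    and "\<exists>S. x' = y' + S *\<^sub>R reflect (normal \<Omega>2 y') d1"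
    and "exits \<Omega>2 y' d1" "\<exists>R. y' = x + R *\<^sub>R d1"
proof -
  define d2 where "d2 = reflect (normal \<Omega>2 y) d"
  have d0: "d \<noteq> 0" using d by auto
  have yf: "y \<in> frontier \<Omega>2" using B.exits_frontier[OF y(1) d0] .
  have sy: "support_normals \<Omega>2 y = {normal \<Omega>2 y}" by (rule B_normal[OF yf])
  have sx: "support_normals \<Omega>1 x = {normal \<Omega>1 x}" "support_normals \<Omega>1 x' = {normal \<Omega>1 x'}"
    using x x' smooth_at_normal by auto
  have nn: "norm (normal \<Omega>1 x) = 1" "norm (normal \<Omega>2 y) = 1"
    using sx sy by (auto simp: support_normals_iff dest: equalityD2)
  have d1: "norm d1 = 1" "norm d2 = 1" using d nn by (auto simp: d1_def d2_def norm_reflect)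
  have d10: "d1 \<noteq> 0" using d1 by auto
  have xA: "x \<in> \<Omega>1" using x(1) by (simp add: exits_def)
  then have "x + 0 *\<^sub>R d1 \<in> \<Omega>2" using A_in_interior_B interior_subset by auto
  then show y': "exits \<Omega>2 y' d1" "\<exists>R. y' = x + R *\<^sub>R d1"
    using B.exits_hit[of x 0 d1] d10 unfolding y'_def by blast+
  then obtain R where R: "y' = x + R *\<^sub>R d1" by blast
  have sy': "support_normals \<Omega>2 y' = {normal \<Omega>2 y'}" using B_normal B.exits_frontier[OF y'(1) d10] by blast
  then have nn': "norm (normal \<Omega>2 y') = 1" by (auto simp: support_normals_iff dest: equalityD2)
  have m1: "billiard_map \<Omega>1 (oriented_line x d) = Some (oriented_line x d1)"
    unfolding d1_def by (rule billiard_map_hit[OF d x(1) sx(1)])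
  have "oriented_line x d1 = oriented_line y' d1" unfolding R using oriented_line_shift[OF d1(1)] by simp
  then have p1: "billiard_map \<Omega>2 (oriented_line x d1) = Some (oriented_line y' (reflect (normal \<Omega>2 y') d1))"
    using billiard_map_hit[OF d1(1) y'(1) sy'] by simp
  have "oriented_line x d = oriented_line y d" unfolding y(2) using oriented_line_shift[OF d] by simp
  then have m2: "billiard_map \<Omega>2 (oriented_line x d) = Some (oriented_line y d2)"
    unfolding d2_def using billiard_map_hit[OF d y(1) sy] by simp
  have "oriented_line y d2 = oriented_line x' d2" unfolding x'(2) d2_def[symmetric] using oriented_line_shift[OF d1(2)] by simp
  then have p2: "billiard_map \<Omega>1 (oriented_line y d2) = Some (oriented_line x' (reflect (normal \<Omega>1 x') d2))"
    using billiard_map_hit[OF d1(2) _ sx(2)] x'(1) by (simp add: d2_def)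
  have "is_oline (oriented_line x d)" using d by (simp add: is_oline_def oriented_line_def)
  then have eq: "oriented_line y' (reflect (normal \<Omega>2 y') d1) = oriented_line x' (reflect (normal \<Omega>1 x') d2)"
    using commute m1 m2 p1 p2 unfolding billiards_commute_def by blast
  have "norm (reflect (normal \<Omega>2 y') d1) = 1" using d1 nn' by (simp add: norm_reflect)
  then show "reflect (normal \<Omega>2 y') d1 = reflect (normal \<Omega>1 x') (reflect (normal \<Omega>2 y) d)"
    "\<exists>S. x' = y' + S *\<^sub>R reflect (normal \<Omega>2 y') d1"
    using oriented_line_eqD[OF eq] by (auto simp: d2_def)
qed

end

text \<open>Pair the closing relation of the quadrilateral with a vector \<open>q\<close> on which
  both sides adjacent to the fourth vertex have the same projection. Then \<open>R\<close> and
  \<open>S\<close> enter only through their sum, which is \<open>r + s\<close>. The result says that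
  the tangents at \<open>x\<close> and \<open>x'\<close> cut the tangent at \<open>y\<close> at the
  same point.\<close>

lemma concurrency_identity:
  assumes nx: "norm nx = 1" and ny: "norm ny = 1" and nx': "norm nx' = 1" and d: "norm d = 1"
    and cl: "r *\<^sub>R d + s *\<^sub>R reflect ny d = R *\<^sub>R reflect nx d + S *\<^sub>R reflect nx' (reflect ny d)"
    and len: "r + s = R + S"
  shows "r * (nx \<bullet> d) * (nx' \<bullet> (\<i> * ny)) + s * (nx' \<bullet> reflect ny d) * (nx \<bullet> (\<i> * ny)) = 0"
proof -
  define \<tau> where "\<tau> = \<i> * ny"
  define d2 where "d2 = reflect ny d"
  \<comment> \<open>With this product of the two normals and the conjugate tangent, the expressions
    \<open>q1\<close> and \<open>q3\<close> become complex conjugates of each other.\<close>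
  define q where "q = nx * nx' * cnj \<tau>"
  have t1: "\<tau> * cnj \<tau> = 1" using mult_cnj_unit[of \<tau>] ny by (simp add: \<tau>_def norm_mult)
  have d2t: "d2 = \<tau>\<^sup>2 * cnj d" by (simp add: d2_def reflect_def \<tau>_def power_mult_distrib)
  have td: "\<tau> * cnj d2 = cnj \<tau> * d"
  proof -
    have "\<tau> * cnj d2 = (\<tau> * cnj \<tau>) * cnj \<tau> * d" by (simp add: d2t power2_eq_square)
    then show ?thesis using t1 by simp
  qed
  note u = mult_cnj_unit[OF nx] mult_cnj_unit[OF nx']
  have q1: "cnj q * reflect nx d = - (nx * cnj nx' * \<tau> * cnj d)"
  proof -
    have "cnj q * reflect nx d = - ((nx * cnj nx) * (nx * cnj nx' * \<tau> * cnj d))"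
      by (simp add: q_def reflect_def power2_eq_square)
    then show ?thesis using u by simp
  qed
  have q3: "cnj q * reflect nx' d2 = - (cnj nx * nx' * (\<tau> * cnj d2))"
  proof -
    have "cnj q * reflect nx' d2 = - ((nx' * cnj nx') * (cnj nx * nx' * (\<tau> * cnj d2)))"
      by (simp add: q_def reflect_def power2_eq_square)
    then show ?thesis using u by simp
  qed
  have e: "Re (cnj q * reflect nx d) = Re (cnj q * reflect nx' d2)"
    unfolding q1 q3 td by (simp add: algebra_simps)
  have f1: "Re (cnj q * d) - Re (cnj q * reflect nx d) = 2 * (nx \<bullet> d) * (nx' \<bullet> \<tau>)"
    unfolding q1 by (simp add: q_def inner_complex_def algebra_simps)
  have f2: "Re (cnj q * d2) - Re (cnj q * reflect nx' d2) = 2 * (nx' \<bullet> d2) * (nx \<bullet> \<tau>)"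
    unfolding q3 by (simp add: q_def inner_complex_def algebra_simps)
  have "Re (cnj q * (r *\<^sub>R d + s *\<^sub>R d2)) = Re (cnj q * (R *\<^sub>R reflect nx d + S *\<^sub>R reflect nx' d2))"
    using cl by (simp add: d2_def)
  then have "r * Re (cnj q * d) + s * Re (cnj q * d2) = R * Re (cnj q * reflect nx d) + S * Re (cnj q * reflect nx' d2)"
    by (simp add: distrib_left)
  also have "\<dots> = (r + s) * Re (cnj q * reflect nx d)" using len e by (simp add: distrib_right)
  finally have "r * (Re (cnj q * d) - Re (cnj q * reflect nx d)) + s * (Re (cnj q * d2) - Re (cnj q * reflect nx' d2)) = 0"
    using e by algebra
  then have "2 * (r * (nx \<bullet> d) * (nx' \<bullet> \<tau>) + s * (nx' \<bullet> d2) * (nx \<bullet> \<tau>)) = 0"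
    unfolding f1 f2 by (simp add: algebra_simps)
  then show ?thesis by (simp add: \<tau>_def d2_def)
qed

lemma hit_scale:
  assumes "c > 0"
  shows "hit K p (c *\<^sub>R d) = hit K p d"
proof -
  have "(\<exists>t. x = p + t *\<^sub>R c *\<^sub>R d) \<longleftrightarrow> (\<exists>t. x = p + t *\<^sub>R d)" for x
    using assms by (metis divide_self_if less_irrefl scaleR_one scaleR_scaleR times_divide_eq_left mult.commute)
  then show ?thesis unfolding hit_def exits_scale[OF assms] by simp
qed

lemma lipschitz_at_cis:
  "lipschitz_at (\<lambda>\<theta>. cis \<theta> * w) t0" "lipschitz_at (\<lambda>\<theta>. cis (- \<theta>) * w) t0"
proof -
  have "((\<lambda>\<theta>. cis \<theta> * w) has_vector_derivative \<i> * cis t0 * w) (at t0)"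
       "((\<lambda>\<theta>. cis (- \<theta>) * w) has_vector_derivative - \<i> * cis (- t0) * w) (at t0)"
    unfolding has_vector_derivative_def by (auto intro!: derivative_eq_intros simp: algebra_simps)
  then show "lipschitz_at (\<lambda>\<theta>. cis \<theta> * w) t0" "lipschitz_at (\<lambda>\<theta>. cis (- \<theta>) * w) t0"
    by (auto intro: lipschitz_at_deriv)
qed

section \<open>Quadrilaterals between the two boundaries\<close>

context commuting_billiards
begin

text \<open>The quadrilateral of the commutation relation: a line leaves \<open>\<Omega>1\<close> at \<open>x\<close> in the direction \<open>d\<close>,
  leaves \<open>\<Omega>2\<close> at \<open>outer x d\<close>, and its reflection leaves \<open>\<Omega>1\<close> at \<open>far x d\<close>.\<close>

abbreviation outer :: "complex \<Rightarrow> complex \<Rightarrow> complex" where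
  "outer x d \<equiv> hit \<Omega>2 x d"

definition dir2 :: "complex \<Rightarrow> complex \<Rightarrow> complex" where
  "dir2 x d = reflect (normal \<Omega>2 (outer x d)) d"

definition far :: "complex \<Rightarrow> complex \<Rightarrow> complex" where
  "far x d = hit \<Omega>1 (outer x d) (dir2 x d)"

lemma outer_props:
  assumes x: "x \<in> \<Omega>1" and d: "norm d = 1"
  shows "exits \<Omega>2 (outer x d) d" "outer x d \<in> frontier \<Omega>2" "\<exists>r>0. outer x d = x + r *\<^sub>R d"
    "normal \<Omega>2 (outer x d) \<bullet> d > 0"
proof -
  have d0: "d \<noteq> 0" using d by auto
  have xi: "x \<in> interior \<Omega>2" using A_in_interior_B[OF x] .
  then have x2: "x + 0 *\<^sub>R d \<in> \<Omega>2" using interior_subset by auto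
  show ex: "exits \<Omega>2 (outer x d) d" using B.exits_hit(1)[OF x2 d0] .
  show fr: "outer x d \<in> frontier \<Omega>2" using B.exits_frontier[OF ex d0] .
  obtain r where r: "outer x d = x + r *\<^sub>R d" using B.exits_hit(2)[OF x2 d0] by blast
  then have "outer x d + (- r) *\<^sub>R d \<in> interior \<Omega>2" using xi by simp
  from B.exits_transversal[OF ex this B.normal_in[OF fr]]
  show "\<exists>r>0. outer x d = x + r *\<^sub>R d" "normal \<Omega>2 (outer x d) \<bullet> d > 0" using r by auto
qed

lemma norm_normal_B: "y \<in> frontier \<Omega>2 \<Longrightarrow> norm (normal \<Omega>2 y) = 1"
  using B.normal_in by (auto simp: support_normals_iff)

lemma norm_normal_A: "x \<in> frontier \<Omega>1 \<Longrightarrow> norm (normal \<Omega>1 x) = 1"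
  using A.normal_in by (auto simp: support_normals_iff)

lemma far_props:
  assumes x: "x \<in> frontier \<Omega>1" "smooth_at \<Omega>1 x" and d: "norm d = 1" "normal \<Omega>1 x \<bullet> d > 0"
  shows "exits \<Omega>1 x d" "norm (dir2 x d) = 1" "exits \<Omega>1 (far x d) (dir2 x d)" "far x d \<in> frontier \<Omega>1"
    "\<exists>s>0. far x d = outer x d + s *\<^sub>R dir2 x d"
    "\<exists>u. outer x d + u *\<^sub>R d \<in> interior \<Omega>1"
    "\<exists>u. outer x d + u *\<^sub>R dir2 x d \<in> interior \<Omega>1"
proof -
  have xA: "x \<in> \<Omega>1" using x A.frontier_subset by blast
  have sx: "support_normals \<Omega>1 x = {normal \<Omega>1 x}" using x(2) smooth_at_normal by blast
  note out = outer_props[OF xA d(1)]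
  show "exits \<Omega>1 x d" using A.exits_smooth[OF xA _ d(2)] sx by blast
  show n2: "norm (dir2 x d) = 1" unfolding dir2_def using d norm_normal_B[OF out(2)] by (simp add: norm_reflect)
  have "\<exists>t. x + t *\<^sub>R d \<in> interior \<Omega>1"
    by (rule A.transversal_meets_interior[OF xA sx]) (use d(2) in simp)
  then obtain t where t: "x + t *\<^sub>R d \<in> interior \<Omega>1" by blast
  obtain r where r: "outer x d = x + r *\<^sub>R d" using out(3) by blast
  have u: "outer x d + (t - r) *\<^sub>R d \<in> interior \<Omega>1" using t by (simp add: r algebra_simps)
  then show "\<exists>u. outer x d + u *\<^sub>R d \<in> interior \<Omega>1" by blast
  show int: "\<exists>u. outer x d + u *\<^sub>R dir2 x d \<in> interior \<Omega>1"
    using reflected_meets_interior[OF out(2) u] by (simp add: dir2_def)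
  then obtain v where v: "outer x d + v *\<^sub>R dir2 x d \<in> \<Omega>1" using interior_subset by blast
  have d20: "dir2 x d \<noteq> 0" using n2 by auto
  show ex: "exits \<Omega>1 (far x d) (dir2 x d)" unfolding far_def using A.exits_hit(1)[OF v d20] .
  show fr: "far x d \<in> frontier \<Omega>1" using A.exits_frontier[OF ex d20] .
  obtain s where s: "far x d = outer x d + s *\<^sub>R dir2 x d"
    using A.exits_hit(2)[OF v d20] unfolding far_def by blast
  have "far x d \<in> \<Omega>1" using ex by (simp add: exits_def)
  from inward[OF B.normal_in[OF out(2)] this]
  have "s * (normal \<Omega>2 (outer x d) \<bullet> dir2 x d) < 0" by (simp add: s)
  moreover have "normal \<Omega>2 (outer x d) \<bullet> dir2 x d < 0"
    using out(4) by (simp add: dir2_def inner_reflect norm_normal_B[OF out(2)])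
  ultimately have "s > 0" by (simp add: mult_less_0_iff)
  then show "\<exists>s>0. far x d = outer x d + s *\<^sub>R dir2 x d" using s by blast
qed

text \<open>If \<open>far x d\<close> were a corner, the composition with \<open>\<Omega>1\<close> last would jump while the line
  rotates about \<open>outer x d\<close>, whereas the other composition is continuous.\<close>

lemma far_smooth:
  assumes x: "x \<in> frontier \<Omega>1" "smooth_at \<Omega>1 x" and d: "norm d = 1" "normal \<Omega>1 x \<bullet> d > 0"
  shows "smooth_at \<Omega>1 (far x d)"
proof -
  have xA: "x \<in> \<Omega>1" using x A.frontier_subset by blast
  have sx: "support_normals \<Omega>1 x = {normal \<Omega>1 x}" using x(2) smooth_at_normal by blast
  note out = outer_props[OF xA d(1)] and far = far_props[OF x d]
  define y where "y = outer x d"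
  define n where "n = normal \<Omega>2 y"
  define d2 where "d2 = dir2 x d"
  have yf: "y \<in> frontier \<Omega>2" using out(2) by (simp add: y_def)
  have "norm n = 1" using norm_normal_B[OF yf] by (simp add: n_def)
  have sn: "support_normals \<Omega>2 y = {n}" using B_normal[OF yf] by (simp add: n_def)
  have rd: "reflect n d = d2" by (simp add: d2_def dir2_def n_def y_def)
  have d0: "d \<noteq> 0" using d by auto
  have nd2: "norm d2 = 1" using far(2) by (simp add: d2_def)
  then have d20: "d2 \<noteq> 0" by auto
  obtain r where r: "r > 0" "y = x + r *\<^sub>R d" using out(3) by (auto simp: y_def)
  obtain u where u: "y + u *\<^sub>R d \<in> interior \<Omega>1" using far(6) by (auto simp: y_def)
  obtain v where v: "y + v *\<^sub>R d2 \<in> interior \<Omega>1" using far(7) by (auto simp: y_def d2_def)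
  have hitx: "hit \<Omega>1 y d = x" using hit_eq[of \<Omega>1 y "- r" d] far(1) r(2) by simp
  define D where "D \<theta> = cis (- \<theta>) * d" for \<theta>
  define D2 where "D2 \<theta> = cis \<theta> * d2" for \<theta>
  have Dlim: "(D \<longlongrightarrow> d) (at 0)" "(D2 \<longlongrightarrow> d2) (at 0)"
  proof -
    have "(D \<longlongrightarrow> cis (- 0) * d) (at 0)" "(D2 \<longlongrightarrow> cis 0 * d2) (at 0)"
      unfolding D_def D2_def by (intro tendsto_intros tendsto_cis)+
    then show "(D \<longlongrightarrow> d) (at 0)" "(D2 \<longlongrightarrow> d2) (at 0)" by simp_all
  qed
  have RD: "reflect n (D \<theta>) = D2 \<theta>" for \<theta> unfolding D_def D2_def reflect_cis rd by simp
  have ND: "norm (D \<theta>) = 1" "norm (D2 \<theta>) = 1" for \<theta> using d nd2 by (auto simp: D_def D2_def norm_mult)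
  define X where "X \<theta> = hit \<Omega>1 y (D \<theta>)" for \<theta>
  define X' where "X' \<theta> = hit \<Omega>1 y (D2 \<theta>)" for \<theta>
  have Xlim: "(X \<longlongrightarrow> x) (at 0)"
    unfolding X_def using A.hit_tendsto[OF tendsto_const Dlim(1) d0 u] hitx by simp
  obtain t t0 where t: "\<forall>\<^sub>F \<theta> in at 0. X' \<theta> = y + t \<theta> *\<^sub>R D2 \<theta> \<and> exits \<Omega>1 (y + t \<theta> *\<^sub>R D2 \<theta>) (D2 \<theta>)"
    "hit \<Omega>1 y d2 = y + t0 *\<^sub>R d2" "exits \<Omega>1 (y + t0 *\<^sub>R d2) d2" "(t \<longlongrightarrow> t0) (at 0)"
    unfolding X'_def using A.hit_time[OF tendsto_const Dlim(2) d20 v] by blast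
  have farh: "far x d = y + t0 *\<^sub>R d2" using t(2) by (simp add: far_def y_def d2_def)
  have t0: "t0 > 0"
  proof -
    obtain s where s: "s > 0" "far x d = y + s *\<^sub>R d2" using far(5) by (auto simp: y_def d2_def)
    then have "s = t0" using farh d20 by simp
    then show ?thesis using s(1) by simp
  qed
  have X'lim: "(X' \<longlongrightarrow> far x d) (at 0)"
    unfolding X'_def far_def y_def[symmetric] d2_def[symmetric] by (rule A.hit_tendsto[OF tendsto_const Dlim(2) d20 v])
  have e1: "\<forall>\<^sub>F \<theta> in at 0. exits \<Omega>1 (X \<theta>) (D \<theta>) \<and> y + u *\<^sub>R D \<theta> \<in> interior \<Omega>1 \<and> D \<theta> \<noteq> 0
     \<and> (\<exists>t. X \<theta> = y + t *\<^sub>R D \<theta>)"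
    unfolding X_def by (rule A.eventually_exits_hit[OF tendsto_const Dlim(1) d0 u])
  have Xf: "\<forall>\<^sub>F \<theta> in at 0. X \<theta> \<in> frontier \<Omega>1"
    using e1 by eventually_elim (use A.exits_frontier in blast)
  have X'f: "\<forall>\<^sub>F \<theta> in at 0. X' \<theta> \<in> frontier \<Omega>1"
    using t(1) by eventually_elim (use A.exits_frontier ND in \<open>metis norm_zero zero_neq_one\<close>)
  have Xne: "\<forall>\<^sub>F \<theta> in at 0. X \<theta> \<noteq> x"
    using reverse_rotated_ray_ne[OF d0, of y] e1
  proof eventually_elim
    case (elim \<theta>)
    have "x = y + (- r) *\<^sub>R d" using r(2) by simp
    then show ?case using elim r(1) by (metis D_def neg_equal_0_iff_equal less_irrefl)
  qed
  have X'ne: "\<forall>\<^sub>F \<theta> in at 0. X' \<theta> \<noteq> far x d"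
    using rotated_ray_ne[OF d20, of y] t(1)
    by eventually_elim (use farh t0 in \<open>metis D2_def less_irrefl\<close>)
  have Xs: "\<forall>\<^sub>F \<theta> in at 0. smooth_at \<Omega>1 (X \<theta>)" by (rule A_smooth_eventually[OF Xlim Xne Xf])
  have X's: "\<forall>\<^sub>F \<theta> in at 0. smooth_at \<Omega>1 (X' \<theta>)" by (rule A_smooth_eventually[OF X'lim X'ne X'f])
  have "((\<lambda>\<theta>. n \<bullet> D \<theta>) \<longlongrightarrow> n \<bullet> d) (at 0)" by (intro tendsto_intros Dlim)
  then have nD: "\<forall>\<^sub>F \<theta> in at 0. n \<bullet> D \<theta> > 0"
    using out(4) by (intro order_tendstoD) (auto simp: n_def y_def)
  define m where "m \<theta> = normal \<Omega>1 (X' \<theta>)" for \<theta>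
  define D1 where "D1 \<theta> = reflect (normal \<Omega>1 (X \<theta>)) (D \<theta>)" for \<theta>
  define Y' where "Y' \<theta> = hit \<Omega>2 (X \<theta>) (D1 \<theta>)" for \<theta>
  have com: "\<forall>\<^sub>F \<theta> in at 0. reflect (normal \<Omega>2 (Y' \<theta>)) (D1 \<theta>) = reflect (m \<theta>) (D2 \<theta>) \<and> Y' \<theta> \<in> frontier \<Omega>2"
    using e1 t(1) Xs X's nD Xf
  proof eventually_elim
    case (elim \<theta>)
    obtain k where k: "X \<theta> = y + k *\<^sub>R D \<theta>" using elim by blast
    have "exits \<Omega>2 y (D \<theta>)"
      using B.exits_smooth[of y n "D \<theta>"] sn yf B.frontier_subset elim by blast
    moreover have "y = X \<theta> + (- k) *\<^sub>R D \<theta>" using k by simp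
    moreover have "exits \<Omega>1 (X' \<theta>) (reflect (normal \<Omega>2 y) (D \<theta>))" "X' \<theta> = y + t \<theta> *\<^sub>R reflect (normal \<Omega>2 y) (D \<theta>)"
      using elim RD by (simp_all add: n_def)
    ultimately have c: "reflect (normal \<Omega>2 (Y' \<theta>)) (D1 \<theta>) = reflect (m \<theta>) (reflect (normal \<Omega>2 y) (D \<theta>))" "exits \<Omega>2 (Y' \<theta>) (D1 \<theta>)"
      using commuting_reflections(1,3)[OF ND(1)] elim unfolding Y'_def D1_def m_def by blast+
    have "norm (D1 \<theta>) = 1" using ND norm_normal_A elim by (simp add: D1_def norm_reflect)
    then have "Y' \<theta> \<in> frontier \<Omega>2" using B.exits_frontier[OF c(2)] by fastforce
    then show ?case using c RD by (simp add: n_def)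
  qed
  define d1 where "d1 = reflect (normal \<Omega>1 x) d"
  \<comment> \<open>Here smoothness at \<open>x\<close> enters: the composition with \<Omega>1 first
    is continuous at angle 0, so the final direction converges.\<close>
  have nXlim: "((\<lambda>\<theta>. normal \<Omega>1 (X \<theta>)) \<longlongrightarrow> normal \<Omega>1 x) (at 0)"
    by (rule A.normals_tendsto[OF _ Xlim]) (use sx Xf A.normal_in in \<open>auto elim: eventually_mono\<close>)
  have D1lim: "(D1 \<longlongrightarrow> d1) (at 0)"
    unfolding D1_def d1_def by (intro tendsto_intros nXlim Dlim)
  have nd1: "norm d1 = 1" using d norm_normal_A[OF x(1)] by (simp add: d1_def norm_reflect)
  then have d10: "d1 \<noteq> 0" by auto
  have "x + 0 *\<^sub>R d1 \<in> interior \<Omega>2" using A_in_interior_B[OF xA] by simp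
  then have Y'lim: "(Y' \<longlongrightarrow> hit \<Omega>2 x d1) (at 0)"
    unfolding Y'_def by (rule B.hit_tendsto[OF Xlim D1lim d10])
  have y'f: "hit \<Omega>2 x d1 \<in> frontier \<Omega>2" using outer_props(2)[OF xA nd1] .
  have nY'lim: "((\<lambda>\<theta>. normal \<Omega>2 (Y' \<theta>)) \<longlongrightarrow> normal \<Omega>2 (hit \<Omega>2 x d1)) (at 0)"
    by (rule B.normals_tendsto[OF _ Y'lim]) (use B_normal[OF y'f] com B.normal_in in \<open>auto elim: eventually_mono\<close>)
  define W where "W = reflect (normal \<Omega>2 (hit \<Omega>2 x d1)) d1"
  have D3lim: "((\<lambda>\<theta>. reflect (normal \<Omega>2 (Y' \<theta>)) (D1 \<theta>)) \<longlongrightarrow> W) (at 0)"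
    unfolding W_def by (intro tendsto_intros nY'lim D1lim)
  \<comment> \<open>The reflection law determines the square of the normal at
    \<open>X' \<theta>\<close> by the incoming and outgoing unit directions, whose limits are
    known.\<close>
  have msq: "\<forall>\<^sub>F \<theta> in at 0. (m \<theta>)\<^sup>2 = - (reflect (normal \<Omega>2 (Y' \<theta>)) (D1 \<theta>) * D2 \<theta>)"
    using com
  proof eventually_elim
    case (elim \<theta>)
    have "reflect (m \<theta>) (D2 \<theta>) * D2 \<theta> = - ((m \<theta>)\<^sup>2 * (D2 \<theta> * cnj (D2 \<theta>)))" by (simp add: reflect_def)
    then show ?case using elim mult_cnj_unit[OF ND(2)] by simp
  qed
  have "((\<lambda>\<theta>. - (reflect (normal \<Omega>2 (Y' \<theta>)) (D1 \<theta>) * D2 \<theta>)) \<longlongrightarrow> - (W * d2)) (at 0)"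
    by (intro tendsto_intros D3lim Dlim)
  then have m2lim: "((\<lambda>\<theta>. (m \<theta>)\<^sup>2) \<longlongrightarrow> - (W * d2)) (at 0)"
    by (rule Lim_transform_eventually) (use msq in \<open>auto elim: eventually_mono\<close>)
  have mS: "\<forall>\<^sub>F \<theta> in at 0. m \<theta> \<in> support_normals \<Omega>1 (X' \<theta>)"
    using X'f by eventually_elim (simp add: m_def A.normal_in)
  have x'int: "far x d + (v - t0) *\<^sub>R d2 \<in> interior \<Omega>1" using v farh by (simp add: algebra_simps)
  have ex': "exits \<Omega>1 (far x d) d2" using far(3) by (simp add: d2_def)
  have En: "E \<bullet> d2 > 0" if "E \<in> support_normals \<Omega>1 (far x d)" for E
    using A.exits_transversal[OF ex' x'int that] by simp
  have "\<exists>E. (m \<longlongrightarrow> E) (at 0)"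
  proof (rule limit_exists_compact[OF compact_sphere[of 0 1]])
    show "\<forall>\<^sub>F \<theta> in at 0. m \<theta> \<in> sphere 0 1" using mS by eventually_elim (simp add: support_normals_iff)
    have key: "E\<^sup>2 = - (W * d2) \<and> E \<bullet> d2 > 0"
      if s: "filterlim s (at 0) sequentially" and E: "(\<lambda>k. m (s k)) \<longlonglongrightarrow> E" for s E
    proof
      have "(\<lambda>k. (m (s k))\<^sup>2) \<longlonglongrightarrow> E\<^sup>2" by (intro tendsto_intros E)
      then show "E\<^sup>2 = - (W * d2)" using filterlim_compose[OF m2lim s] LIMSEQ_unique by blast
      have "E \<in> support_normals \<Omega>1 (far x d)"
        by (rule A.support_normals_closed[OF filterlim_compose[OF X'lim s] E eventually_compose_filterlim[OF mS s]]) simp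
      then show "E \<bullet> d2 > 0" by (rule En)
    qed
    fix s s' E E' assume "filterlim s (at 0) sequentially" "filterlim s' (at 0) sequentially"
      "(\<lambda>k. m (s k)) \<longlonglongrightarrow> E" "(\<lambda>k. m (s' k)) \<longlonglongrightarrow> E'"
    then show "E = E'" using key unit_square_eq[of E E' d2] by metis
  qed
  then obtain E where E: "(m \<longlongrightarrow> E) (at 0)" by blast
  have "E \<in> support_normals \<Omega>1 (far x d)" by (rule A.support_normals_closed[OF X'lim E mS]) simp
  then have "E \<bullet> d2 \<noteq> 0" using En by fastforce
  then have "support_normals \<Omega>1 (far x d) = {E}"
    using t t0 farh X'f A.frontier_subset
    by (intro A.two_sided_normal_limit[OF far(4) farh t0 _ _ _ mS E])
       (auto simp: D2_def elim: eventually_mono)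
  then show ?thesis by (auto simp: smooth_at_def)
qed

text \<open>All four lengths are positive, the last because the side from the outer vertex reaches
  \<Omega>1 and its direction points inward by the reflection law.\<close>

lemma quadrilateral:
  assumes x: "x \<in> frontier \<Omega>1" "smooth_at \<Omega>1 x" and d: "norm d = 1" "normal \<Omega>1 x \<bullet> d > 0"
  defines "d1 \<equiv> reflect (normal \<Omega>1 x) d"
  defines "d3 \<equiv> reflect (normal \<Omega>1 (far x d)) (dir2 x d)"
  shows "\<exists>r s R S. r > 0 \<and> s > 0 \<and> R > 0 \<and> S > 0 \<and> outer x d = x + r *\<^sub>R d \<and>
      far x d = outer x d + s *\<^sub>R dir2 x d \<and> outer x d1 = x + R *\<^sub>R d1 \<and> far x d = outer x d1 + S *\<^sub>R d3"
    and "d3 = reflect (normal \<Omega>2 (outer x d1)) d1" "norm d1 = 1" "norm d3 = 1"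
proof -
  have xA: "x \<in> \<Omega>1" using x A.frontier_subset by blast
  note out = outer_props[OF xA d(1)] and far = far_props[OF x d]
  show nd1: "norm d1 = 1" using d norm_normal_A[OF x(1)] by (simp add: d1_def norm_reflect)
  note out1 = outer_props[OF xA nd1]
  obtain r where r: "r > 0" "outer x d = x + r *\<^sub>R d" using out(3) by blast
  obtain s where s: "s > 0" "far x d = outer x d + s *\<^sub>R dir2 x d" using far(5) by blast
  obtain R where R: "R > 0" "outer x d1 = x + R *\<^sub>R d1" using out1(3) by blast
  have c: "reflect (normal \<Omega>2 (outer x d1)) d1 = d3" "\<exists>S. far x d = outer x d1 + S *\<^sub>R reflect (normal \<Omega>2 (outer x d1)) d1"
    using commuting_reflections(1,2)[OF d(1) far(1) x(2) out(1) r(2) _ _ far_smooth[OF x d], of s] far(3) s(2)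
    unfolding d1_def d3_def dir2_def by blast+
  show d3: "d3 = reflect (normal \<Omega>2 (outer x d1)) d1" using c(1) by simp
  show "norm d3 = 1" unfolding d3 using nd1 norm_normal_B[OF out1(2)] by (simp add: norm_reflect)
  obtain S where S: "far x d = outer x d1 + S *\<^sub>R d3" using c by auto
  have "far x d \<in> \<Omega>1" using far(3) by (simp add: exits_def)
  from inward[OF B.normal_in[OF out1(2)] this]
  have "S * (normal \<Omega>2 (outer x d1) \<bullet> d3) < 0" by (simp add: S)
  moreover have "normal \<Omega>2 (outer x d1) \<bullet> d3 < 0"
    using out1(4) by (simp add: d3 inner_reflect norm_normal_B[OF out1(2)])
  ultimately have "S > 0" by (simp add: mult_less_0_iff)
  then show "\<exists>r s R S. r > 0 \<and> s > 0 \<and> R > 0 \<and> S > 0 \<and> outer x d = x + r *\<^sub>R d \<and>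
      far x d = outer x d + s *\<^sub>R dir2 x d \<and> outer x d1 = x + R *\<^sub>R d1 \<and> far x d = outer x d1 + S *\<^sub>R d3"
    using r s R S by blast
qed

end

section \<open>First variation of the alternating perimeter\<close>

lemma has_real_derivative_zero_within:
  assumes "(f has_real_derivative 0) (at a)"
  shows "(f has_derivative (\<lambda>h. 0)) (at a within S)"
proof -
  have "(*) (0::real) = (\<lambda>h. 0)" by auto
  then show ?thesis
    using assms has_derivative_at_withinI unfolding has_field_derivative_def by metis
qed

context commuting_billiards
begin

text \<open>With \<open>x\<close> fixed, the alternating perimeter of the quadrilateral is stationary by the
  reflection law at its other three vertices, and it tends to 0 when the line becomes
  tangent to \<open>\<Omega>1\<close> at \<open>x\<close>.\<close>

lemma alternating_perimeter:
  assumes x: "x \<in> frontier \<Omega>1" "smooth_at \<Omega>1 x" and d: "norm d = 1" "normal \<Omega>1 x \<bullet> d > 0"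
  defines "y' \<equiv> outer x (reflect (normal \<Omega>1 x) d)"
  shows "norm (outer x d - x) + norm (far x d - outer x d) = norm (y' - x) + norm (far x d - y')"
proof -
  have xA: "x \<in> \<Omega>1" using x A.frontier_subset by blast
  define n where "n = normal \<Omega>1 x"
  have nn: "norm n = 1" using norm_normal_A[OF x(1)] by (simp add: n_def)
  \<comment> \<open>With this tangent \<open>\<delta> \<psi>\<close> makes the angle \<psi> with the
    boundary at \<open>x\<close>. Outgoing directions have \<psi> in \<open>{0<..<pi}\<close>, and
    reflection at \<open>x\<close> changes the sign of \<psi>, so \<open>Y (- \<psi>)\<close> is the
    vertex \<open>y'\<close>.\<close>
  define \<tau> where "\<tau> = - \<i> * n"
  have nt: "norm \<tau> = 1" using nn by (simp add: \<tau>_def norm_mult)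
  have t0: "\<tau> \<noteq> 0" using nt by auto
  define \<delta> where "\<delta> \<psi> = cis \<psi> * \<tau>" for \<psi>
  have N\<delta>: "norm (\<delta> \<psi>) = 1" for \<psi> using nt by (simp add: \<delta>_def norm_mult)
  then have \<delta>0: "\<delta> \<psi> \<noteq> 0" for \<psi> by (metis norm_zero zero_neq_one)
  have n\<delta>: "n \<bullet> \<delta> \<psi> = sin \<psi>" for \<psi>
  proof -
    have "n \<bullet> \<delta> \<psi> = sin \<psi> * (n \<bullet> n)" by (simp add: \<delta>_def \<tau>_def inner_complex_def algebra_simps)
    then show ?thesis using inner_unit[OF nn] by simp
  qed
  have r\<delta>: "reflect n (\<delta> \<psi>) = \<delta> (- \<psi>)" for \<psi>
  proof -
    have "reflect n \<tau> = (n * cnj n) * \<tau>" by (simp add: reflect_def \<tau>_def power2_eq_square)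
    then have "reflect n \<tau> = \<tau>" using mult_cnj_unit[OF nn] by simp
    then show ?thesis by (simp add: \<delta>_def reflect_cis)
  qed
  have sin_pos: "n \<bullet> \<delta> \<psi> > 0" if "\<psi> \<in> {0<..<pi}" for \<psi> using that n\<delta> sin_gt_zero by simp
  define Y where "Y \<psi> = outer x (\<delta> \<psi>)" for \<psi>
  define N where "N \<psi> = normal \<Omega>2 (Y \<psi>)" for \<psi>
  define e where "e \<psi> = dir2 x (\<delta> \<psi>)" for \<psi>
  define X where "X \<psi> = far x (\<delta> \<psi>)" for \<psi>
  have e_eq: "e \<psi> = reflect (N \<psi>) (\<delta> \<psi>)" for \<psi> by (simp add: e_def N_def Y_def dir2_def)
  have X_eq: "X \<psi> = hit \<Omega>1 (Y \<psi>) (e \<psi>)" for \<psi> by (simp add: X_def far_def Y_def e_def)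
  have Yf: "Y \<psi> \<in> frontier \<Omega>2" for \<psi> using outer_props(2)[OF xA N\<delta>] by (simp add: Y_def)
  have NY: "norm (N \<psi>) = 1" for \<psi> using norm_normal_B[OF Yf] by (simp add: N_def)
  have sY: "support_normals \<Omega>2 (Y \<psi>) = {N \<psi>}" for \<psi> using B_normal[OF Yf] by (simp add: N_def)
  have xint: "x + 0 *\<^sub>R \<delta> \<psi> \<in> interior \<Omega>2" for \<psi> using A_in_interior_B[OF xA] by simp
  have \<delta>lim: "(\<delta> \<longlongrightarrow> \<delta> a) (at a)" "((\<lambda>\<psi>. \<delta> (- \<psi>)) \<longlongrightarrow> \<delta> (- a)) (at a)" for a
    unfolding \<delta>_def by (intro tendsto_intros tendsto_cis)+
  have Ylim: "(Y \<longlongrightarrow> Y a) (at a)" "((\<lambda>\<psi>. Y (- \<psi>)) \<longlongrightarrow> Y (- a)) (at a)" for a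
    unfolding Y_def by (rule B.hit_tendsto[OF tendsto_const \<delta>lim(1) \<delta>0 xint], rule B.hit_tendsto[OF tendsto_const \<delta>lim(2) \<delta>0 xint])
  have Nlim: "(N \<longlongrightarrow> N a) (at a)" for a
    unfolding N_def by (rule B.normals_tendsto[OF _ Ylim(1)]) (use B_normal[OF Yf] B.normal_in[OF Yf] in auto)
  have elim: "(e \<longlongrightarrow> e a) (at a)" for a
    unfolding e_eq by (intro tendsto_intros Nlim \<delta>lim)
  have xd: "normal \<Omega>1 x \<bullet> \<delta> \<psi> > 0" if "\<psi> \<in> {0<..<pi}" for \<psi> using sin_pos[OF that] by (simp add: n_def)
  note fp = far_props[OF x N\<delta> xd] and quad = quadrilateral[OF x N\<delta> xd]
  have ne: "norm (e \<psi>) = 1" if "\<psi> \<in> {0<..<pi}" for \<psi> using fp(2)[OF that] by (simp add: e_def)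
  have Xlim: "(X \<longlongrightarrow> X a) (at a)" if a: "a \<in> {0<..<pi}" for a
  proof -
    obtain u where u: "Y a + u *\<^sub>R e a \<in> interior \<Omega>1" using fp(7)[OF a] by (auto simp: Y_def e_def)
    have "e a \<noteq> 0" using ne[OF a] by auto
    then show ?thesis unfolding X_eq by (rule A.hit_tendsto[OF Ylim(1) elim _ u])
  qed
  define P where "P \<psi> = norm (Y \<psi> - x) + norm (X \<psi> - Y \<psi>) - norm (Y (- \<psi>) - x) - norm (X \<psi> - Y (- \<psi>))" for \<psi>
  have contP: "continuous_on {0<..<pi} P"
    unfolding continuous_on_eq_continuous_at[OF open_greaterThanLessThan] isCont_def P_def
    by (intro ballI tendsto_intros Ylim Xlim)
  obtain F where F: "finite F" "\<forall>y\<in>frontier \<Omega>2 - F. B.regular_at y" using regular_B by blast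
  \<comment> \<open>Only \<open>Y \<psi>\<close> has to be a regular point, since its moving normal
    steers the next side. At \<open>Y (- \<psi>)\<close> only the normal at the fixed parameter is
    used.\<close>
  define Bad where "Bad = {\<psi>\<in>{0<..<pi}. Y \<psi> \<in> F}"
  have "inj_on Y {0<..<pi}"
  proof (rule inj_onI)
    fix a b assume ab: "a \<in> {0<..<pi}" "b \<in> {0<..<pi}" "Y a = Y b"
    obtain r s where rs: "r > 0" "s > 0" "Y a = x + r *\<^sub>R \<delta> a" "Y b = x + s *\<^sub>R \<delta> b"
      using outer_props(3)[OF xA N\<delta>] unfolding Y_def by metis
    then have eq: "r *\<^sub>R \<delta> a = s *\<^sub>R \<delta> b" using ab(3) by simp
    then have "norm (r *\<^sub>R \<delta> a) = norm (s *\<^sub>R \<delta> b)" by simp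
    then have "r = s" using rs N\<delta> by simp
    then have "cis a = cis b" using eq rs t0 by (simp add: \<delta>_def)
    then have "cos a = cos b" by (metis cis.sel(1))
    then show "a = b" using ab cos_inj_pi[of a b] by simp
  qed
  then have "finite Bad"
    unfolding Bad_def using finite_vimage_IntI[OF F(1), of Y "{0<..<pi}"] by (simp add: vimage_def Int_def conj_commute)
  have derP: "(P has_real_derivative 0) (at a)" if a: "a \<in> {0<..<pi} - Bad" for a
  proof -
    have a': "a \<in> {0<..<pi}" using a by blast
    have reg: "B.regular_at (Y a)" using a F(2) Yf by (auto simp: Bad_def)
    define m where "m = normal \<Omega>1 (X a)"
    define d1 where "d1 = \<delta> (- a)"
    define d3 where "d3 = reflect m (e a)"
    have d1: "d1 = reflect (normal \<Omega>1 x) (\<delta> a)" using r\<delta>[of a] by (simp add: n_def d1_def)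
    have Yd1: "outer x (reflect (normal \<Omega>1 x) (\<delta> a)) = Y (- a)" using d1 by (simp add: Y_def d1_def)
    have q: "d3 = reflect (N (- a)) d1" "norm d3 = 1"
      using quad(2,4)[OF a'] unfolding Yd1 by (simp_all add: d3_def m_def X_def e_def N_def d1)
    obtain r s R S where q1: "r > 0" "s > 0" "R > 0" "S > 0" "Y a - x = r *\<^sub>R \<delta> a"
      "X a - Y a = s *\<^sub>R e a" "Y (- a) - x = R *\<^sub>R d1" "X a - Y (- a) = S *\<^sub>R d3"
    proof -
      obtain r s R S where *: "r > 0" "s > 0" "R > 0" "S > 0" "outer x (\<delta> a) = x + r *\<^sub>R \<delta> a"
        "far x (\<delta> a) = outer x (\<delta> a) + s *\<^sub>R dir2 x (\<delta> a)"
        "outer x (reflect (normal \<Omega>1 x) (\<delta> a)) = x + R *\<^sub>R reflect (normal \<Omega>1 x) (\<delta> a)"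
        "far x (\<delta> a) = outer x (reflect (normal \<Omega>1 x) (\<delta> a)) + S *\<^sub>R reflect (normal \<Omega>1 (far x (\<delta> a))) (dir2 x (\<delta> a))"
        using quad(1)[OF a'] by blast
      show thesis
      proof (rule that[OF *(1-4)])
        show "Y a - x = r *\<^sub>R \<delta> a" using *(5) by (simp add: Y_def)
        show "X a - Y a = s *\<^sub>R e a" using *(6) by (simp add: X_def Y_def e_def)
        show "Y (- a) - x = R *\<^sub>R d1" using *(7) unfolding Yd1 by (simp add: d1)
        show "X a - Y (- a) = S *\<^sub>R d3"
          using *(8) unfolding Yd1 X_def d3_def m_def e_def by (metis add_diff_cancel_left')
      qed
    qed
    have "smooth_at \<Omega>1 (X a)" using far_smooth[OF x N\<delta> xd[OF a']] by (simp add: X_def)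
    then have sX: "support_normals \<Omega>1 (X a) = {m}" using smooth_at_normal by (simp add: m_def)
    have Xf: "X a \<in> frontier \<Omega>1" using fp(4)[OF a'] by (simp add: X_def)
    have nm: "norm m = 1" using norm_normal_A[OF Xf] by (simp add: m_def)
    have L\<delta>: "lipschitz_at \<delta> a" "lipschitz_at (\<lambda>\<psi>. \<delta> (- \<psi>)) a"
      unfolding \<delta>_def by (rule lipschitz_at_cis)+
    have LY: "lipschitz_at Y a"
    proof -
      obtain C where "\<forall>\<^sub>F \<psi> in at a. norm (hit \<Omega>2 x (\<delta> \<psi>) - hit \<Omega>2 x (\<delta> a)) \<le> C * (norm (x - x) + norm (\<delta> \<psi> - \<delta> a))"
        using B.hit_lipschitz[OF tendsto_const \<delta>lim(1) \<delta>0 xint] sY unfolding Y_def by blast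
      then show ?thesis unfolding Y_def by (intro lipschitz_at_le[OF L\<delta>(1)]) simp
    qed
    have LY': "lipschitz_at (\<lambda>\<psi>. Y (- \<psi>)) a"
    proof -
      obtain C where "\<forall>\<^sub>F \<psi> in at a. norm (hit \<Omega>2 x (\<delta> (- \<psi>)) - hit \<Omega>2 x (\<delta> (- a))) \<le> C * (norm (x - x) + norm (\<delta> (- \<psi>) - \<delta> (- a)))"
        using B.hit_lipschitz[OF tendsto_const \<delta>lim(2) \<delta>0 xint] sY unfolding Y_def by blast
      then show ?thesis unfolding Y_def by (intro lipschitz_at_le[OF L\<delta>(2)]) simp
    qed
    have LN: "lipschitz_at N a"
      unfolding N_def using B.normal_lipschitz[OF reg LY] Yf by simp
    have Le: "lipschitz_at e a"
      unfolding e_eq by (rule lipschitz_at_reflect[OF LN L\<delta>(1)])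
    have LX: "lipschitz_at X a"
    proof -
      obtain u where u: "Y a + u *\<^sub>R e a \<in> interior \<Omega>1" using fp(7)[OF a'] by (auto simp: Y_def e_def)
      have "e a \<noteq> 0" using ne[OF a'] by auto
      then obtain C where "\<forall>\<^sub>F \<psi> in at a. norm (hit \<Omega>1 (Y \<psi>) (e \<psi>) - hit \<Omega>1 (Y a) (e a)) \<le> C * (norm (Y \<psi> - Y a) + norm (e \<psi> - e a))"
        using A.hit_lipschitz[OF Ylim(1) elim _ u] sX unfolding X_eq by blast
      then show ?thesis unfolding X_eq by (intro lipschitz_at_le2[OF LY Le])
    qed
    have evX: "\<forall>\<^sub>F \<psi> in at a. X \<psi> \<in> frontier \<Omega>1"
    proof -
      have "\<forall>\<^sub>F \<psi> in at a. \<psi> \<in> {0<..<pi}"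
        using a' by (intro eventually_at_in_open') auto
      then show ?thesis by (rule eventually_mono) (use fp(4) in \<open>auto simp: X_def\<close>)
    qed
    have t1: "((\<lambda>\<psi>. N a \<bullet> Y \<psi>) has_real_derivative 0) (at a)"
      by (rule B.tangential_derivative[OF _ sY LY]) (use Yf B.frontier_subset in auto)
    have t2: "((\<lambda>\<psi>. N (- a) \<bullet> Y (- \<psi>)) has_real_derivative 0) (at a)"
      by (rule B.tangential_derivative[OF _ sY LY']) (use Yf B.frontier_subset in auto)
    have t3: "((\<lambda>\<psi>. m \<bullet> X \<psi>) has_real_derivative 0) (at a)"
      by (rule A.tangential_derivative[OF _ sX LX evX]) (use Xf A.frontier_subset in auto)
    have g1: "((\<lambda>\<psi>. norm (Y \<psi> - x) - \<delta> a \<bullet> (Y \<psi> - x)) has_real_derivative 0) (at a)"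
      by (rule norm_compose_derivative[OF lipschitz_at_diff[OF LY lipschitz_at_const] q1(5) N\<delta> q1(1)])
    have g2: "((\<lambda>\<psi>. norm (X \<psi> - Y \<psi>) - e a \<bullet> (X \<psi> - Y \<psi>)) has_real_derivative 0) (at a)"
      by (rule norm_compose_derivative[OF lipschitz_at_diff[OF LX LY] q1(6) ne[OF a'] q1(2)])
    have g3: "((\<lambda>\<psi>. norm (Y (- \<psi>) - x) - d1 \<bullet> (Y (- \<psi>) - x)) has_real_derivative 0) (at a)"
      by (rule norm_compose_derivative[OF lipschitz_at_diff[OF LY' lipschitz_at_const] q1(7) _ q1(3)]) (simp add: d1_def N\<delta>)
    have g4: "((\<lambda>\<psi>. norm (X \<psi> - Y (- \<psi>)) - d3 \<bullet> (X \<psi> - Y (- \<psi>))) has_real_derivative 0) (at a)"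
      by (rule norm_compose_derivative[OF lipschitz_at_diff[OF LX LY'] q1(8) q(2) q1(4)])
    have k1: "\<delta> a - e a = (2 * (N a \<bullet> \<delta> a)) *\<^sub>R N a" unfolding e_eq reflect_eq[OF NY] by simp
    have k2: "e a - d3 = (2 * (m \<bullet> e a)) *\<^sub>R m" unfolding d3_def reflect_eq[OF nm] by simp
    have k3: "d1 - d3 = (2 * (N (- a) \<bullet> d1)) *\<^sub>R N (- a)" unfolding q(1) reflect_eq[OF NY] by simp
    \<comment> \<open>Summation by vertices: each moving vertex is paired with the difference of the
      unit vectors of its two sides, by the reflection law a multiple of the normal there. The
      contribution of \<open>x\<close> is constant.\<close>
    have lin: "\<delta> a \<bullet> (y - x) + e a \<bullet> (z - y) - d1 \<bullet> (y' - x) - d3 \<bullet> (z - y')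
       = 2 * (N a \<bullet> \<delta> a) * (N a \<bullet> y) + 2 * (m \<bullet> e a) * (m \<bullet> z) - 2 * (N (- a) \<bullet> d1) * (N (- a) \<bullet> y')
         + (d1 - \<delta> a) \<bullet> x" for y y' z
    proof -
      have "\<delta> a \<bullet> (y - x) + e a \<bullet> (z - y) - d1 \<bullet> (y' - x) - d3 \<bullet> (z - y')
        = (\<delta> a - e a) \<bullet> y + (e a - d3) \<bullet> z - (d1 - d3) \<bullet> y' + (d1 - \<delta> a) \<bullet> x"
        by (simp add: inner_diff_left inner_diff_right)
      then show ?thesis unfolding k1 k2 k3 by simp
    qed
    have "P = (\<lambda>\<psi>. ((norm (Y \<psi> - x) - \<delta> a \<bullet> (Y \<psi> - x)) + (norm (X \<psi> - Y \<psi>) - e a \<bullet> (X \<psi> - Y \<psi>))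
        - (norm (Y (- \<psi>) - x) - d1 \<bullet> (Y (- \<psi>) - x)) - (norm (X \<psi> - Y (- \<psi>)) - d3 \<bullet> (X \<psi> - Y (- \<psi>))))
        + (2 * (N a \<bullet> \<delta> a) * (N a \<bullet> Y \<psi>) + 2 * (m \<bullet> e a) * (m \<bullet> X \<psi>) - 2 * (N (- a) \<bullet> d1) * (N (- a) \<bullet> Y (- \<psi>))
         + (d1 - \<delta> a) \<bullet> x))"
      unfolding lin[symmetric] P_def by (simp add: fun_eq_iff)
    moreover have "(\<dots> has_real_derivative ((0 + 0 - 0 - 0) + (2 * (N a \<bullet> \<delta> a) * 0 + 2 * (m \<bullet> e a) * 0 - 2 * (N (- a) \<bullet> d1) * 0 + 0))) (at a)"
      by (intro DERIV_add DERIV_diff DERIV_cmult DERIV_const g1 g2 g3 g4 t1 t2 t3)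
    ultimately show ?thesis by simp
  qed
  have const: "P \<psi> = P (pi / 2)" if "\<psi> \<in> {0<..<pi}" for \<psi>
  proof (rule has_derivative_zero_unique_strong_connected[where S="{0<..<pi}" and K=Bad and f=P and c="pi / 2"])
    fix a assume "a \<in> {0<..<pi} - Bad"
    from derP[OF this] show "(P has_derivative (\<lambda>h. 0)) (at a within {0<..<pi})"
      by (rule has_real_derivative_zero_within)
  qed (use \<open>finite Bad\<close> contP that in auto)
  \<comment> \<open>By the triangle inequality \<open>X \<psi>\<close> drops out, so no control of
    it is needed as \<psi> tends to 0.\<close>
  have Pb: "\<bar>P \<psi>\<bar> \<le> 2 * norm (Y \<psi> - Y (- \<psi>))" for \<psi>
  proof -
    have "\<bar>norm (Y \<psi> - x) - norm (Y (- \<psi>) - x)\<bar> \<le> norm (Y \<psi> - Y (- \<psi>))"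
      using norm_triangle_ineq3[of "Y \<psi> - x" "Y (- \<psi>) - x"] by simp
    moreover have "\<bar>norm (X \<psi> - Y \<psi>) - norm (X \<psi> - Y (- \<psi>))\<bar> \<le> norm (Y \<psi> - Y (- \<psi>))"
      using norm_triangle_ineq3[of "X \<psi> - Y \<psi>" "X \<psi> - Y (- \<psi>)"] by (simp add: norm_minus_commute)
    ultimately show ?thesis unfolding P_def by linarith
  qed
  have "((\<lambda>\<psi>. 2 * norm (Y \<psi> - Y (- \<psi>))) \<longlongrightarrow> 2 * norm (Y 0 - Y (- 0))) (at 0)"
    by (intro tendsto_intros Ylim)
  then have lim0: "((\<lambda>\<psi>. 2 * norm (Y \<psi> - Y (- \<psi>))) \<longlongrightarrow> 0) (at_right 0)"
    by (simp add: filterlim_at_split)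
  have "\<forall>\<^sub>F \<psi> in at_right (0::real). \<psi> \<in> {0<..<pi}"
    using eventually_at_right_real[of 0 pi] by simp
  then have "\<forall>\<^sub>F \<psi> in at_right 0. \<bar>P (pi / 2)\<bar> \<le> 2 * norm (Y \<psi> - Y (- \<psi>))"
    by (rule eventually_mono) (use const Pb in metis)
  then have "\<bar>P (pi / 2)\<bar> \<le> 0"
    by (intro tendsto_lowerbound[OF lim0]) auto
  then have P0: "P \<psi> = 0" if "\<psi> \<in> {0<..<pi}" for \<psi> using const[OF that] by simp
  obtain \<psi> where \<psi>: "\<psi> \<in> {0<..<pi}" "d = \<delta> \<psi>"
  proof -
    have "norm (d / \<tau>) = 1" using d(1) nt by (simp add: norm_divide)
    then obtain a where a: "d / \<tau> = cis a" "- pi < a" "a \<le> pi"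
      by (metis cis_Arg Arg_bounded norm_zero sgn_eq div_by_1 of_real_1 zero_neq_one)
    then have da: "d = \<delta> a" using t0 by (simp add: \<delta>_def field_simps)
    have "sin a > 0" using d(2) n\<delta>[of a] da by (simp add: n_def)
    then have "a > 0" using a(2) sin_ge_zero[of "- a"] by (cases "a > 0") auto
    moreover have "a \<noteq> pi" using \<open>sin a > 0\<close> by auto
    ultimately show thesis using that[of a] a da by simp
  qed
  have "P \<psi> = 0" by (rule P0[OF \<psi>(1)])
  then show ?thesis
    unfolding P_def y'_def \<psi>(2) using r\<delta>[of \<psi>] by (simp add: n_def Y_def X_def)
qed

text \<open>The fourth vertex is eliminated by \<open>concurrency_identity\<close>, using the
  closing relation and the equality of lengths. What is left can be used with \<open>y\<close> fixed
  while the line through \<open>y\<close> turns.\<close>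

lemma tangent_concurrency:
  assumes x: "x \<in> frontier \<Omega>1" "smooth_at \<Omega>1 x" and d: "norm d = 1" "normal \<Omega>1 x \<bullet> d > 0"
  defines "y \<equiv> outer x d" and "x' \<equiv> far x d"
  shows "norm (y - x) * (normal \<Omega>1 x \<bullet> d) * (normal \<Omega>1 x' \<bullet> (\<i> * normal \<Omega>2 y))
    + norm (x' - y) * (normal \<Omega>1 x' \<bullet> dir2 x d) * (normal \<Omega>1 x \<bullet> (\<i> * normal \<Omega>2 y)) = 0"
proof -
  have xA: "x \<in> \<Omega>1" using x A.frontier_subset by blast
  note out = outer_props[OF xA d(1)] and far = far_props[OF x d] and q = quadrilateral[OF x d]
  define d1 where "d1 = reflect (normal \<Omega>1 x) d"
  define d3 where "d3 = reflect (normal \<Omega>1 (far x d)) (dir2 x d)"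
  have nd: "norm d1 = 1" "norm d3 = 1" using q(3,4) by (simp_all add: d1_def d3_def)
  obtain r s R S where rs: "r > 0" "s > 0" "R > 0" "S > 0" "outer x d = x + r *\<^sub>R d"
      "far x d = outer x d + s *\<^sub>R dir2 x d" "outer x d1 = x + R *\<^sub>R d1" "far x d = outer x d1 + S *\<^sub>R d3"
    using q(1) unfolding d1_def d3_def by blast
  have "y - x = r *\<^sub>R d" "x' - y = s *\<^sub>R dir2 x d" "outer x d1 - x = R *\<^sub>R d1" "x' - outer x d1 = S *\<^sub>R d3"
    using rs(5-8) unfolding y_def x'_def by (metis add_diff_cancel_left')+
  then have r: "norm (y - x) = r" "norm (x' - y) = s" "norm (outer x d1 - x) = R" "norm (x' - outer x d1) = S"
    using rs(1-4) d(1) far(2) nd by simp_all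
  have len: "r + s = R + S"
    using alternating_perimeter[OF x d] r by (simp add: y_def x'_def d1_def)
  have "x + r *\<^sub>R d + s *\<^sub>R dir2 x d = x + R *\<^sub>R d1 + S *\<^sub>R d3" using rs by metis
  then have cl: "r *\<^sub>R d + s *\<^sub>R reflect (normal \<Omega>2 y) d = R *\<^sub>R reflect (normal \<Omega>1 x) d + S *\<^sub>R reflect (normal \<Omega>1 x') (reflect (normal \<Omega>2 y) d)"
    by (simp add: d1_def d3_def dir2_def y_def x'_def add.assoc)
  show ?thesis
    using concurrency_identity[OF norm_normal_A[OF x(1)] norm_normal_B[OF out(2)] norm_normal_A[OF far(4)] d(1), of r s R S]
      cl len r by (simp add: y_def x'_def dir2_def)
qed

text \<open>In the coordinates \<open>\<tau> \<bullet> (z - y) / \<rho>\<close> and \<open>1 / \<rho>\<close>, where \<open>\<rho>\<close> is the distance of \<open>z\<close> to the tangent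
  line of \<open>\<Omega>2\<close> at \<open>y\<close>, the next two lemmas say that \<open>\<Omega>1\<close> is centrally symmetric. The derivative of the
  sum of the two reciprocals with respect to the slope \<open>\<sigma>\<close> vanishes by the concurrency of tangents.\<close>

lemma reciprocal_sum_constant:
  assumes y: "y \<in> frontier \<Omega>2"
  defines "n \<equiv> normal \<Omega>2 y"
  defines "\<tau> \<equiv> \<i> * n"
  shows "\<exists>K. \<forall>\<sigma>. (\<exists>t. y + t *\<^sub>R (n + \<sigma> *\<^sub>R \<tau>) \<in> interior \<Omega>1) \<longrightarrow>
     1 / (n \<bullet> (y - hit \<Omega>1 y (n + \<sigma> *\<^sub>R \<tau>))) + 1 / (n \<bullet> (y - hit \<Omega>1 y (- n + \<sigma> *\<^sub>R \<tau>))) = K"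
proof -
  have nn: "norm n = 1" using norm_normal_B[OF y] by (simp add: n_def)
  have sn: "support_normals \<Omega>2 y = {n}" using B_normal[OF y] by (simp add: n_def)
  have n1: "n \<bullet> n = 1" "n \<bullet> \<tau> = 0" using inner_unit[OF nn] by (simp_all add: \<tau>_def inner_complex_def)
  define D where "D \<sigma> = n + \<sigma> *\<^sub>R \<tau>" for \<sigma> :: real
  define E where "E \<sigma> = - n + \<sigma> *\<^sub>R \<tau>" for \<sigma> :: real
  have nD: "n \<bullet> D \<sigma> = 1" "n \<bullet> E \<sigma> = - 1" for \<sigma> using n1 by (simp_all add: D_def E_def inner_add_right inner_diff_right)
  have D0: "D \<sigma> \<noteq> 0" "E \<sigma> \<noteq> 0" for \<sigma> using nD[of \<sigma>] by auto
  have rD: "reflect n (D \<sigma>) = E \<sigma>" for \<sigma>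
    unfolding reflect_eq[OF nn] nD by (simp add: D_def E_def algebra_simps scaleR_2)
  have inw: "n \<bullet> (y - z) > 0" if "z \<in> \<Omega>1" for z
    using inward[of n y z] sn that by (simp add: inner_diff_right)
  define \<Lambda> where "\<Lambda> = {\<sigma>. \<exists>t. y + t *\<^sub>R D \<sigma> \<in> interior \<Omega>1}"
  define sl where "sl z = (\<tau> \<bullet> (y - z)) / (n \<bullet> (y - z))" for z
  have nt: "norm \<tau> = 1" using nn by (simp add: \<tau>_def norm_mult)
  have t1: "\<tau> \<bullet> \<tau> = 1" "\<tau> \<bullet> n = 0" using inner_unit[OF nt] n1(2) by (simp_all add: inner_commute)
  have slD: "sl (y + t *\<^sub>R D \<sigma>) = \<sigma>" "sl (y + t *\<^sub>R E \<sigma>) = - \<sigma>" if "t \<noteq> 0" for t \<sigma>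
    using that n1 t1 by (simp_all add: sl_def D_def E_def inner_add_right inner_diff_right)
  have yA: "y \<notin> \<Omega>1" using frontier_B_notin_A[OF y] .
  \<comment> \<open>The slopes of lines crossing the interior form a continuous image of a connected
    set; connectedness is what turns a zero derivative into constancy.\<close>
  have "\<Lambda> = sl ` interior \<Omega>1"
  proof
    show "\<Lambda> \<subseteq> sl ` interior \<Omega>1"
    proof
      fix \<sigma> assume "\<sigma> \<in> \<Lambda>"
      then obtain t where t: "y + t *\<^sub>R D \<sigma> \<in> interior \<Omega>1" by (auto simp: \<Lambda>_def)
      then have "t \<noteq> 0" using yA interior_subset by force
      then have "sl (y + t *\<^sub>R D \<sigma>) = \<sigma>" by (rule slD)
      then show "\<sigma> \<in> sl ` interior \<Omega>1" using t by (metis image_eqI)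
    qed
    show "sl ` interior \<Omega>1 \<subseteq> \<Lambda>"
    proof
      fix \<sigma> assume "\<sigma> \<in> sl ` interior \<Omega>1"
      then obtain z where z: "z \<in> interior \<Omega>1" "\<sigma> = sl z" by blast
      have p: "n \<bullet> (y - z) > 0" using inw z interior_subset by blast
      have "y - z = (n \<bullet> (y - z)) *\<^sub>R n + (\<tau> \<bullet> (y - z)) *\<^sub>R \<tau>"
        unfolding \<tau>_def by (rule unit_decomp[OF nn])
      also have "\<dots> = (n \<bullet> (y - z)) *\<^sub>R D \<sigma>" using p by (simp add: D_def z(2) sl_def scaleR_add_right)
      finally have "z = y + (- (n \<bullet> (y - z))) *\<^sub>R D \<sigma>" by (simp add: algebra_simps)
      then show "\<sigma> \<in> \<Lambda>" using z(1) unfolding \<Lambda>_def by (metis (mono_tags, lifting) mem_Collect_eq)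
    qed
  qed
  moreover have "connected (sl ` interior \<Omega>1)"
  proof (rule connected_continuous_image)
    show "connected (interior \<Omega>1)" using A.convex_K convex_interior convex_connected by blast
    have "n \<bullet> (y - z) \<noteq> 0" if "z \<in> interior \<Omega>1" for z using inw[of z] that interior_subset by fastforce
    then show "continuous_on (interior \<Omega>1) sl" unfolding sl_def by (intro continuous_intros) auto
  qed
  ultimately have conn: "connected \<Lambda>" by simp
  have "\<Lambda> = (\<Union>t. (\<lambda>\<sigma>. y + t *\<^sub>R D \<sigma>) -` interior \<Omega>1)" by (auto simp: \<Lambda>_def)
  moreover have "open ((\<lambda>\<sigma>. y + t *\<^sub>R D \<sigma>) -` interior \<Omega>1)" for t
    unfolding D_def by (intro continuous_open_vimage open_interior continuous_intros)
  ultimately have opn: "open \<Lambda>" by auto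
  define X where "X \<sigma> = hit \<Omega>1 y (D \<sigma>)" for \<sigma>
  define X' where "X' \<sigma> = hit \<Omega>1 y (E \<sigma>)" for \<sigma>
  have int': "\<exists>t. y + t *\<^sub>R E \<sigma> \<in> interior \<Omega>1" if s: "\<sigma> \<in> \<Lambda>" for \<sigma>
  proof -
    obtain t where t: "y + t *\<^sub>R D \<sigma> \<in> interior \<Omega>1" using s by (auto simp: \<Lambda>_def)
    show ?thesis using reflected_meets_interior[OF y t] unfolding n_def[symmetric] rD .
  qed
  have XA: "exits \<Omega>1 (X \<sigma>) (D \<sigma>)" "exits \<Omega>1 (X' \<sigma>) (E \<sigma>)" "X \<sigma> \<in> frontier \<Omega>1" "X' \<sigma> \<in> frontier \<Omega>1"
    "X \<sigma> \<in> \<Omega>1" "X' \<sigma> \<in> \<Omega>1"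
    "X \<sigma> = y + (- (n \<bullet> (y - X \<sigma>))) *\<^sub>R D \<sigma>" "X' \<sigma> = y + (n \<bullet> (y - X' \<sigma>)) *\<^sub>R E \<sigma>" if s: "\<sigma> \<in> \<Lambda>" for \<sigma>
  proof -
    obtain t where t: "y + t *\<^sub>R D \<sigma> \<in> \<Omega>1" using s interior_subset by (auto simp: \<Lambda>_def)
    obtain u where u: "y + u *\<^sub>R E \<sigma> \<in> \<Omega>1" using int'[OF s] interior_subset by blast
    show 1: "exits \<Omega>1 (X \<sigma>) (D \<sigma>)" unfolding X_def by (rule A.exits_hit(1)[OF t D0(1)])
    show 2: "exits \<Omega>1 (X' \<sigma>) (E \<sigma>)" unfolding X'_def by (rule A.exits_hit(1)[OF u D0(2)])
    show "X \<sigma> \<in> frontier \<Omega>1" "X' \<sigma> \<in> frontier \<Omega>1" using A.exits_frontier 1 2 D0 by blast+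
    show "X \<sigma> \<in> \<Omega>1" "X' \<sigma> \<in> \<Omega>1" using 1 2 by (simp_all add: exits_def)
    obtain a where a: "X \<sigma> = y + a *\<^sub>R D \<sigma>" unfolding X_def using A.exits_hit(2)[OF t D0(1)] by blast
    then have "n \<bullet> (y - X \<sigma>) = - a" using nD by simp
    then show "X \<sigma> = y + (- (n \<bullet> (y - X \<sigma>))) *\<^sub>R D \<sigma>" using a by simp
    obtain b where b: "X' \<sigma> = y + b *\<^sub>R E \<sigma>" unfolding X'_def using A.exits_hit(2)[OF u D0(2)] by blast
    then have "n \<bullet> (y - X' \<sigma>) = b" using nD by simp
    then show "X' \<sigma> = y + (n \<bullet> (y - X' \<sigma>)) *\<^sub>R E \<sigma>" using b by simp
  qed
  have Dlim: "(D \<longlongrightarrow> D a) (at a)" "(E \<longlongrightarrow> E a) (at a)" for a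
    unfolding D_def E_def by (intro tendsto_intros)+
  have Xlim: "(X \<longlongrightarrow> X a) (at a)" "(X' \<longlongrightarrow> X' a) (at a)" if a: "a \<in> \<Lambda>" for a
  proof -
    obtain t where "y + t *\<^sub>R D a \<in> interior \<Omega>1" using a by (auto simp: \<Lambda>_def)
    then show "(X \<longlongrightarrow> X a) (at a)" unfolding X_def by (rule A.hit_tendsto[OF tendsto_const Dlim(1) D0(1)])
    obtain u where "y + u *\<^sub>R E a \<in> interior \<Omega>1" using int'[OF a] by blast
    then show "(X' \<longlongrightarrow> X' a) (at a)" unfolding X'_def by (rule A.hit_tendsto[OF tendsto_const Dlim(2) D0(2)])
  qed
  define k where "k \<sigma> = 1 / (n \<bullet> (y - X \<sigma>)) + 1 / (n \<bullet> (y - X' \<sigma>))" for \<sigma>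
  have contk: "continuous_on \<Lambda> k"
    unfolding continuous_on_eq_continuous_at[OF opn] isCont_def k_def
  proof (intro ballI tendsto_intros Xlim)
    fix a assume "a \<in> \<Lambda>"
    then show "n \<bullet> (y - X a) \<noteq> 0" "n \<bullet> (y - X' a) \<noteq> 0" using inw XA(5,6) by fastforce+
  qed
  obtain F where F: "finite F" "\<forall>x\<in>frontier \<Omega>1 - F. smooth_at \<Omega>1 x" using smooth_A by blast
  \<comment> \<open>A point of \<open>F\<close> lies on a single line through \<open>y\<close>: as
    near point it excludes its slope, as far point the opposite slope.\<close>
  define Bad where "Bad = sl ` F \<union> (\<lambda>z. - sl z) ` F"
  have "finite Bad" using F(1) by (simp add: Bad_def)
  have good: "smooth_at \<Omega>1 (X a)" "smooth_at \<Omega>1 (X' a)" if a: "a \<in> \<Lambda> - Bad" for a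
  proof -
    have aL: "a \<in> \<Lambda>" using a by blast
    have "sl (X a) = a" "- sl (X' a) = a"
      using slD inw[OF XA(5)[OF aL]] inw[OF XA(6)[OF aL]] XA(7,8)[OF aL] by (metis neg_equal_0_iff_equal less_irrefl minus_minus)+
    then have "X a \<notin> F" "X' a \<notin> F" using a by (force simp: Bad_def)+
    then show "smooth_at \<Omega>1 (X a)" "smooth_at \<Omega>1 (X' a)" using F(2) XA(3,4)[OF aL] by blast+
  qed
  have derk: "(k has_real_derivative 0) (at a)" if a: "a \<in> \<Lambda> - Bad" for a
  proof -
    have aL: "a \<in> \<Lambda>" using a by blast
    define c where "c = norm (D a)"
    have c: "c > 0" using D0 by (simp add: c_def)
    define d where "d = (1 / c) *\<^sub>R D a"
    have nd: "norm d = 1" using c by (simp add: d_def c_def)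
    have Dd: "D a = c *\<^sub>R d" using c by (simp add: d_def)
    define x where "x = X a"
    define m where "m = normal \<Omega>1 x"
    define m' where "m' = normal \<Omega>1 (X' a)"
    have xf: "x \<in> frontier \<Omega>1" "smooth_at \<Omega>1 x" using XA(3)[OF aL] good(1)[OF a] by (auto simp: x_def)
    have sm: "support_normals \<Omega>1 x = {m}" "support_normals \<Omega>1 (X' a) = {m'}"
      using good[OF a] smooth_at_normal by (auto simp: m_def m'_def x_def)
    obtain t where t: "y + t *\<^sub>R D a \<in> interior \<Omega>1" using aL by (auto simp: \<Lambda>_def)
    obtain u where u: "y + u *\<^sub>R E a \<in> interior \<Omega>1" using int'[OF aL] by blast
    define \<rho> where "\<rho> = n \<bullet> (y - X a)"
    define \<rho>' where "\<rho>' = n \<bullet> (y - X' a)"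
    have rho: "\<rho> > 0" "\<rho>' > 0" using inw XA(5,6)[OF aL] by (auto simp: \<rho>_def \<rho>'_def)
    have Xa: "X a = y + (- \<rho>) *\<^sub>R D a" "X' a = y + \<rho>' *\<^sub>R E a"
      using XA(7,8)[OF aL] by (simp_all add: \<rho>_def \<rho>'_def)
    have "x + (t + \<rho>) *\<^sub>R D a = y + t *\<^sub>R D a" unfolding x_def Xa(1) by (simp add: algebra_simps)
    then have "x + (t + \<rho>) *\<^sub>R D a \<in> interior \<Omega>1" using t by simp
    then have mD: "m \<bullet> D a > 0" using A.exits_transversal[OF XA(1)[OF aL]] sm(1) by (auto simp: x_def)
    have "X' a + (u - \<rho>') *\<^sub>R E a = y + u *\<^sub>R E a" unfolding Xa(2) by (simp add: algebra_simps)
    then have "X' a + (u - \<rho>') *\<^sub>R E a \<in> interior \<Omega>1" using u by simp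
    then have mE: "m' \<bullet> E a > 0" using A.exits_transversal[OF XA(2)[OF aL]] sm(2) by auto
    have md: "normal \<Omega>1 x \<bullet> d > 0" using mD c by (simp add: m_def d_def)
    have yx: "y = x + (\<rho> * c) *\<^sub>R d" using Xa(1) Dd by (simp add: x_def)
    have "n \<bullet> d > 0" using nD[of a] c by (simp add: d_def)
    then have "exits \<Omega>2 y d" using B.exits_smooth[of y n d] sn y B.frontier_subset by blast
    then have oy: "outer x d = y" using hit_eq[of \<Omega>2 x "\<rho> * c" d] yx by simp
    have d2: "dir2 x d = (1 / c) *\<^sub>R E a"
    proof -
      have "dir2 x d = reflect n d" by (simp only: dir2_def oy n_def)
      then show ?thesis by (simp add: d_def reflect_scaleR rD)
    qed
    have fx: "far x d = X' a" unfolding far_def oy d2 X'_def using c by (intro hit_scale) simp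
    have "norm (y - x) = \<rho> * c" using yx nd rho c by simp
    moreover have "norm (X' a - y) = \<rho>' * c"
    proof -
      have "norm (E a) = c" using norm_reflect[OF nn, of "D a"] rD by (simp add: c_def)
      then show ?thesis using Xa(2) rho by simp
    qed
    ultimately have id: "(\<rho> * c) * (m \<bullet> d) * (m' \<bullet> \<tau>) + (\<rho>' * c) * (m' \<bullet> ((1 / c) *\<^sub>R E a)) * (m \<bullet> \<tau>) = 0"
      using tangent_concurrency[OF xf nd md] unfolding oy fx d2 n_def[symmetric] \<tau>_def[symmetric] m_def m'_def
      by simp
    then have id: "(\<rho> * (m \<bullet> D a)) * (m' \<bullet> \<tau>) + (\<rho>' * (m' \<bullet> E a)) * (m \<bullet> \<tau>) = 0"
      using c by (simp add: d_def)
    have LD: "lipschitz_at D a" "lipschitz_at E a"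
    proof -
      have "(D has_vector_derivative \<tau>) (at a)" "(E has_vector_derivative \<tau>) (at a)"
        unfolding D_def E_def has_vector_derivative_def by (auto intro!: derivative_eq_intros)
      then show "lipschitz_at D a" "lipschitz_at E a" by (auto intro: lipschitz_at_deriv)
    qed
    have LX: "lipschitz_at X a"
    proof -
      obtain C where "\<forall>\<^sub>F \<sigma> in at a. norm (hit \<Omega>1 y (D \<sigma>) - hit \<Omega>1 y (D a)) \<le> C * (norm (y - y) + norm (D \<sigma> - D a))"
        using A.hit_lipschitz[OF tendsto_const Dlim(1) D0(1) t] sm(1) unfolding x_def X_def by blast
      then show ?thesis unfolding X_def by (intro lipschitz_at_le[OF LD(1)]) simp
    qed
    have LX': "lipschitz_at X' a"
    proof -
      obtain C where "\<forall>\<^sub>F \<sigma> in at a. norm (hit \<Omega>1 y (E \<sigma>) - hit \<Omega>1 y (E a)) \<le> C * (norm (y - y) + norm (E \<sigma> - E a))"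
        using A.hit_lipschitz[OF tendsto_const Dlim(2) D0(2) u] sm(2) unfolding X'_def by blast
      then show ?thesis unfolding X'_def by (intro lipschitz_at_le[OF LD(2)]) simp
    qed
    have evL: "\<forall>\<^sub>F \<sigma> in at a. \<sigma> \<in> \<Lambda>" using opn aL by (intro eventually_at_in_open')
    have T: "((\<lambda>\<sigma>. m \<bullet> X \<sigma>) has_real_derivative 0) (at a)"
      by (rule A.tangential_derivative[OF _ _ LX]) (use sm XA(3,5) aL evL in \<open>auto simp: x_def elim: eventually_mono\<close>)
    have T': "((\<lambda>\<sigma>. m' \<bullet> X' \<sigma>) has_real_derivative 0) (at a)"
      by (rule A.tangential_derivative[OF _ _ LX']) (use sm XA(4,6) aL evL in \<open>auto simp: elim: eventually_mono\<close>)
    \<comment> \<open>Measured along the fixed normals \<open>m\<close> and \<open>m'\<close>, the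
      distances from \<open>y\<close> are stationary at \<open>a\<close>, since \<open>X\<close> and
      \<open>X'\<close> move tangentially. Each reciprocal is an affine function of \<sigma> over a
      stationary one, so only \<open>m \<bullet> \<tau>\<close> and
      \<open>m' \<bullet> \<tau>\<close> enter the derivative, and concurrency cancels them.\<close>
    define q where "q \<sigma> = m \<bullet> y - m \<bullet> X \<sigma>" for \<sigma>
    define q' where "q' \<sigma> = m' \<bullet> X' \<sigma> - m' \<bullet> y" for \<sigma>
    have qd: "(q has_real_derivative 0) (at a)" "(q' has_real_derivative 0) (at a)"
      unfolding q_def q'_def using T T' by (auto intro!: derivative_eq_intros)
    have qa: "q a = \<rho> * (m \<bullet> D a)" "q' a = \<rho>' * (m' \<bullet> E a)"
      unfolding q_def q'_def Xa by (simp_all add: inner_add_right inner_diff_right algebra_simps)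
    have qpos: "q a > 0" "q' a > 0" using qa rho mD mE by simp_all
    have qq: "q \<sigma> = (n \<bullet> (y - X \<sigma>)) * (m \<bullet> n + \<sigma> * (m \<bullet> \<tau>))" "q' \<sigma> = (n \<bullet> (y - X' \<sigma>)) * (- (m' \<bullet> n) + \<sigma> * (m' \<bullet> \<tau>))"
      if s: "\<sigma> \<in> \<Lambda>" for \<sigma>
    proof -
      have "m \<bullet> X \<sigma> = m \<bullet> (y + (- (n \<bullet> (y - X \<sigma>))) *\<^sub>R D \<sigma>)" using XA(7)[OF s] by simp
      then show "q \<sigma> = (n \<bullet> (y - X \<sigma>)) * (m \<bullet> n + \<sigma> * (m \<bullet> \<tau>))"
        unfolding q_def D_def by (simp add: inner_add_right inner_diff_right algebra_simps)
      have "m' \<bullet> X' \<sigma> = m' \<bullet> (y + (n \<bullet> (y - X' \<sigma>)) *\<^sub>R E \<sigma>)" using XA(8)[OF s] by simp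
      then show "q' \<sigma> = (n \<bullet> (y - X' \<sigma>)) * (- (m' \<bullet> n) + \<sigma> * (m' \<bullet> \<tau>))"
        unfolding q'_def E_def by (simp add: inner_add_right inner_diff_right algebra_simps)
    qed
    define k0 where "k0 \<sigma> = (m \<bullet> n + \<sigma> * (m \<bullet> \<tau>)) / q \<sigma> + (- (m' \<bullet> n) + \<sigma> * (m' \<bullet> \<tau>)) / q' \<sigma>" for \<sigma>
    have "(q \<longlongrightarrow> q a) (at a)" "(q' \<longlongrightarrow> q' a) (at a)"
      using qd DERIV_isCont isCont_def by blast+
    then have "\<forall>\<^sub>F \<sigma> in at a. q \<sigma> > 0" "\<forall>\<^sub>F \<sigma> in at a. q' \<sigma> > 0"
      using qpos by (auto intro: order_tendstoD)
    then have evq: "\<forall>\<^sub>F \<sigma> in nhds a. q \<sigma> > 0 \<and> q' \<sigma> > 0"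
      using qpos by (simp add: eventually_nhds_conv_at eventually_conj)
    have "\<forall>\<^sub>F \<sigma> in nhds a. \<sigma> \<in> \<Lambda>" using opn aL eventually_nhds by blast
    then have kk: "\<forall>\<^sub>F \<sigma> in nhds a. k \<sigma> = k0 \<sigma>"
      using evq
    proof eventually_elim
      case (elim \<sigma>)
      then show ?case using qq[OF elim(1)] unfolding k_def k0_def by auto
    qed
    have lin: "((\<lambda>\<sigma>. x + \<sigma> * b) has_real_derivative b) (at a)" for x b :: real
      by (auto intro!: derivative_eq_intros)
    have "(k0 has_real_derivative ((m \<bullet> \<tau>) * q a - (m \<bullet> n + a * (m \<bullet> \<tau>)) * 0) / (q a * q a)
        + ((m' \<bullet> \<tau>) * q' a - (- (m' \<bullet> n) + a * (m' \<bullet> \<tau>)) * 0) / (q' a * q' a)) (at a)"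
      unfolding k0_def using qpos by (intro DERIV_add DERIV_divide lin qd) auto
    then have "(k0 has_real_derivative ((m \<bullet> \<tau>) / q a + (m' \<bullet> \<tau>) / q' a)) (at a)"
      using qpos by simp
    moreover have "(m \<bullet> \<tau>) / q a + (m' \<bullet> \<tau>) / q' a = 0"
    proof -
      have "(m \<bullet> \<tau>) * q' a + (m' \<bullet> \<tau>) * q a = 0" using id qa by (simp add: algebra_simps)
      then show ?thesis using qpos by (simp add: field_simps)
    qed
    ultimately have "(k0 has_real_derivative 0) (at a)" by simp
    then show ?thesis using DERIV_cong_ev[OF refl kk refl] by blast
  qed
  show ?thesis
  proof (cases "\<Lambda> = {}")
    case True
    then show ?thesis by (auto simp: \<Lambda>_def D_def)
  next
    case False
    then obtain b where b: "b \<in> \<Lambda>" by blast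
    have "k \<sigma> = k b" if "\<sigma> \<in> \<Lambda>" for \<sigma>
    proof (rule has_derivative_zero_unique_strong_connected[where S=\<Lambda> and K=Bad and f=k and c=b])
      fix a assume "a \<in> \<Lambda> - Bad"
      from derk[OF this] show "(k has_derivative (\<lambda>h. 0)) (at a within \<Lambda>)"
        by (rule has_real_derivative_zero_within)
    qed (use \<open>finite Bad\<close> contk that b conn opn in auto)
    then show ?thesis
      by (intro exI[of _ "k b"]) (auto simp: k_def X_def X'_def D_def E_def \<Lambda>_def)
  qed
qed

lemma projective_symmetry:
  assumes y: "y \<in> frontier \<Omega>2"
  defines "n \<equiv> normal \<Omega>2 y"
  defines "\<tau> \<equiv> \<i> * n"
  shows "\<exists>K. \<forall>z\<in>\<Omega>1. \<exists>z'\<in>\<Omega>1. (\<tau> \<bullet> (z' - y)) / (n \<bullet> (y - z')) = - ((\<tau> \<bullet> (z - y)) / (n \<bullet> (y - z)))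
      \<and> 1 / (n \<bullet> (y - z)) + 1 / (n \<bullet> (y - z')) = K"
proof -
  have nn: "norm n = 1" using norm_normal_B[OF y] by (simp add: n_def)
  have sn: "support_normals \<Omega>2 y = {n}" using B_normal[OF y] by (simp add: n_def)
  have nt: "norm \<tau> = 1" using nn by (simp add: \<tau>_def norm_mult)
  have n1: "n \<bullet> n = 1" "n \<bullet> \<tau> = 0" "\<tau> \<bullet> \<tau> = 1" "\<tau> \<bullet> n = 0"
    using inner_unit[OF nn] inner_unit[OF nt] by (simp_all add: \<tau>_def inner_complex_def)
  define D where "D \<sigma> = n + \<sigma> *\<^sub>R \<tau>" for \<sigma> :: real
  have nD: "n \<bullet> D \<sigma> = 1" "\<tau> \<bullet> D \<sigma> = \<sigma>" for \<sigma> using n1 by (simp_all add: D_def inner_add_right)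
  have D0: "D \<sigma> \<noteq> 0" for \<sigma> using nD(1)[of \<sigma>] by auto
  have rD: "reflect n (D \<sigma>) = - D (- \<sigma>)" for \<sigma>
    unfolding reflect_eq[OF nn] nD by (simp add: D_def algebra_simps scaleR_2)
  have inw: "n \<bullet> (y - z) > 0" if "z \<in> \<Omega>1" for z
    using inward[of n y z] sn that by (simp add: inner_diff_right)
  obtain K where K: "\<And>\<sigma>. (\<exists>t. y + t *\<^sub>R D \<sigma> \<in> interior \<Omega>1) \<Longrightarrow>
     1 / (n \<bullet> (y - hit \<Omega>1 y (D \<sigma>))) + 1 / (n \<bullet> (y - hit \<Omega>1 y (- D (- \<sigma>)))) = K"
    using reciprocal_sum_constant[OF y] unfolding n_def[symmetric] \<tau>_def[symmetric] D_def by auto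
  define R where "R z z' \<longleftrightarrow> (\<tau> \<bullet> (z' - y)) / (n \<bullet> (y - z')) = - ((\<tau> \<bullet> (z - y)) / (n \<bullet> (y - z)))
      \<and> 1 / (n \<bullet> (y - z)) + 1 / (n \<bullet> (y - z')) = K" for z z'
  have int: "\<exists>z'\<in>\<Omega>1. R z z'" if z: "z \<in> interior \<Omega>1" for z
  proof -
    define \<rho> where "\<rho> = n \<bullet> (y - z)"
    have zA: "z \<in> \<Omega>1" using z interior_subset by blast
    have rho: "\<rho> > 0" using inw zA by (simp add: \<rho>_def)
    define \<sigma> where "\<sigma> = (\<tau> \<bullet> (y - z)) / \<rho>"
    have zD: "z = y + (- \<rho>) *\<^sub>R D \<sigma>"
    proof -
      have "y - z = (n \<bullet> (y - z)) *\<^sub>R n + (\<tau> \<bullet> (y - z)) *\<^sub>R \<tau>"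
        unfolding \<tau>_def by (rule unit_decomp[OF nn])
      also have "\<dots> = \<rho> *\<^sub>R D \<sigma>" using rho by (simp add: D_def \<sigma>_def scaleR_add_right \<rho>_def)
      finally show ?thesis by (simp add: algebra_simps)
    qed
    have i1: "\<exists>t. y + t *\<^sub>R D \<sigma> \<in> interior \<Omega>1" using z zD by metis
    then obtain t where t: "y + t *\<^sub>R D \<sigma> \<in> interior \<Omega>1" by blast
    obtain u where u: "y + u *\<^sub>R (- D (- \<sigma>)) \<in> interior \<Omega>1"
      using reflected_meets_interior[OF y t] rD[of \<sigma>] unfolding n_def[symmetric] by metis
    have i2: "y + (- u) *\<^sub>R D (- \<sigma>) \<in> interior \<Omega>1" using u by simp
    have hitx: "exits \<Omega>1 (hit \<Omega>1 y (s *\<^sub>R D \<kappa>)) (s *\<^sub>R D \<kappa>) \<and> hit \<Omega>1 y (s *\<^sub>R D \<kappa>) \<in> \<Omega>1 \<and>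
        hit \<Omega>1 y (s *\<^sub>R D \<kappa>) = y + (- (n \<bullet> (y - hit \<Omega>1 y (s *\<^sub>R D \<kappa>)))) *\<^sub>R D \<kappa>"
      if "s = 1 \<or> s = -1" "y + v *\<^sub>R D \<kappa> \<in> interior \<Omega>1" for s \<kappa> v
    proof -
      have "y + v *\<^sub>R D \<kappa> \<in> \<Omega>1" using that(2) interior_subset by blast
      then have "y + (v * s) *\<^sub>R (s *\<^sub>R D \<kappa>) \<in> \<Omega>1" using that(1) by auto
      from A.exits_hit[OF this] that D0
      obtain a where a: "exits \<Omega>1 (hit \<Omega>1 y (s *\<^sub>R D \<kappa>)) (s *\<^sub>R D \<kappa>)" "hit \<Omega>1 y (s *\<^sub>R D \<kappa>) = y + a *\<^sub>R s *\<^sub>R D \<kappa>" by auto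
      have "n \<bullet> (y - hit \<Omega>1 y (s *\<^sub>R D \<kappa>)) = - (a * s)" unfolding a(2) using nD by simp
      then show ?thesis using a by (simp add: exits_def)
    qed
    \<comment> \<open>Near and far point of \<Omega>1 on the line of slope \<open>\<kappa>\<close>.
      The reciprocal relation couples the near point of slope \<sigma> with the far point of slope
      \<open>- \<sigma>\<close>, and vice versa.\<close>
    define N where "N \<kappa> = hit \<Omega>1 y (D \<kappa>)" for \<kappa>
    define Fa where "Fa \<kappa> = hit \<Omega>1 y (- D \<kappa>)" for \<kappa>
    define \<nu> where "\<nu> \<kappa> = n \<bullet> (y - N \<kappa>)" for \<kappa>
    define \<phi> where "\<phi> \<kappa> = n \<bullet> (y - Fa \<kappa>)" for \<kappa>
    have NF: "exits \<Omega>1 (N \<kappa>) (D \<kappa>)" "N \<kappa> \<in> \<Omega>1" "N \<kappa> = y + (- \<nu> \<kappa>) *\<^sub>R D \<kappa>"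
       "exits \<Omega>1 (Fa \<kappa>) (- D \<kappa>)" "Fa \<kappa> \<in> \<Omega>1" "Fa \<kappa> = y + (- \<phi> \<kappa>) *\<^sub>R D \<kappa>" "\<nu> \<kappa> > 0" "\<phi> \<kappa> > 0"
      if "y + v *\<^sub>R D \<kappa> \<in> interior \<Omega>1" for \<kappa> v
      using hitx[OF _ that, of 1] hitx[OF _ that, of "-1"] inw unfolding N_def Fa_def \<nu>_def \<phi>_def by simp_all
    note NF1 = NF[OF t] and NF2 = NF[OF i2]
    have K1: "1 / \<nu> \<sigma> + 1 / \<phi> (- \<sigma>) = K" using K[OF i1] by (simp add: \<nu>_def \<phi>_def N_def Fa_def)
    have "\<exists>t. y + t *\<^sub>R D (- \<sigma>) \<in> interior \<Omega>1" using i2 by blast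
    from K[OF this] have K2: "1 / \<nu> (- \<sigma>) + 1 / \<phi> \<sigma> = K" by (simp add: \<nu>_def \<phi>_def N_def Fa_def)
    have "- \<rho> \<le> - \<nu> \<sigma>"
      using exits_le[of \<Omega>1 y "- \<nu> \<sigma>" "D \<sigma>" "- \<rho>"] NF1(1,3) zA zD by metis
    then have le1: "1 / \<rho> \<le> 1 / \<nu> \<sigma>" using NF1(7) by (simp add: frac_le)
    have "\<rho> \<le> \<phi> \<sigma>"
    proof (rule exits_le)
      show "exits \<Omega>1 (y + \<phi> \<sigma> *\<^sub>R (- D \<sigma>)) (- D \<sigma>)" using NF1(4,6) by simp
      show "y + \<rho> *\<^sub>R (- D \<sigma>) \<in> \<Omega>1" using zA zD by simp
    qed
    then have le2: "1 / \<phi> \<sigma> \<le> 1 / \<rho>" using rho by (simp add: frac_le)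
    \<comment> \<open>The depth forced by the reciprocal sum. As \<rho> lies between the near and
      far depths for \<sigma>, \<open>\<rho>'\<close> lies between those for
      \<open>- \<sigma>\<close>, and convexity places the point in \<Omega>1.\<close>
    define \<rho>' where "\<rho>' = 1 / (K - 1 / \<rho>)"
    have Kr: "K - 1 / \<rho> > 0" "1 / \<phi> (- \<sigma>) \<le> K - 1 / \<rho>" "K - 1 / \<rho> \<le> 1 / \<nu> (- \<sigma>)"
    proof -
      show "1 / \<phi> (- \<sigma>) \<le> K - 1 / \<rho>" using K1 le1 by linarith
      then show "K - 1 / \<rho> > 0" using NF2(8) by (meson less_le_trans zero_less_divide_1_iff)
      show "K - 1 / \<rho> \<le> 1 / \<nu> (- \<sigma>)" using K2 le2 by linarith
    qed
    have rho': "\<rho>' > 0" "\<rho>' \<le> \<phi> (- \<sigma>)" "\<nu> (- \<sigma>) \<le> \<rho>'"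
      using Kr NF2(7,8) by (auto simp: \<rho>'_def field_simps)
    define z' where "z' = y + (- \<rho>') *\<^sub>R D (- \<sigma>)"
    have "z' \<in> \<Omega>1"
    proof (cases "\<nu> (- \<sigma>) = \<phi> (- \<sigma>)")
      case True
      then show ?thesis using rho' NF2(2,3) by (simp add: z'_def)
    next
      case False
      define e where "e = (\<rho>' - \<nu> (- \<sigma>)) / (\<phi> (- \<sigma>) - \<nu> (- \<sigma>))"
      have pos: "\<phi> (- \<sigma>) - \<nu> (- \<sigma>) > 0" using False rho' by linarith
      have e: "0 \<le> e" "e \<le> 1" using pos rho' by (auto simp: e_def)
      have "(1 - e) *\<^sub>R N (- \<sigma>) + e *\<^sub>R Fa (- \<sigma>) \<in> \<Omega>1"
        by (rule convexD_alt[OF A.convex_K NF2(2,5) e])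
      also have "(1 - e) *\<^sub>R N (- \<sigma>) + e *\<^sub>R Fa (- \<sigma>) = y + (- (\<nu> (- \<sigma>) + e * (\<phi> (- \<sigma>) - \<nu> (- \<sigma>)))) *\<^sub>R D (- \<sigma>)"
        by (subst NF2(3), subst NF2(6)) (simp add: algebra_simps)
      also have "\<nu> (- \<sigma>) + e * (\<phi> (- \<sigma>) - \<nu> (- \<sigma>)) = \<rho>'" using pos by (simp add: e_def)
      finally show ?thesis by (simp add: z'_def)
    qed
    moreover have "R z z'"
    proof -
      have a: "n \<bullet> (y - z') = \<rho>'" "\<tau> \<bullet> (z' - y) = \<rho>' * \<sigma>" using nD by (simp_all add: z'_def)
      have b: "\<tau> \<bullet> (z - y) = - (\<rho> * \<sigma>)" using zD nD by simp
      show ?thesis unfolding R_def a b \<rho>_def[symmetric] using rho rho' by (simp add: \<rho>'_def)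
    qed
    ultimately show ?thesis by blast
  qed
  \<comment> \<open>\<open>R\<close> is closed in both points, so compactness extends it from the
    interior to all of \<Omega>1.\<close>
  have "\<exists>z'\<in>\<Omega>1. R z z'" if z: "z \<in> \<Omega>1" for z
  proof -
    have "z \<in> closure (interior \<Omega>1)" using z A.closure_interior_K by simp
    then obtain w where w: "\<And>k. w k \<in> interior \<Omega>1" "w \<longlonglongrightarrow> z"
      unfolding closure_sequential by blast
    have "\<forall>k. \<exists>z'. z' \<in> \<Omega>1 \<and> R (w k) z'" using int w(1) by blast
    then obtain w' where w': "\<And>k. w' k \<in> \<Omega>1" "\<And>k. R (w k) (w' k)" by metis
    obtain z' r where z': "z' \<in> \<Omega>1" "strict_mono r" "(w' \<circ> r) \<longlonglongrightarrow> z'"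
      using A.compact_K w'(1) unfolding compact_def by metis
    have wr: "(\<lambda>k. w (r k)) \<longlonglongrightarrow> z" and wr': "(\<lambda>k. w' (r k)) \<longlonglongrightarrow> z'"
      using LIMSEQ_subseq_LIMSEQ[OF w(2) z'(2)] z'(3) by (simp_all add: o_def)
    have ne: "n \<bullet> (y - z) \<noteq> 0" "n \<bullet> (y - z') \<noteq> 0" using inw[OF z] inw[OF z'(1)] by auto
    have "(\<lambda>k. (\<tau> \<bullet> (w' (r k) - y)) / (n \<bullet> (y - w' (r k)))) \<longlonglongrightarrow> (\<tau> \<bullet> (z' - y)) / (n \<bullet> (y - z'))"
      "(\<lambda>k. - ((\<tau> \<bullet> (w (r k) - y)) / (n \<bullet> (y - w (r k))))) \<longlonglongrightarrow> - ((\<tau> \<bullet> (z - y)) / (n \<bullet> (y - z)))"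
      "(\<lambda>k. 1 / (n \<bullet> (y - w (r k))) + 1 / (n \<bullet> (y - w' (r k)))) \<longlonglongrightarrow> 1 / (n \<bullet> (y - z)) + 1 / (n \<bullet> (y - z'))"
      using ne by (auto intro!: tendsto_intros wr wr')
    moreover have "(\<tau> \<bullet> (w' (r k) - y)) / (n \<bullet> (y - w' (r k))) = - ((\<tau> \<bullet> (w (r k) - y)) / (n \<bullet> (y - w (r k))))"
      "1 / (n \<bullet> (y - w (r k))) + 1 / (n \<bullet> (y - w' (r k))) = K" for k
      using w'(2)[of "r k"] by (auto simp: R_def)
    ultimately have "R z z'" unfolding R_def using LIMSEQ_unique by (simp add: LIMSEQ_const_iff)
    then show ?thesis using z'(1) by blast
  qed
  then show ?thesis unfolding R_def by blast
qed

end

section \<open>Ellipses\<close>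

text \<open>The rule on \<open>1 / (a - v)\<close> is the projective involution exchanging 0 and
  \<open>D\<close>. The first identity says that it preserves each conic
  \<open>v * (D - v) = f * w\<^sup>2\<close>; the second that in the coordinate
  \<open>v / (D - v)\<close> it is the inversion with product
  \<open>(a / (a - D))\<^sup>2\<close>.\<close>

lemma harmonic_involution_identities:
  fixes a v v' w w' D :: real
  assumes pos: "a - v > 0" "a - v' > 0" "a > 0" "a - D > 0"
    and rec: "1 / (a - v) + 1 / (a - v') = 1 / a + 1 / (a - D)"
    and w: "w' * (a - v) = - (w * (a - v'))"
  shows "v' * (D - v') * w\<^sup>2 = v * (D - v) * w'\<^sup>2"
    and "v * v' * (a - D)\<^sup>2 = a\<^sup>2 * ((D - v) * (D - v'))"
proof -
  define s where "s = a - v"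
  define s' where "s' = a - v'"
  define b where "b = a - D"
  have p: "s > 0" "s' > 0" "a > 0" "b > 0" using pos by (auto simp: s_def s'_def b_def)
  have vs: "v = a - s" "v' = a - s'" "D - v = s - b" "D - v' = s' - b" by (simp_all add: s_def s'_def b_def)
  have "1 / s + 1 / s' = 1 / a + 1 / b" using rec by (simp add: s_def s'_def b_def)
  then have r: "(s + s') * (a * b) = (s * s') * (a + b)" using p by (simp add: field_simps)
  have "(a - s) * (a - s') * b\<^sup>2 - a\<^sup>2 * ((s - b) * (s' - b)) = (a - b) * ((s + s') * (a * b) - (s * s') * (a + b))"
    by (simp add: algebra_simps power2_eq_square)
  then show "v * v' * (a - D)\<^sup>2 = a\<^sup>2 * ((D - v) * (D - v'))"
    unfolding vs(3,4) unfolding vs(1,2) unfolding b_def[symmetric] using r by simp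
  have ww: "w' * s = - (w * s')" using w by (simp add: s_def s'_def)
  have "(a - s') * (s' - b) * s\<^sup>2 - (a - s) * (s - b) * s'\<^sup>2 = (s - s') * ((s * s') * (a + b) - (s + s') * (a * b))"
    by (simp add: algebra_simps power2_eq_square)
  then have k: "(a - s') * (s' - b) * s\<^sup>2 = (a - s) * (s - b) * s'\<^sup>2" using r by simp
  have "((a - s') * (s' - b) * w\<^sup>2) * s\<^sup>2 = ((a - s') * (s' - b) * s\<^sup>2) * w\<^sup>2" by simp
  also have "\<dots> = (a - s) * (s - b) * (w * s')\<^sup>2" unfolding k by (simp add: power_mult_distrib)
  also have "(w * s')\<^sup>2 = (w' * s)\<^sup>2" unfolding ww by simp
  also have "(a - s) * (s - b) * (w' * s)\<^sup>2 = ((a - s) * (s - b) * w'\<^sup>2) * s\<^sup>2" by (simp add: power_mult_distrib)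
  finally show "v' * (D - v') * w\<^sup>2 = v * (D - v) * w'\<^sup>2" unfolding vs(3,4) unfolding vs(1,2) using p(1) by simp
qed

lemma focal_sum_convex:
  fixes f1 f2 a b :: complex
  assumes "0 \<le> e" "e \<le> 1"
  shows "norm ((1 - e) *\<^sub>R a + e *\<^sub>R b - f1) + norm ((1 - e) *\<^sub>R a + e *\<^sub>R b - f2)
    \<le> (1 - e) * (norm (a - f1) + norm (a - f2)) + e * (norm (b - f1) + norm (b - f2))"
proof -
  have "norm ((1 - e) *\<^sub>R a + e *\<^sub>R b - f) \<le> (1 - e) * norm (a - f) + e * norm (b - f)" for f
  proof -
    have "(1 - e) *\<^sub>R a + e *\<^sub>R b - f = (1 - e) *\<^sub>R (a - f) + e *\<^sub>R (b - f)" by (simp add: algebra_simps)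
    then show ?thesis using norm_triangle_ineq[of "(1 - e) *\<^sub>R (a - f)" "e *\<^sub>R (b - f)"] assms by simp
  qed
  from this[of f1] this[of f2] show ?thesis by (simp add: distrib_left)
qed

text \<open>Convexity along the segment from \<open>f1\<close> to the outer point; strictness comes
  from the focal sum at \<open>f1\<close> being below \<open>s\<close>.\<close>

lemma focal_sum_ray:
  fixes f1 f2 z :: complex
  assumes s: "norm (f1 - f2) < s" and t: "t > 1"
    and le: "norm (f1 + t *\<^sub>R (z - f1) - f1) + norm (f1 + t *\<^sub>R (z - f1) - f2) \<le> s"
  shows "norm (z - f1) + norm (z - f2) < s"
proof -
  define b where "b = f1 + t *\<^sub>R (z - f1)"
  have z: "z = (1 - 1 / t) *\<^sub>R f1 + (1 / t) *\<^sub>R b" using t by (simp add: b_def algebra_simps)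
  have "norm (z - f1) + norm (z - f2) \<le> (1 - 1 / t) * (norm (f1 - f1) + norm (f1 - f2)) + (1 / t) * (norm (b - f1) + norm (b - f2))"
    by (subst (1 2) z, rule focal_sum_convex) (use t in auto)
  also have "\<dots> \<le> (1 - 1 / t) * norm (f1 - f2) + (1 / t) * s"
    using le t by (intro add_mono mult_left_mono) (auto simp: b_def)
  also have "\<dots> < (1 - 1 / t) * s + (1 / t) * s" using s t by simp
  finally show ?thesis by (simp add: algebra_simps)
qed

text \<open>An interior point can be pushed slightly away from \<open>f1\<close> inside the disc, so
  its focal sum is strictly below \<open>s\<close>.\<close>

lemma frontier_focal_disc:
  assumes s: "norm (f1 - f2) < s"
  shows "frontier {z. norm (z - f1) + norm (z - f2) \<le> s} = ellipse f1 f2 s"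
proof -
  let ?K = "{z. norm (z - f1) + norm (z - f2) \<le> s}"
  have cont: "continuous_on UNIV (\<lambda>z. norm (z - f1) + norm (z - f2))" by (intro continuous_intros)
  have "closed ?K" using closed_Collect_le[OF cont, of "\<lambda>_. s"] by simp
  have opn: "open {z. norm (z - f1) + norm (z - f2) < s}" using open_Collect_less[OF cont, of "\<lambda>_. s"] by simp
  have int: "interior ?K = {z. norm (z - f1) + norm (z - f2) < s}"
  proof
    show "{z. norm (z - f1) + norm (z - f2) < s} \<subseteq> interior ?K" by (rule interior_maximal[OF _ opn]) auto
    show "interior ?K \<subseteq> {z. norm (z - f1) + norm (z - f2) < s}"
    proof
      fix z assume z: "z \<in> interior ?K"
      then obtain e where e: "e > 0" "cball z e \<subseteq> ?K" by (auto simp: mem_interior_cball)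
      define t where "t = 1 + e / (norm (z - f1) + 1)"
      have p: "norm (z - f1) + 1 > 0" by (simp add: add_nonneg_pos)
      have t: "t > 1" using e(1) p by (simp add: t_def)
      have "f1 + t *\<^sub>R (z - f1) = z + (e / (norm (z - f1) + 1)) *\<^sub>R (z - f1)" by (simp add: t_def algebra_simps)
      moreover have "norm ((e / (norm (z - f1) + 1)) *\<^sub>R (z - f1)) \<le> e"
      proof -
        have "norm ((e / (norm (z - f1) + 1)) *\<^sub>R (z - f1)) = e / (norm (z - f1) + 1) * norm (z - f1)"
          unfolding norm_scaleR using e(1) p by simp
        also have "\<dots> \<le> e / (norm (z - f1) + 1) * (norm (z - f1) + 1)"
          using e(1) p by (intro mult_left_mono) auto
        also have "\<dots> = e" using p by simp
        finally show ?thesis .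
      qed
      ultimately have "f1 + t *\<^sub>R (z - f1) \<in> ?K" by (intro subsetD[OF e(2)]) (simp add: dist_norm)
      then show "z \<in> {z. norm (z - f1) + norm (z - f2) < s}" using focal_sum_ray[OF s t] by blast
    qed
  qed
  show ?thesis
    unfolding frontier_def closure_closed[OF \<open>closed ?K\<close>] int ellipse_def by auto
qed

text \<open>Each ray from \<open>f1\<close> contains a frontier point of \<open>K\<close> and, by
  \<open>focal_sum_ray\<close>, only one point of the ellipse; one inclusion therefore gives
  equality.\<close>

lemma (in convex_body) frontier_eq_ellipse:
  assumes s: "norm (f1 - f2) < s" and f1: "f1 \<in> interior K" and sub: "frontier K \<subseteq> ellipse f1 f2 s"
  shows "frontier K = ellipse f1 f2 s"
proof
  show "ellipse f1 f2 s \<subseteq> frontier K"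
  proof
    fix z assume z: "z \<in> ellipse f1 f2 s"
    have zf: "z - f1 \<noteq> 0" using z s by (auto simp: ellipse_def)
    obtain t where t: "exits K (f1 + t *\<^sub>R (z - f1)) (z - f1)"
      using exits_exists[of f1 0 "z - f1"] f1 interior_subset zf by auto
    have fr: "f1 + t *\<^sub>R (z - f1) \<in> frontier K" using exits_frontier[OF t zf] .
    have "t > 0"
    proof (rule ccontr)
      assume "\<not> t > 0"
      have "f1 + 0 *\<^sub>R (z - f1) \<in> K" using f1 interior_subset by auto
      then have "0 \<le> t" by (rule exits_le[OF t])
      then show False using \<open>\<not> t > 0\<close> fr f1 by (auto simp: frontier_def)
    qed
    have E: "norm (f1 + t *\<^sub>R (z - f1) - f1) + norm (f1 + t *\<^sub>R (z - f1) - f2) = s"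
      using fr sub by (auto simp: ellipse_def)
    have "t = 1"
    proof (rule ccontr)
      assume "t \<noteq> 1"
      then consider "t > 1" | "t < 1" by linarith
      then show False
      proof cases
        case 1
        then have "norm (z - f1) + norm (z - f2) < s" using focal_sum_ray[OF s] E by simp
        then show False using z by (simp add: ellipse_def)
      next
        case 2
        define y where "y = f1 + t *\<^sub>R (z - f1)"
        have "f1 + (1 / t) *\<^sub>R (y - f1) = z" using \<open>t > 0\<close> by (simp add: y_def)
        moreover have "1 / t > 1" using 2 \<open>t > 0\<close> by simp
        ultimately have "norm (y - f1) + norm (y - f2) < s"
          using focal_sum_ray[OF s, of "1 / t" y] z by (simp add: ellipse_def)
        then show False using E by (simp add: y_def)
      qed
    qed
    then show "z \<in> frontier K" using fr by simp
  qed
qed (rule sub)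

text \<open>The quadratic is nonnegative on an interval with midpoint \<open>- h / c\<close>;
  invariance under change of sign puts the midpoint at 0.\<close>

lemma quadratic_even:
  fixes a h c :: real
  assumes c: "c < 0" and ex: "a + 2 * h * b0 + c * b0\<^sup>2 \<ge> 0"
    and sym: "\<And>b. a + 2 * h * b + c * b\<^sup>2 \<ge> 0 \<Longrightarrow> a - 2 * h * b + c * b\<^sup>2 \<ge> 0"
  shows "h = 0"
proof -
  have sq: "c * (a + 2 * h * b + c * b\<^sup>2) = (c * b + h)\<^sup>2 - (h\<^sup>2 - a * c)" for b
    by (simp add: algebra_simps power2_eq_square)
  have "c * (a + 2 * h * b0 + c * b0\<^sup>2) \<le> 0" using c ex by (simp add: mult_nonpos_nonneg)
  then have disc: "h\<^sup>2 - a * c \<ge> 0" unfolding sq using zero_le_power2[of "c * b0 + h"] by linarith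
  define q where "q = sqrt (h\<^sup>2 - a * c)"
  have q2: "q\<^sup>2 = h\<^sup>2 - a * c" using disc by (simp add: q_def)
  have key: "h * (- h + r) \<ge> 0" if "r\<^sup>2 = h\<^sup>2 - a * c" for r
  proof -
    define b where "b = (- h + r) / c"
    have cb: "c * b = - h + r" using c by (simp add: b_def)
    have "c * (a + 2 * h * b + c * b\<^sup>2) = 0" unfolding sq cb using that by simp
    then have z: "a + 2 * h * b + c * b\<^sup>2 = 0" using c by simp
    then have "a - 2 * h * b + c * b\<^sup>2 \<ge> 0" using sym by simp
    then have "h * b \<le> 0" using z by linarith
    then have "c * (h * b) \<ge> 0" using c by (simp add: mult_nonpos_nonpos)
    then have "h * (c * b) \<ge> 0" by (simp only: mult.left_commute)
    then show ?thesis unfolding cb .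
  qed
  have "h * (- h + q) + h * (- h + (- q)) \<ge> 0" using key[of q] key[of "- q"] q2 by simp
  then have "h\<^sup>2 \<le> 0" by (simp add: algebra_simps power2_eq_square)
  then show ?thesis by simp
qed

lemma quadratic_solvable:
  fixes a b c :: real
  assumes "a > 0"
  shows "(\<exists>t. a * t\<^sup>2 + 2 * b * t + c \<le> 0) \<longleftrightarrow> b\<^sup>2 - a * c \<ge> 0"
proof -
  have sq: "a * (a * t\<^sup>2 + 2 * b * t + c) = (a * t + b)\<^sup>2 - (b\<^sup>2 - a * c)" for t
    by (simp add: algebra_simps power2_eq_square)
  show ?thesis
  proof
    assume "\<exists>t. a * t\<^sup>2 + 2 * b * t + c \<le> 0"
    then obtain t where "a * t\<^sup>2 + 2 * b * t + c \<le> 0" by blast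
    then have "a * (a * t\<^sup>2 + 2 * b * t + c) \<le> 0" using assms by (simp add: mult_nonneg_nonpos)
    then show "b\<^sup>2 - a * c \<ge> 0" unfolding sq using zero_le_power2[of "a * t + b"] by linarith
  next
    assume "b\<^sup>2 - a * c \<ge> 0"
    moreover define t where "t = - b / a"
    have "a * t + b = 0" using assms by (simp add: t_def)
    ultimately have "a * (a * t\<^sup>2 + 2 * b * t + c) \<le> 0" unfolding sq by simp
    then have "a * t\<^sup>2 + 2 * b * t + c \<le> 0" using assms by (simp add: mult_le_0_iff)
    then show "\<exists>t. a * t\<^sup>2 + 2 * b * t + c \<le> 0" by blast
  qed
qed

text \<open>The correspondence \<open>sym\<close> permutes the level sets of \<open>V\<close> and reverses \<open>W\<close> on each of them, so it
  exchanges their upper and lower ends.\<close>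

lemma slice_flip:
  fixes V W :: "'a \<Rightarrow> real" and s :: "real \<Rightarrow> real"
  assumes sym: "\<And>z. z \<in> K \<Longrightarrow> \<exists>z'\<in>K. W z' * s (V z) = - (W z * s (V z')) \<and> 1 / s (V z) + 1 / s (V z') = T"
    and pos: "\<And>z. z \<in> K \<Longrightarrow> s (V z) > 0" and inj: "\<And>u v. s u = s v \<Longrightarrow> u = v"
    and z: "z \<in> K" and top: "\<And>z2. z2 \<in> K \<Longrightarrow> V z2 = V z \<Longrightarrow> W z2 \<le> W z"
    and z': "z' \<in> K" "W z' * s (V z) = - (W z * s (V z'))" "1 / s (V z) + 1 / s (V z') = T"
    and z2: "z2 \<in> K" "V z2 = V z'"
  shows "W z' \<le> W z2"
proof -
  obtain y where y: "y \<in> K" "W y * s (V z2) = - (W z2 * s (V y))" "1 / s (V z2) + 1 / s (V y) = T"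
    using sym[OF z2(1)] by blast
  have "1 / s (V y) = 1 / s (V z)" using y(3)[unfolded z2(2)] z'(3) by linarith
  then have "s (V y) = s (V z)" by simp
  then have Vy: "V y = V z" by (rule inj)
  then have "W y \<le> W z" using top y(1) by blast
  then have "W y * s (V z') \<le> W z * s (V z')" using pos[OF z'(1)] by simp
  then have "- (W z2 * s (V z)) \<le> - (W z' * s (V z))" using y(2) z'(2) z2(2) Vy by simp
  then show ?thesis using pos[OF z] by simp
qed

text \<open>The ends of the diameter have the extreme values of \<open>s\<close>, so the images of
  \<open>P\<close> and \<open>Q\<close> give opposite inequalities for \<open>T\<close>. Equality
  sends \<open>P\<close> to the level 0, where \<open>W\<close> vanishes, and comparing
  \<open>W\<close> leaves no offset \<open>w\<close> of the symmetry.\<close>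

lemma diameter_slices:
  fixes V W :: "'a \<Rightarrow> real" and s :: "real \<Rightarrow> real"
  assumes D: "D > 0" and P: "P \<in> K" "V P = D" and Q: "Q \<in> K" "V Q = 0" and W0: "W P = 0"
    "\<And>z. z \<in> K \<Longrightarrow> V z = 0 \<Longrightarrow> W z = 0"
    and V: "\<And>z. z \<in> K \<Longrightarrow> 0 \<le> V z \<and> V z \<le> D"
    and pos: "\<And>v. 0 \<le> v \<Longrightarrow> v \<le> D \<Longrightarrow> s v > 0" and inj: "\<And>u v. s u = s v \<Longrightarrow> u = v"
    and mono: "(\<forall>v. 0 \<le> v \<and> v \<le> D \<longrightarrow> s D \<le> s v \<and> s v \<le> s 0) \<or> (\<forall>v. 0 \<le> v \<and> v \<le> D \<longrightarrow> s 0 \<le> s v \<and> s v \<le> s D)"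
    and sym: "\<And>z. z \<in> K \<Longrightarrow> \<exists>z'\<in>K. (W z' - w) / s (V z') = - ((W z - w) / s (V z)) \<and> 1 / s (V z) + 1 / s (V z') = T"
  shows "T = 1 / s 0 + 1 / s D \<and> w = 0"
proof -
  have p: "s 0 > 0" "s D > 0" using pos D by auto
  obtain P' where P': "P' \<in> K" "(W P' - w) / s (V P') = - ((W P - w) / s (V P))" "1 / s (V P) + 1 / s (V P') = T"
    using sym[OF P(1)] by blast
  obtain Q' where Q': "Q' \<in> K" "1 / s (V Q) + 1 / s (V Q') = T"
    using sym[OF Q(1)] by blast
  have pP: "s (V P') > 0" "s (V Q') > 0" using pos V P'(1) Q'(1) by auto
  have T: "T = 1 / s 0 + 1 / s D"
    using mono
  proof
    assume "\<forall>v. 0 \<le> v \<and> v \<le> D \<longrightarrow> s D \<le> s v \<and> s v \<le> s 0"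
    then have "s (V P') \<le> s 0" "s D \<le> s (V Q')" using V P'(1) Q'(1) by auto
    then have "1 / s 0 \<le> 1 / s (V P')" "1 / s (V Q') \<le> 1 / s D" using p pP by (auto simp: frac_le)
    then show ?thesis using P'(3) Q'(2) P(2) Q(2) by simp
  next
    assume "\<forall>v. 0 \<le> v \<and> v \<le> D \<longrightarrow> s 0 \<le> s v \<and> s v \<le> s D"
    then have "s 0 \<le> s (V P')" "s (V Q') \<le> s D" using V P'(1) Q'(1) by auto
    then have "1 / s (V P') \<le> 1 / s 0" "1 / s D \<le> 1 / s (V Q')" using p pP by (auto simp: frac_le)
    then show ?thesis using P'(3) Q'(2) P(2) Q(2) by simp
  qed
  then have "1 / s (V P') = 1 / s 0" using P'(3) P(2) by simp
  then have "s (V P') = s 0" by simp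
  then have v0: "V P' = 0" by (rule inj)
  then have "W P' = 0" using W0(2) P'(1) by blast
  then have "- w / s 0 = - (- w / s D)" using P'(2) P(2) W0(1) v0 by simp
  then have "w * (1 / s 0 + 1 / s D) = 0" by (simp add: algebra_simps)
  moreover have "1 / s 0 + 1 / s D > 0" using p by (simp add: add_pos_pos)
  ultimately show ?thesis using T by simp
qed

lemma two_factor_interior:
  fixes v v' D p q :: real
  assumes "v * v' * p = q * ((D - v) * (D - v'))" "p > 0" "q > 0" "0 < v" "v < D" "0 \<le> v'" "v' \<le> D"
  shows "0 < v' \<and> v' < D"
proof -
  have "v' \<noteq> 0" using assms by auto
  moreover have "v' \<noteq> D" using assms by auto
  ultimately show ?thesis using assms by linarith
qed

text \<open>The two symmetries have axes on either side of \<open>K\<close>; their composition fixes the ends \<open>Q\<close> and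
  \<open>Q + D n\<close> of the diameter, preserves the pencil of conics \<open>V (D - V) = f W\<^sup>2\<close> touching there, and
  contracts \<open>K\<close> to \<open>Q\<close>. Hence the 2-jet of the boundary at \<open>Q\<close> determines \<open>f\<close> everywhere.\<close>

lemma (in convex_body) ellipse_of_projective_symmetries:
  fixes n Q :: complex and D a1 a2 :: real
  defines "V \<equiv> \<lambda>z. n \<bullet> (z - Q)" and "W \<equiv> \<lambda>z. (\<i> * n) \<bullet> (z - Q)"
  assumes C: "piecewise_Ck_Jordan 4 (frontier K)"
    and n: "norm n = 1" and D: "D > 0" and a1: "a1 > D" and a2: "a2 > 0"
    and QP: "Q \<in> K" "Q + D *\<^sub>R n \<in> K"
    and bd: "\<And>z. z \<in> K \<Longrightarrow> 0 \<le> V z \<and> V z \<le> D \<and> (W z)\<^sup>2 \<le> V z * (2 * D - V z) \<and> (V z = D \<longrightarrow> W z = 0)"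
    and sym1: "\<And>z. z \<in> K \<Longrightarrow> \<exists>z'\<in>K. W z' * (a1 - V z) = - (W z * (a1 - V z')) \<and>
        1 / (a1 - V z) + 1 / (a1 - V z') = 1 / a1 + 1 / (a1 - D)"
    and sym2: "\<And>z. z \<in> K \<Longrightarrow> \<exists>z'\<in>K. W z' * (a2 + V z) = - (W z * (a2 + V z')) \<and>
        1 / (a2 + V z) + 1 / (a2 + V z') = 1 / a2 + 1 / (a2 + D)"
  shows "\<exists>c>0. \<forall>z. z \<in> K \<longleftrightarrow> c * (W z)\<^sup>2 \<le> V z * (D - V z)"
proof -
  have nt: "norm (\<i> * n) = 1" using n by (simp add: norm_mult)
  have n1: "n \<bullet> n = 1" "n \<bullet> (\<i> * n) = 0" "(\<i> * n) \<bullet> (\<i> * n) = 1" "(\<i> * n) \<bullet> n = 0"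
    using inner_unit[OF n] inner_unit[OF nt] by (simp_all add: inner_complex_def)
  define pt where "pt v w = Q + v *\<^sub>R n + w *\<^sub>R (\<i> * n)" for v w
  have Vpt: "V (pt v w) = v" "W (pt v w) = w" for v w
    by (simp_all add: V_def W_def pt_def inner_add_right n1 del: mult_scaleR_right)
  have ptV: "pt (V z) (W z) = z" for z
  proof -
    have "z - Q = V z *\<^sub>R n + W z *\<^sub>R (\<i> * n)" unfolding V_def W_def by (rule unit_decomp[OF n])
    then show ?thesis unfolding pt_def by (metis add.assoc add.commute diff_add_cancel)
  qed
  have Vcomb: "V ((1 - e) *\<^sub>R a + e *\<^sub>R b) = (1 - e) * V a + e * V b"
    "W ((1 - e) *\<^sub>R a + e *\<^sub>R b) = (1 - e) * W a + e * W b" for e a b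
    by (simp_all add: V_def W_def inner_add_right inner_diff_right algebra_simps)
  have p0: "pt 0 0 \<in> K" "pt D 0 \<in> K" using QP by (simp_all add: pt_def)
  have comb: "(1 - e) *\<^sub>R a + e *\<^sub>R b \<in> K" if "a \<in> K" "b \<in> K" "0 \<le> e" "e \<le> 1" for a b e
    using convexD_alt[OF convex_K that] .
  have between: "pt v w \<in> K" if h: "pt v w1 \<in> K" "pt v w2 \<in> K" "w1 \<le> w" "w \<le> w2" for v w w1 w2
  proof (cases "w1 = w2")
    case False
    define e where "e = (w - w1) / (w2 - w1)"
    have e: "0 \<le> e" "e \<le> 1" using h False by (auto simp: e_def)
    have "(1 - e) *\<^sub>R pt v w1 + e *\<^sub>R pt v w2 \<in> K" by (rule comb[OF h(1,2) e])
    moreover have "V ((1 - e) *\<^sub>R pt v w1 + e *\<^sub>R pt v w2) = v"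
      unfolding Vcomb Vpt by (simp add: algebra_simps)
    moreover have "W ((1 - e) *\<^sub>R pt v w1 + e *\<^sub>R pt v w2) = w1 + e * (w2 - w1)"
      unfolding Vcomb Vpt by (simp add: algebra_simps)
    moreover have "w1 + e * (w2 - w1) = w" using False by (simp add: e_def)
    ultimately show ?thesis by (metis ptV)
  qed (use h in auto)
  have axis: "pt v 0 \<in> K" if v: "0 \<le> v" "v \<le> D" for v
  proof -
    have "(1 - v / D) *\<^sub>R pt 0 0 + (v / D) *\<^sub>R pt D 0 \<in> K" by (rule comb[OF p0]) (use v D in auto)
    moreover have "V ((1 - v / D) *\<^sub>R pt 0 0 + (v / D) *\<^sub>R pt D 0) = v"
      "W ((1 - v / D) *\<^sub>R pt 0 0 + (v / D) *\<^sub>R pt D 0) = 0" unfolding Vcomb Vpt using D by simp_all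
    ultimately show ?thesis by (metis ptV)
  qed
  have W0: "W z = 0" if "z \<in> K" "V z = 0 \<or> V z = D" for z
    using bd[OF that(1)] that(2) by auto
  have a1p: "a1 - V z > 0" "a2 + V z > 0" if "z \<in> K" for z using bd[OF that] a1 a2 by linarith+
  have id1: "V z' * (D - V z') * (W z)\<^sup>2 = V z * (D - V z) * (W z')\<^sup>2"
    "V z * V z' * (a1 - D)\<^sup>2 = a1\<^sup>2 * ((D - V z) * (D - V z'))"
    if "z \<in> K" "z' \<in> K" "W z' * (a1 - V z) = - (W z * (a1 - V z'))" "1 / (a1 - V z) + 1 / (a1 - V z') = 1 / a1 + 1 / (a1 - D)" for z z'
    using harmonic_involution_identities[OF a1p(1)[OF that(1)] a1p(1)[OF that(2)] _ _ that(4,3)] a1 D by auto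
  have id2: "V z' * (D - V z') * (W z)\<^sup>2 = V z * (D - V z) * (W z')\<^sup>2"
    "V z * V z' * (a2 + D)\<^sup>2 = a2\<^sup>2 * ((D - V z) * (D - V z'))"
    if h: "z \<in> K" "z' \<in> K" "W z' * (a2 + V z) = - (W z * (a2 + V z'))" "1 / (a2 + V z) + 1 / (a2 + V z') = 1 / a2 + 1 / (a2 + D)" for z z'
  proof -
    \<comment> \<open>Reversing the diameter, \<open>V\<close> to \<open>D - V\<close> with
      \<open>a2 + D\<close> in the role of \<open>a\<close>, makes the second symmetry an instance
      of the same identities.\<close>
    have e: "(a2 + D) - (D - V z) = a2 + V z" "(a2 + D) - (D - V z') = a2 + V z'" "(a2 + D) - D = a2" by simp_all
    have "(D - V z') * (D - (D - V z')) * (W z)\<^sup>2 = (D - V z) * (D - (D - V z)) * (W z')\<^sup>2"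
      "(D - V z) * (D - V z') * ((a2 + D) - D)\<^sup>2 = (a2 + D)\<^sup>2 * ((D - (D - V z)) * (D - (D - V z')))"
      using harmonic_involution_identities[of "a2 + D" "D - V z" "D - V z'" D "W z'" "W z"]
        a1p(2)[OF h(1)] a1p(2)[OF h(2)] a2 D h(3,4) unfolding e by (auto simp: add.commute)
    then show "V z' * (D - V z') * (W z)\<^sup>2 = V z * (D - V z) * (W z')\<^sup>2"
      "V z * V z' * (a2 + D)\<^sup>2 = a2\<^sup>2 * ((D - V z) * (D - V z'))" by (simp_all add: mult_ac)
  qed
  define top where "top z \<longleftrightarrow> z \<in> K \<and> (\<forall>z2\<in>K. V z2 = V z \<longrightarrow> W z2 \<le> W z)" for z
  define bot where "bot z \<longleftrightarrow> z \<in> K \<and> (\<forall>z2\<in>K. V z2 = V z \<longrightarrow> W z \<le> W z2)" for z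
  \<comment> \<open>\<open>f\<close> is the parameter of the conic of the pencil through
    \<open>z\<close>; in the coordinate \<open>u\<close> the symmetries are the inversions
    \<open>u\<close> to \<open>k1 / u\<close> and \<open>u\<close> to \<open>k2 / u\<close>.\<close>
  define f where "f z = V z * (D - V z) / (W z)\<^sup>2" for z
  define u where "u z = V z / (D - V z)" for z
  define k1 where "k1 = (a1 / (a1 - D))\<^sup>2"
  define k2 where "k2 = (a2 / (a2 + D))\<^sup>2"
  have flip1: "\<exists>z'. bot z' \<and> 0 < V z' \<and> V z' < D \<and> W z' < 0 \<and> f z' = f z \<and> u z * u z' = k1"
    if z: "top z" "0 < V z" "V z < D" "W z > 0" for z
  proof -
    have zK: "z \<in> K" using z by (simp add: top_def)
    obtain z' where z': "z' \<in> K" "W z' * (a1 - V z) = - (W z * (a1 - V z'))" "1 / (a1 - V z) + 1 / (a1 - V z') = 1 / a1 + 1 / (a1 - D)"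
      using sym1[OF zK] by blast
    note id = id1[OF zK z']
    have in': "0 < V z' \<and> V z' < D" by (rule two_factor_interior[OF id(2)]) (use z bd[OF z'(1)] a1 D in auto)
    have "W z' * (a1 - V z) < 0" using z'(2) z(4) a1p(1)[OF z'(1)] by simp
    then have neg: "W z' < 0" using a1p(1)[OF zK] by (simp add: mult_less_0_iff)
    have "f z' = f z" using id(1) z neg by (simp add: f_def field_simps)
    moreover have "u z * u z' = k1"
    proof -
      have "(D - V z) * (D - V z') \<noteq> 0" "(a1 - D)\<^sup>2 \<noteq> 0" using z in' a1 by auto
      then have "(V z * V z') / ((D - V z) * (D - V z')) = a1\<^sup>2 / (a1 - D)\<^sup>2"
        using id(2) frac_eq_eq by blast
      then show ?thesis by (simp only: u_def k1_def power_divide times_divide_times_eq)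
    qed
    moreover have "W z' \<le> W z2" if z2: "z2 \<in> K" "V z2 = V z'" for z2
    proof (rule slice_flip[where s="\<lambda>v. a1 - v", OF sym1 a1p(1) _ zK _ z' z2])
      show "W z2 \<le> W z" if "z2 \<in> K" "V z2 = V z" for z2 using z(1) that by (auto simp: top_def)
    qed auto
    ultimately show ?thesis using in' neg z'(1) by (auto simp: bot_def)
  qed
  have flip2: "\<exists>z'. top z' \<and> 0 < V z' \<and> V z' < D \<and> W z' > 0 \<and> f z' = f z \<and> u z * u z' = k2"
    if z: "bot z" "0 < V z" "V z < D" "W z < 0" for z
  proof -
    have zK: "z \<in> K" using z by (simp add: bot_def)
    obtain z' where z': "z' \<in> K" "W z' * (a2 + V z) = - (W z * (a2 + V z'))" "1 / (a2 + V z) + 1 / (a2 + V z') = 1 / a2 + 1 / (a2 + D)"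
      using sym2[OF zK] by blast
    note id = id2[OF zK z']
    have in': "0 < V z' \<and> V z' < D" by (rule two_factor_interior[OF id(2)]) (use z bd[OF z'(1)] a2 D in auto)
    have "W z * (a2 + V z') < 0" using z(4) a1p(2)[OF z'(1)] by (simp add: mult_neg_pos)
    then have "W z' * (a2 + V z) > 0" using z'(2) by simp
    then have neg: "W z' > 0" using a1p(2)[OF zK] by (simp add: zero_less_mult_iff)
    have "f z' = f z" using id(1) z neg by (simp add: f_def field_simps)
    moreover have "u z * u z' = k2"
    proof -
      have "(D - V z) * (D - V z') \<noteq> 0" "(a2 + D)\<^sup>2 \<noteq> 0" using z in' a2 D by auto
      then have "(V z * V z') / ((D - V z) * (D - V z')) = a2\<^sup>2 / (a2 + D)\<^sup>2"
        using id(2) frac_eq_eq by blast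
      then show ?thesis by (simp only: u_def k2_def power_divide times_divide_times_eq)
    qed
    moreover have "- W z' \<le> - W z2" if z2: "z2 \<in> K" "V z2 = V z'" for z2
    \<comment> \<open>With \<open>W\<close> negated, lowest points of slices become highest
      ones.\<close>
    proof (rule slice_flip[where s="\<lambda>v. a2 + v" and W="\<lambda>z. - W z", OF _ a1p(2) _ zK _ z'(1) _ z'(3) z2])
      show "\<exists>z'\<in>K. - W z' * (a2 + V z) = - (- W z * (a2 + V z')) \<and> 1 / (a2 + V z) + 1 / (a2 + V z') = 1 / a2 + 1 / (a2 + D)"
        if z: "z \<in> K" for z
      proof -
        obtain z' where z': "z' \<in> K" "W z' * (a2 + V z) = - (W z * (a2 + V z'))" "1 / (a2 + V z) + 1 / (a2 + V z') = 1 / a2 + 1 / (a2 + D)"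
          using sym2[OF z] by blast
        show ?thesis using z'(2,3) by (intro bexI[OF _ z'(1)]) simp
      qed
      show "- W z2 \<le> - W z" if "z2 \<in> K" "V z2 = V z" for z2 using z(1) that by (auto simp: bot_def)
      show "- W z' * (a2 + V z) = - (- W z * (a2 + V z'))" using z'(2) by simp
    qed auto
    ultimately show ?thesis using in' neg z'(1) by (auto simp: top_def)
  qed
  have k: "k1 > 1" "0 < k2" "k2 < 1" "k1 > 0"
  proof -
    have "a1 / (a1 - D) > 1" using a1 D by simp
    then show "k1 > 1" unfolding k1_def by (simp add: one_less_power)
    then show "k1 > 0" by simp
    have r: "0 < a2 / (a2 + D)" "a2 / (a2 + D) < 1" using a2 D by auto
    then show "0 < k2" unfolding k2_def by (intro zero_less_power)
    have "(a2 / (a2 + D))\<^sup>2 < 1\<^sup>2" using r by (intro power_strict_mono) auto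
    then show "k2 < 1" by (simp add: k2_def)
  qed
  \<comment> \<open>The two inversions compose to multiplication of \<open>u\<close> by this ratio.
    The tangents lie beyond opposite ends of the diameter, which makes \<open>k1 > 1\<close> and
    \<open>k2 < 1\<close>.\<close>
  define \<kappa> where "\<kappa> = k2 / k1"
  have \<kappa>: "0 < \<kappa>" "\<kappa> < 1" using k by (auto simp: \<kappa>_def)
  have iter: "\<exists>y. top y \<and> 0 < V y \<and> V y < D \<and> W y > 0 \<and> f y = f z \<and> u y = \<kappa> ^ j * u z"
    if z: "top z" "0 < V z" "V z < D" "W z > 0" for z j
  proof (induction j)
    case 0
    show ?case using z by auto
  next
    case (Suc j)
    then obtain y where y: "top y" "0 < V y" "V y < D" "W y > 0" "f y = f z" "u y = \<kappa> ^ j * u z" by blast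
    obtain y' where y': "bot y'" "0 < V y'" "V y' < D" "W y' < 0" "f y' = f y" "u y * u y' = k1"
      using flip1[OF y(1-4)] by blast
    obtain x where x: "top x" "0 < V x" "V x < D" "W x > 0" "f x = f y'" "u y' * u x = k2"
      using flip2[OF y'(1-4)] by blast
    have up: "u y > 0" using y(2,3) by (simp add: u_def)
    have "u y' \<noteq> 0" using y'(6) k by auto
    have "u x * k1 = u x * (u y * u y')" using y'(6) by simp
    also have "\<dots> = u y * k2" using x(6) by (simp add: mult_ac)
    finally have "u x = \<kappa> * u y" using k by (simp add: \<kappa>_def field_simps)
    then show ?case using x y y' by (auto simp: mult.assoc)
  qed
  have Wfr: "z \<in> frontier K" if z: "top z" for z
  proof -
    have zK: "z \<in> K" using z by (simp add: top_def)
    have "z \<notin> interior K"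
    proof
      assume "z \<in> interior K"
      then obtain e where e: "e > 0" "cball z e \<subseteq> K" by (auto simp: mem_interior_cball)
      have "norm (e *\<^sub>R (\<i> * n)) = e" using e(1) nt by (simp add: norm_mult)
      then have "z + e *\<^sub>R (\<i> * n) \<in> K" by (intro subsetD[OF e(2)]) (simp add: dist_norm)
      moreover have "V (z + e *\<^sub>R (\<i> * n)) = V z" "W (z + e *\<^sub>R (\<i> * n)) = W z + e"
        by (simp_all add: V_def W_def inner_add_right inner_diff_right n1 del: mult_scaleR_right)
      ultimately show False using z e(1) unfolding top_def by force
    qed
    then show ?thesis using zK closed_K by (simp add: frontier_def)
  qed
  obtain L where L: "finite L" "\<And>g z. (\<forall>k. z k \<in> frontier K \<and> z k \<noteq> Q \<and>
     (n \<bullet> (z k - Q)) * (D - n \<bullet> (z k - Q)) = g * ((\<i> * n) \<bullet> (z k - Q))\<^sup>2) \<Longrightarrow> z \<longlonglongrightarrow> Q \<Longrightarrow> g \<in> L"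
    using conic_parameter_finite[OF C n D, of Q] by blast
  have fL: "f z \<in> L" if z: "top z" "0 < V z" "V z < D" "W z > 0" for z
  proof -
    obtain Z where Z: "\<And>j. top (Z j)" "\<And>j. 0 < V (Z j)" "\<And>j. V (Z j) < D" "\<And>j. W (Z j) > 0" "\<And>j. f (Z j) = f z"
      "\<And>j. u (Z j) = \<kappa> ^ j * u z" using iter[OF z] by metis
    show ?thesis
    proof (rule L(2))
      show "\<forall>k. Z k \<in> frontier K \<and> Z k \<noteq> Q \<and>
        (n \<bullet> (Z k - Q)) * (D - n \<bullet> (Z k - Q)) = f z * ((\<i> * n) \<bullet> (Z k - Q))\<^sup>2"
      proof (intro allI conjI)
        fix k
        show "Z k \<in> frontier K" using Wfr Z(1) by blast
        show "Z k \<noteq> Q" using Z(2)[of k] by (auto simp: V_def)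
        have "V (Z k) * (D - V (Z k)) = f (Z k) * (W (Z k))\<^sup>2" using Z(4)[of k] by (simp add: f_def)
        then show "(n \<bullet> (Z k - Q)) * (D - n \<bullet> (Z k - Q)) = f z * ((\<i> * n) \<bullet> (Z k - Q))\<^sup>2"
          unfolding Z(5) by (simp add: V_def W_def)
      qed
      have "(\<lambda>j. \<kappa> ^ j * u z) \<longlonglongrightarrow> 0 * u z" by (intro tendsto_intros LIMSEQ_realpow_zero) (use \<kappa> in auto)
      then have u0: "(\<lambda>j. \<kappa> ^ j * u z) \<longlonglongrightarrow> 0" by simp
      have Vu: "V (Z j) \<le> D * (\<kappa> ^ j * u z)" for j
      proof -
        have "V (Z j) = u (Z j) * (D - V (Z j))" using Z(3)[of j] by (simp add: u_def)
        also have "\<dots> \<le> u (Z j) * D" using Z(2,3)[of j] by (intro mult_left_mono) (auto simp: u_def)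
        finally show ?thesis by (simp add: Z(6) mult.commute)
      qed
      have "(\<lambda>j. 2 * D * (D * (\<kappa> ^ j * u z))) \<longlonglongrightarrow> 2 * D * (D * 0)" by (intro tendsto_intros u0)
      then have lim: "(\<lambda>j. 2 * D * (D * (\<kappa> ^ j * u z))) \<longlonglongrightarrow> 0" by simp
      \<comment> \<open>By \<open>bd\<close> the body lies in the disc of radius \<open>D\<close>
        about the other end of the diameter, so points of \<open>K\<close> with \<open>V\<close>
        tending to 0 tend to \<open>Q\<close>.\<close>
      have "(norm (Z j - Q))\<^sup>2 \<le> 2 * D * (D * (\<kappa> ^ j * u z))" for j
      proof -
        have zj: "Z j \<in> K" using Z(1) by (simp add: top_def)
        have dd: "Z j - Q = V (Z j) *\<^sub>R n + W (Z j) *\<^sub>R (\<i> * n)" unfolding V_def W_def by (rule unit_decomp[OF n])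
        have "(norm (Z j - Q))\<^sup>2 = (Z j - Q) \<bullet> (V (Z j) *\<^sub>R n + W (Z j) *\<^sub>R (\<i> * n))"
          unfolding dd[symmetric] by (simp add: power2_norm_eq_inner)
        also have "\<dots> = V (Z j) * V (Z j) + W (Z j) * W (Z j)"
          by (simp add: V_def W_def inner_add_right inner_commute del: mult_scaleR_right)
        also have "\<dots> \<le> 2 * D * V (Z j)" using bd[OF zj] by (simp add: power2_eq_square algebra_simps)
        also have "\<dots> \<le> 2 * D * (D * (\<kappa> ^ j * u z))" using Vu[of j] D by simp
        finally show ?thesis .
      qed
      then have "(\<lambda>j. (norm (Z j - Q))\<^sup>2) \<longlonglongrightarrow> 0"
        by (intro tendsto_sandwich[OF _ _ tendsto_const lim]) (auto intro: always_eventually)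
      then have "(\<lambda>j. sqrt ((norm (Z j - Q))\<^sup>2)) \<longlonglongrightarrow> sqrt 0" by (rule tendsto_real_sqrt)
      then have "(\<lambda>j. norm (Z j - Q)) \<longlonglongrightarrow> 0" by simp
      then show "Z \<longlonglongrightarrow> Q" by (rule LIM_zero_cancel[OF tendsto_norm_zero_cancel])
    qed
  qed
  have contVW: "continuous_on K V" "continuous_on K W" unfolding V_def W_def by (intro continuous_intros)+
  have "\<exists>z. top z \<and> V z = v" if v: "0 \<le> v" "v \<le> D" for v
  proof -
    let ?S = "K \<inter> {z. V z = v}"
    have "closed {z. V z = v}" unfolding V_def by (intro closed_Collect_eq continuous_intros)
    then have "compact ?S" using compact_K compact_Int_closed by blast
    moreover have "?S \<noteq> {}" using axis[OF v] Vpt by blast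
    moreover have "continuous_on ?S W" using contVW continuous_on_subset by blast
    ultimately obtain z where "z \<in> ?S" "\<forall>y\<in>?S. W y \<le> W z" using continuous_attains_sup by metis
    then show ?thesis by (auto simp: top_def)
  qed
  then obtain tp where tp: "\<And>v. 0 \<le> v \<Longrightarrow> v \<le> D \<Longrightarrow> top (tp v) \<and> V (tp v) = v" by metis
  define om where "om v = W (tp v)" for v
  have om: "W z \<le> om (V z)" if "z \<in> K" for z
    using tp[of "V z"] bd[OF that] that by (auto simp: om_def top_def)
  have posW: "\<exists>z\<in>K. W z > 0"
  proof -
    obtain z where "z \<in> interior K" using interior_K by blast
    then obtain e where e: "e > 0" "cball z e \<subseteq> K" by (auto simp: mem_interior_cball)
    have "norm (e *\<^sub>R (\<i> * n)) = e" using e(1) nt by (simp add: norm_mult)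
    then have z2: "z + e *\<^sub>R (\<i> * n) \<in> K" by (intro subsetD[OF e(2)]) (simp add: dist_norm)
    have zK: "z \<in> K" using e by auto
    have "W (z + e *\<^sub>R (\<i> * n)) = W z + e"
      by (simp add: W_def inner_add_right inner_diff_right n1 del: mult_scaleR_right)
    then have "\<exists>x\<in>K. W x \<noteq> 0" using z2 zK e(1) by (cases "W z = 0") force+
    then obtain x where x: "x \<in> K" "W x \<noteq> 0" by blast
    show ?thesis
    proof (cases "W x > 0")
      case False
      then have neg: "W x < 0" using x by simp
      obtain x' where x': "x' \<in> K" "W x' * (a1 - V x) = - (W x * (a1 - V x'))" using sym1[OF x(1)] by blast
      have "W x * (a1 - V x') < 0" using neg a1p(1)[OF x'(1)] by (simp add: mult_neg_pos)
      then have "W x' * (a1 - V x) > 0" using x'(2) by simp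
      then have "W x' > 0" using a1p(1)[OF x(1)] by (simp add: zero_less_mult_iff)
      then show ?thesis using x' by blast
    qed (use x in blast)
  qed
  have ompos: "om v > 0" if v: "0 < v" "v < D" for v
  proof -
    obtain z where z: "z \<in> K" "W z > 0" using posW by blast
    have Vz: "0 < V z" "V z < D" using bd[OF z(1)] W0[OF z(1)] z(2) by (auto simp: less_le)
    have "\<exists>y\<in>K. V y = v \<and> W y > 0"
    proof (cases "v \<le> V z")
      case True
      let ?y = "(1 - v / V z) *\<^sub>R pt 0 0 + (v / V z) *\<^sub>R z"
      have "?y \<in> K" by (rule comb[OF p0(1) z(1)]) (use True v Vz in auto)
      moreover have "V ?y = v" "W ?y > 0" unfolding Vcomb Vpt using Vz v z by auto
      ultimately show ?thesis by blast
    next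
      case False
      define e where "e = (D - v) / (D - V z)"
      let ?y = "(1 - e) *\<^sub>R pt D 0 + e *\<^sub>R z"
      have "?y \<in> K" by (rule comb[OF p0(2) z(1)]) (use False v Vz in \<open>auto simp: e_def\<close>)
      moreover have "V ?y = D - e * (D - V z)" "W ?y = e * W z" unfolding Vcomb Vpt by (simp_all add: algebra_simps)
      moreover have "D - e * (D - V z) = v" "e * W z > 0" using Vz v z by (auto simp: e_def)
      ultimately show ?thesis by metis
    qed
    then show ?thesis using om by force
  qed
  have tpi: "top (tp v)" "V (tp v) = v" "tp v \<in> K" if "v \<in> {0<..<D}" for v
    using tp[of v] that by (auto simp: top_def)
  \<comment> \<open>The upper profile of a convex body is concave, hence continuous; as the conic
    parameter along it takes finitely many values, it is constant.\<close>
  have "convex_on {0<..<D} (\<lambda>v. - om v)"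
  proof (rule convex_onI)
    fix t x y :: real assume t: "0 < t" "t < 1" and xy: "x \<in> {0<..<D}" "y \<in> {0<..<D}"
    have "(1 - t) *\<^sub>R tp x + t *\<^sub>R tp y \<in> K" using comb tpi(3)[OF xy(1)] tpi(3)[OF xy(2)] t by simp
    from om[OF this] have "(1 - t) * om x + t * om y \<le> om ((1 - t) * x + t * y)"
      unfolding Vcomb tpi(2)[OF xy(1)] tpi(2)[OF xy(2)] by (simp add: om_def)
    then show "- om ((1 - t) *\<^sub>R x + t *\<^sub>R y) \<le> (1 - t) * - om x + t * - om y" by simp
  qed simp
  then have "continuous_on {0<..<D} (\<lambda>v. - om v)" by (rule convex_on_continuous[OF open_greaterThanLessThan])
  then have "continuous_on {0<..<D} (\<lambda>v. - (- om v))" by (rule continuous_on_minus)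
  then have contom: "continuous_on {0<..<D} om" by simp
  have fin: "(\<lambda>v. v * (D - v) / (om v)\<^sup>2) ` {0<..<D} \<subseteq> L"
  proof
    fix g assume "g \<in> (\<lambda>v. v * (D - v) / (om v)\<^sup>2) ` {0<..<D}"
    then obtain v where v: "v \<in> {0<..<D}" "g = v * (D - v) / (om v)\<^sup>2" by blast
    have "f (tp v) \<in> L" by (rule fL) (use tpi[OF v(1)] v ompos in \<open>auto simp: om_def\<close>)
    then show "g \<in> L" using v tpi(2)[OF v(1)] by (simp add: f_def om_def)
  qed
  have "(\<lambda>v. v * (D - v) / (om v)\<^sup>2) constant_on {0<..<D}"
  proof (rule continuous_finite_range_constant)
    show "continuous_on {0<..<D} (\<lambda>v. v * (D - v) / (om v)\<^sup>2)"
      using ompos by (intro continuous_intros contom) force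
    show "finite ((\<lambda>v. v * (D - v) / (om v)\<^sup>2) ` {0<..<D})" using fin L(1) finite_subset by blast
  qed auto
  then obtain c where c: "\<And>v. v \<in> {0<..<D} \<Longrightarrow> v * (D - v) / (om v)\<^sup>2 = c" unfolding constant_on_def by blast
  have cpos: "c > 0"
  proof -
    have "D / 2 \<in> {0<..<D}" using D by simp
    then show ?thesis using c[of "D / 2"] ompos[of "D / 2"] D by (metis divide_pos_pos greaterThanLessThan_iff diff_gt_0_iff_gt mult_pos_pos zero_less_power)
  qed
  have omc: "v * (D - v) = c * (om v)\<^sup>2" if "v \<in> {0<..<D}" for v
    using c[OF that] ompos[of v] that by (simp add: field_simps)
  have sq: "c * w\<^sup>2 \<le> v * (D - v)" if "v \<in> {0<..<D}" "0 \<le> w" "w \<le> om v" for v w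
    unfolding omc[OF that(1)] using cpos power_mono[OF that(3,2), of 2] by (intro mult_left_mono) auto
  \<comment> \<open>A point below the diameter is moved above it by the first symmetry, which
    preserves its conic.\<close>
  have dir1: "c * (W z)\<^sup>2 \<le> V z * (D - V z)" if z: "z \<in> K" for z
  proof (cases "V z \<in> {0<..<D}")
    case True
    show ?thesis
    proof (cases "W z \<ge> 0")
      case True
      then show ?thesis using sq[OF \<open>V z \<in> {0<..<D}\<close>] om[OF z] by blast
    next
      case False
      obtain z' where z': "z' \<in> K" "W z' * (a1 - V z) = - (W z * (a1 - V z'))" "1 / (a1 - V z) + 1 / (a1 - V z') = 1 / a1 + 1 / (a1 - D)"
        using sym1[OF z] by blast
      note id = id1[OF z z']
      have in': "0 < V z' \<and> V z' < D" by (rule two_factor_interior[OF id(2)]) (use True bd[OF z'(1)] a1 D in auto)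
      have "W z * (a1 - V z') < 0" using False a1p(1)[OF z'(1)] by (simp add: mult_neg_pos)
      then have "W z' * (a1 - V z) > 0" using z'(2) by simp
      then have W': "W z' > 0" using a1p(1)[OF z] by (simp add: zero_less_mult_iff)
      have "c * (W z')\<^sup>2 \<le> V z' * (D - V z')" using sq[of "V z'" "W z'"] in' W' om[OF z'(1)] by simp
      then have "(c * (W z')\<^sup>2) * (W z)\<^sup>2 \<le> V z' * (D - V z') * (W z)\<^sup>2" by (intro mult_right_mono) auto
      then have "(c * (W z)\<^sup>2) * (W z')\<^sup>2 \<le> (V z * (D - V z)) * (W z')\<^sup>2" unfolding id(1) by (simp add: mult_ac)
      then show ?thesis using W' by (simp add: mult_le_cancel_right)
    qed
  next
    case False
    then have "V z = 0 \<or> V z = D" using bd[OF z] by auto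
    then show ?thesis using W0[OF z] by auto
  qed
  have dir2: "z \<in> K" if z: "c * (W z)\<^sup>2 \<le> V z * (D - V z)" for z
  proof -
    have "c * (W z)\<^sup>2 \<ge> 0" using cpos by simp
    then have "V z * (D - V z) \<ge> 0" using z by linarith
    then have Vz: "0 \<le> V z" "V z \<le> D" using D by (auto simp: zero_le_mult_iff)
    show ?thesis
    proof (cases "V z \<in> {0<..<D}")
      case False
      then have "V z * (D - V z) = 0" using Vz by auto
      then have "c * (W z)\<^sup>2 \<le> 0" using z by linarith
      then have "W z = 0" using cpos by (simp add: mult_le_0_iff)
      then show ?thesis using axis[OF Vz] ptV[of z] by simp
    next
      case True
      define v where "v = V z"
      have v: "v \<in> {0<..<D}" using True by (simp add: v_def)
      have "c * (W z)\<^sup>2 \<le> c * (om v)\<^sup>2" using z omc[OF v] by (simp add: v_def)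
      then have "(W z)\<^sup>2 \<le> (om v)\<^sup>2" using cpos by simp
      then have Wz: "\<bar>W z\<bar> \<le> om v" using ompos[of v] v by (simp add: abs_le_square_iff[symmetric])
      have t: "pt v (om v) \<in> K" using tpi[OF v] ptV[of "tp v"] by (simp add: om_def)
      \<comment> \<open>The lower end of the slice at \<open>v\<close> is the image of the top of a
        partner slice, whose level is that of the image of \<open>pt v 0\<close>.\<close>
      have b: "pt v (- om v) \<in> K"
      proof -
        obtain z1 where z1: "z1 \<in> K" "1 / (a1 - V (pt v 0)) + 1 / (a1 - V z1) = 1 / a1 + 1 / (a1 - D)"
            "W z1 * (a1 - V (pt v 0)) = - (W (pt v 0) * (a1 - V z1))"
          using sym1[OF axis[of v]] v by auto
        have "0 < V z1 \<and> V z1 < D"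
          by (rule two_factor_interior[OF id1(2)[OF axis[of v] z1(1,3,2)]]) (use v bd[OF z1(1)] a1 D Vpt in auto)
        then have v1: "V z1 \<in> {0<..<D}" by simp
        define y where "y = tp (V z1)"
        have y: "y \<in> K" "V y = V z1" "W y = om (V z1)" using tpi[OF v1] by (auto simp: y_def om_def)
        obtain x where x: "x \<in> K" "W x * (a1 - V y) = - (W y * (a1 - V x))" "1 / (a1 - V y) + 1 / (a1 - V x) = 1 / a1 + 1 / (a1 - D)"
          using sym1[OF y(1)] by blast
        have "1 / (a1 - V x) = 1 / (a1 - v)"
          using x(3)[unfolded y(2)] z1(2)[unfolded Vpt] by linarith
        then have Vx: "V x = v" by simp
        have "V x * (D - V x) * (W y)\<^sup>2 = V y * (D - V y) * (W x)\<^sup>2" by (rule id1(1)[OF y(1) x])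
        then have "(c * (om v)\<^sup>2) * (W y)\<^sup>2 = (c * (W y)\<^sup>2) * (W x)\<^sup>2"
          unfolding Vx y(2) omc[OF v] omc[OF v1] by (simp add: y(3))
        moreover have Wy: "W y > 0" using y(3) ompos v1 by simp
        ultimately have "(W x)\<^sup>2 = (om v)\<^sup>2" using cpos by simp
        moreover have "W x < 0"
        proof -
          have "W y * (a1 - V x) > 0" using Wy a1p(1)[OF x(1)] by simp
          then have "W x * (a1 - V y) < 0" using x(2) by simp
          then show ?thesis using a1p(1)[OF y(1)] by (simp add: mult_less_0_iff)
        qed
        ultimately have "W x = - om v" using ompos[of v] v by (auto simp: power2_eq_iff)
        then show ?thesis using x(1) Vx ptV[of x] by simp
      qed
      have "pt v (W z) \<in> K" by (rule between[OF b t]) (use Wz in auto)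
      then show ?thesis using ptV[of z] by (simp add: v_def)
    qed
  qed
  show ?thesis using cpos dir1 dir2 by blast
qed

section \<open>Ellipses in axis coordinates and by foci\<close>

lemma coordinates_norm:
  fixes n z :: complex
  assumes "norm n = 1"
  shows "(norm z)\<^sup>2 = (n \<bullet> z)\<^sup>2 + ((\<i> * n) \<bullet> z)\<^sup>2"
proof -
  have "(norm z)\<^sup>2 = z \<bullet> ((n \<bullet> z) *\<^sub>R n + ((\<i> * n) \<bullet> z) *\<^sub>R (\<i> * n))"
    using unit_decomp[OF assms, of z] by (simp add: power2_norm_eq_inner del: mult_scaleR_right)
  then show ?thesis
    by (simp add: inner_add_right inner_commute power2_eq_square del: mult_scaleR_right)
qed

text \<open>Squaring twice: the inequality becomes \<open>p * q \<le> M\<close>, and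
  \<open>M\<^sup>2 - (p * q)\<^sup>2\<close> is four times the slack of the quadratic inequality.
  Undoing the second squaring requires \<open>M \<ge> 0\<close>, where \<open>B \<le> A\<close>
  enters.\<close>

lemma focal_disc_coordinates:
  fixes n c z :: complex
  assumes n: "norm n = 1" and AB: "0 < B" "B \<le> A" and f: "f\<^sup>2 = A\<^sup>2 - B\<^sup>2"
  shows "norm (z - (c + f *\<^sub>R n)) + norm (z - (c - f *\<^sub>R n)) \<le> 2 * A \<longleftrightarrow>
    B\<^sup>2 * (n \<bullet> (z - c))\<^sup>2 + A\<^sup>2 * ((\<i> * n) \<bullet> (z - c))\<^sup>2 \<le> A\<^sup>2 * B\<^sup>2"
proof -
  define v where "v = n \<bullet> (z - c)"
  define w where "w = (\<i> * n) \<bullet> (z - c)"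
  define p where "p = norm (z - (c + f *\<^sub>R n))"
  define q where "q = norm (z - (c - f *\<^sub>R n))"
  have nn: "n \<bullet> n = 1" "(\<i> * n) \<bullet> n = 0" using inner_unit[OF n] by (simp_all add: inner_complex_def)
  have p2: "p\<^sup>2 = (v - f)\<^sup>2 + w\<^sup>2"
    unfolding p_def coordinates_norm[OF n] by (simp add: v_def w_def inner_diff_right inner_add_right nn algebra_simps)
  have q2: "q\<^sup>2 = (v + f)\<^sup>2 + w\<^sup>2"
    unfolding q_def coordinates_norm[OF n] by (simp add: v_def w_def inner_diff_right inner_add_right nn algebra_simps)
  have pq0: "p \<ge> 0" "q \<ge> 0" by (simp_all add: p_def q_def)
  define M where "M = 2 * A\<^sup>2 - (v\<^sup>2 + w\<^sup>2 + f\<^sup>2)"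
  have id: "M\<^sup>2 - (p * q)\<^sup>2 = 4 * (A\<^sup>2 * B\<^sup>2 - (B\<^sup>2 * v\<^sup>2 + A\<^sup>2 * w\<^sup>2))"
  proof -
    have b: "B\<^sup>2 = A\<^sup>2 - f\<^sup>2" using f by simp
    show ?thesis unfolding power_mult_distrib p2 q2 M_def b by (simp add: power2_eq_square algebra_simps)
  qed
  have sq_iff: "(p * q)\<^sup>2 \<le> M\<^sup>2 \<longleftrightarrow> B\<^sup>2 * v\<^sup>2 + A\<^sup>2 * w\<^sup>2 \<le> A\<^sup>2 * B\<^sup>2"
  proof -
    have "P \<le> N \<longleftrightarrow> L \<le> R" if "N - P = 4 * (R - L)" for L N P R :: real using that by auto
    from this[OF id] show ?thesis .
  qed
  have sumsq: "(p + q)\<^sup>2 = 2 * (v\<^sup>2 + w\<^sup>2 + f\<^sup>2) + 2 * (p * q)"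
    using p2 q2 by (simp add: power2_eq_square algebra_simps)
  have A: "A > 0" using AB by simp
  have "p + q \<le> 2 * A \<longleftrightarrow> (p + q)\<^sup>2 \<le> (2 * A)\<^sup>2"
    using pq0 A abs_le_square_iff[of "p + q" "2 * A"] by simp
  also have "\<dots> \<longleftrightarrow> p * q \<le> M"
  proof -
    have 1: "(2 * A)\<^sup>2 = 4 * A\<^sup>2" by (simp add: power_mult_distrib)
    have 2: "2 * S + 2 * r \<le> 4 * T \<longleftrightarrow> r \<le> 2 * T - S" for S r T :: real by auto
    show ?thesis unfolding sumsq M_def 1 by (rule 2)
  qed
  also have "\<dots> \<longleftrightarrow> B\<^sup>2 * v\<^sup>2 + A\<^sup>2 * w\<^sup>2 \<le> A\<^sup>2 * B\<^sup>2"
  proof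
    assume "p * q \<le> M"
    then have "(p * q)\<^sup>2 \<le> M\<^sup>2" using pq0 by (intro power_mono) auto
    then show "B\<^sup>2 * v\<^sup>2 + A\<^sup>2 * w\<^sup>2 \<le> A\<^sup>2 * B\<^sup>2" using sq_iff by blast
  next
    assume le: "B\<^sup>2 * v\<^sup>2 + A\<^sup>2 * w\<^sup>2 \<le> A\<^sup>2 * B\<^sup>2"
    then have sq: "(p * q)\<^sup>2 \<le> M\<^sup>2" using sq_iff by blast
    have "B\<^sup>2 \<le> A\<^sup>2" using AB by (intro power_mono) auto
    then have "B\<^sup>2 * w\<^sup>2 \<le> A\<^sup>2 * w\<^sup>2" by (intro mult_right_mono) auto
    then have "B\<^sup>2 * (v\<^sup>2 + w\<^sup>2) \<le> B\<^sup>2 * A\<^sup>2" using le by (simp add: algebra_simps)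
    then have "v\<^sup>2 + w\<^sup>2 \<le> A\<^sup>2" using AB(1) by simp
    moreover have "f\<^sup>2 \<le> A\<^sup>2" using f by simp
    ultimately have "M \<ge> 0" by (simp add: M_def)
    then show "p * q \<le> M" using sq power2_le_imp_le by blast
  qed
  finally show ?thesis by (simp add: p_def q_def v_def w_def)
qed

text \<open>The assumption makes the slopes \<open>t1 / n1\<close> and \<open>t2 / n2\<close>
  opposite, so the unit vectors towards the point from the foci have opposite tangential components:
  the tangential derivative of the focal sum vanishes.\<close>

lemma bisector_focal_gradient:
  fixes t1 t2 n1 n2 :: real
  assumes "t1 * n2 + n1 * t2 = 0" "n1 > 0" "n2 > 0"
  shows "t1 / sqrt (n1\<^sup>2 + t1\<^sup>2) + t2 / sqrt (n2\<^sup>2 + t2\<^sup>2) = 0"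
proof -
  define k where "k = t1 / n1"
  have t: "t1 = n1 * k" "t2 = n2 * (- k)" using assms by (simp_all add: k_def field_simps)
  have "sqrt (n1\<^sup>2 + t1\<^sup>2) = n1 * sqrt (1 + k\<^sup>2)"
  proof -
    have "n1\<^sup>2 + t1\<^sup>2 = n1\<^sup>2 * (1 + k\<^sup>2)" unfolding t by (simp add: power2_eq_square algebra_simps)
    then show ?thesis using assms by (simp add: real_sqrt_mult)
  qed
  moreover have "sqrt (n2\<^sup>2 + t2\<^sup>2) = n2 * sqrt (1 + k\<^sup>2)"
  proof -
    have "n2\<^sup>2 + t2\<^sup>2 = n2\<^sup>2 * (1 + k\<^sup>2)" unfolding t by (simp add: power2_eq_square algebra_simps)
    then show ?thesis using assms by (simp add: real_sqrt_mult)
  qed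
  ultimately show ?thesis using t assms(2,3) by simp
qed

section \<open>The inner ellipse and the confocal outer one\<close>

context commuting_billiards
begin

text \<open>At a maximiser of \<open>n \<bullet> z\<close> over \<Omega>2 the vector
  \<open>n\<close> is a support normal, by smoothness the only one.\<close>

lemma extreme_boundary_point:
  assumes "norm n = 1"
  shows "\<exists>y\<in>frontier \<Omega>2. normal \<Omega>2 y = n"
proof -
  have "\<Omega>2 \<noteq> {}" using B.interior_K interior_subset by blast
  moreover have "continuous_on \<Omega>2 (\<lambda>z. n \<bullet> z)" by (intro continuous_intros)
  ultimately obtain y where y: "y \<in> \<Omega>2" "\<And>z. z \<in> \<Omega>2 \<Longrightarrow> n \<bullet> z \<le> n \<bullet> y"
    using continuous_attains_sup[OF B.compact_K] by metis
  then have n: "n \<in> support_normals \<Omega>2 y" using assms by (simp add: support_normals_iff inner_diff_right)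
  then have "y \<notin> interior \<Omega>2" using B.support_normals_interior by fastforce
  then have yf: "y \<in> frontier \<Omega>2" using y(1) B.closed_K by (simp add: frontier_def)
  then have "normal \<Omega>2 y = n" using B_normal[OF yf] n by auto
  then show ?thesis using yf by blast
qed

lemma inner_ellipse:
  assumes C: "piecewise_Ck_Jordan 4 (frontier \<Omega>1)"
  shows "\<exists>c n A B. norm n = 1 \<and> 0 < B \<and> B \<le> A \<and>
    \<Omega>1 = {z. B\<^sup>2 * (n \<bullet> (z - c))\<^sup>2 + A\<^sup>2 * ((\<i> * n) \<bullet> (z - c))\<^sup>2 \<le> A\<^sup>2 * B\<^sup>2}"
proof -
  text \<open>Take a diameter \<open>QP\<close> of \<open>\<Omega>1\<close> and the two points of the outer boundary whose tangent lines
    are perpendicular to it.\<close>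
  have A0: "\<Omega>1 \<noteq> {}" using A.interior_K interior_subset by blast
  have "continuous_on (\<Omega>1 \<times> \<Omega>1) (\<lambda>x. norm (fst x - snd x))" by (intro continuous_intros)
  moreover have "\<Omega>1 \<times> \<Omega>1 \<noteq> {}" using A0 by blast
  ultimately have "\<exists>x\<in>\<Omega>1 \<times> \<Omega>1. \<forall>y\<in>\<Omega>1 \<times> \<Omega>1. norm (fst y - snd y) \<le> norm (fst x - snd x)"
    by (intro continuous_attains_sup compact_Times A.compact_K)
  then
  obtain x0 where x0: "x0 \<in> \<Omega>1 \<times> \<Omega>1" "\<forall>x\<in>\<Omega>1 \<times> \<Omega>1. norm (fst x - snd x) \<le> norm (fst x0 - snd x0)"
    by blast
  obtain P Q where x0PQ: "x0 = (P, Q)" by (cases x0)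
  have PQ: "P \<in> \<Omega>1" "Q \<in> \<Omega>1" "\<And>x y. x \<in> \<Omega>1 \<Longrightarrow> y \<in> \<Omega>1 \<Longrightarrow> norm (x - y) \<le> norm (P - Q)"
    using x0 unfolding x0PQ by auto
  define D where "D = norm (P - Q)"
  have D: "D > 0"
  proof -
    obtain z where "z \<in> interior \<Omega>1" using A.interior_K by blast
    then obtain e where e: "e > 0" "cball z e \<subseteq> \<Omega>1" by (auto simp: mem_interior_cball)
    then have "z \<in> \<Omega>1" "z + of_real e \<in> \<Omega>1" by (auto intro!: subsetD[OF e(2)] simp: dist_norm)
    from PQ(3)[OF this(2,1)] have "norm (of_real e :: complex) \<le> D" by (simp add: D_def)
    then show ?thesis using e(1) by simp
  qed
  define n where "n = (1 / D) *\<^sub>R (P - Q)"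
  have nn: "norm n = 1" using D by (simp add: n_def D_def)
  define \<tau> where "\<tau> = \<i> * n"
  have P: "P = Q + D *\<^sub>R n" using D by (simp add: n_def)
  have n1: "n \<bullet> n = 1" "n \<bullet> \<tau> = 0" "\<tau> \<bullet> n = 0" using inner_unit[OF nn] by (simp_all add: \<tau>_def inner_complex_def)
  define V where "V z = n \<bullet> (z - Q)" for z
  define W where "W z = \<tau> \<bullet> (z - Q)" for z
  have VPQ: "V P = D" "W P = 0" "V Q = 0" "W Q = 0" unfolding V_def W_def P using n1 by simp_all
  have nQ: "(norm (z - Q))\<^sup>2 = (V z)\<^sup>2 + (W z)\<^sup>2" for z
    unfolding coordinates_norm[OF nn] V_def W_def \<tau>_def ..
  have nP: "(norm (z - P))\<^sup>2 = (V z - D)\<^sup>2 + (W z)\<^sup>2" for z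
    unfolding coordinates_norm[OF nn] V_def W_def \<tau>_def[symmetric] P by (simp add: inner_diff_right inner_add_right n1 diff_diff_eq)
  \<comment> \<open>A diameter confines \<Omega>1 to the two discs of radius \<open>D\<close> about
    its ends.\<close>
  have bd: "0 \<le> V z \<and> V z \<le> D \<and> (W z)\<^sup>2 \<le> V z * (2 * D - V z) \<and> (V z = D \<longrightarrow> W z = 0)" if z: "z \<in> \<Omega>1" for z
  proof -
    have "(norm (z - Q))\<^sup>2 \<le> D\<^sup>2" "(norm (z - P))\<^sup>2 \<le> D\<^sup>2"
      using PQ(3)[OF z PQ(2)] PQ(3)[OF z PQ(1)] by (auto simp: D_def intro!: power_mono)
    then have 1: "(V z)\<^sup>2 + (W z)\<^sup>2 \<le> D\<^sup>2" "(V z - D)\<^sup>2 + (W z)\<^sup>2 \<le> D\<^sup>2" unfolding nQ nP by auto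
    have "(V z)\<^sup>2 \<le> D\<^sup>2" "(V z - D)\<^sup>2 \<le> D\<^sup>2" using 1 zero_le_power2[of "W z"] by linarith+
    then have "\<bar>V z\<bar> \<le> D" "\<bar>V z - D\<bar> \<le> D" using D abs_le_square_iff[of _ D] by auto
    moreover have "(W z)\<^sup>2 \<le> V z * (2 * D - V z)" using 1(2) by (simp add: power2_eq_square algebra_simps)
    moreover have "V z = D \<longrightarrow> W z = 0" using 1(1) by auto
    ultimately show ?thesis by linarith
  qed
  have W0: "W z = 0" if "z \<in> \<Omega>1" "V z = 0" for z using bd[OF that(1)] that(2) by simp
  obtain y1 where y1: "y1 \<in> frontier \<Omega>2" "normal \<Omega>2 y1 = n" using extreme_boundary_point[OF nn] by blast
  obtain y2 where y2: "y2 \<in> frontier \<Omega>2" "normal \<Omega>2 y2 = - n" using extreme_boundary_point[of "- n"] nn by auto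
  \<comment> \<open>Distances from \<open>Q\<close> to the two tangents perpendicular to the
    diameter, beyond \<open>P\<close> and beyond \<open>Q\<close>.\<close>
  define a1 where "a1 = n \<bullet> (y1 - Q)"
  define a2 where "a2 = n \<bullet> (Q - y2)"
  have l1: "n \<bullet> (y1 - z) = a1 - V z" for z by (simp add: a1_def V_def inner_diff_right)
  have l2: "(- n) \<bullet> (y2 - z) = a2 + V z" for z by (simp add: a2_def V_def inner_diff_right)
  have p1: "a1 - V z > 0" if "z \<in> \<Omega>1" for z
    using inward[OF B.normal_in[OF y1(1)] that] l1[of z] y1(2) by (simp add: inner_diff_right)
  have p2: "a2 + V z > 0" if "z \<in> \<Omega>1" for z
    using inward[OF B.normal_in[OF y2(1)] that] l2[of z] y2(2) by (simp add: inner_diff_right)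
  have a1: "a1 > D" using p1[OF PQ(1)] VPQ by simp
  have a2: "a2 > 0" using p2[OF PQ(2)] VPQ by simp
  obtain K1 where K1: "\<And>z. z \<in> \<Omega>1 \<Longrightarrow> \<exists>z'\<in>\<Omega>1. (\<tau> \<bullet> (z' - y1)) / (a1 - V z') = - ((\<tau> \<bullet> (z - y1)) / (a1 - V z))
      \<and> 1 / (a1 - V z) + 1 / (a1 - V z') = K1"
    using projective_symmetry[OF y1(1)] unfolding y1(2) \<tau>_def[symmetric] l1 by blast
  obtain K2 where K2: "\<And>z. z \<in> \<Omega>1 \<Longrightarrow> \<exists>z'\<in>\<Omega>1. ((\<i> * (- n)) \<bullet> (z' - y2)) / (a2 + V z') = - (((\<i> * (- n)) \<bullet> (z - y2)) / (a2 + V z))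
      \<and> 1 / (a2 + V z) + 1 / (a2 + V z') = K2"
    using projective_symmetry[OF y2(1)] unfolding y2(2) l2 by blast
  define w1 where "w1 = \<tau> \<bullet> (y1 - Q)"
  define w2 where "w2 = \<tau> \<bullet> (y2 - Q)"
  have e1: "\<tau> \<bullet> (z - y1) = W z - w1" for z by (simp add: W_def w1_def inner_diff_right)
  have e2: "(\<i> * (- n)) \<bullet> (z - y2) = - (W z - w2)" for z
    unfolding W_def w2_def \<tau>_def by (simp add: inner_diff_right)
  \<comment> \<open>The symmetry exchanges the ends of the diameter. This determines its constant
    and puts the point of tangency on the line of the diameter.\<close>
  have r1: "K1 = 1 / (a1 - 0) + 1 / (a1 - D) \<and> w1 = 0"
  proof (rule diameter_slices[where s="\<lambda>v. a1 - v" and V=V and W=W and K=\<Omega>1, OF D PQ(1) VPQ(1) PQ(2) VPQ(3,2) W0])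
    show "\<exists>z'\<in>\<Omega>1. (W z' - w1) / (a1 - V z') = - ((W z - w1) / (a1 - V z)) \<and> 1 / (a1 - V z) + 1 / (a1 - V z') = K1"
      if "z \<in> \<Omega>1" for z using K1[OF that] unfolding e1 .
  qed (use a1 bd in auto)
  have r2: "K2 = 1 / (a2 + 0) + 1 / (a2 + D) \<and> w2 = 0"
  proof (rule diameter_slices[where s="\<lambda>v. a2 + v" and V=V and W=W and K=\<Omega>1, OF D PQ(1) VPQ(1) PQ(2) VPQ(3,2) W0])
    show "\<exists>z'\<in>\<Omega>1. (W z' - w2) / (a2 + V z') = - ((W z - w2) / (a2 + V z)) \<and> 1 / (a2 + V z) + 1 / (a2 + V z') = K2"
      if "z \<in> \<Omega>1" for z using K2[OF that] unfolding e2
      by (simp only: minus_divide_left[symmetric] neg_equal_iff_equal)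
  qed (use a2 bd in auto)
  have s1: "\<exists>z'\<in>\<Omega>1. W z' * (a1 - V z) = - (W z * (a1 - V z')) \<and> 1 / (a1 - V z) + 1 / (a1 - V z') = 1 / a1 + 1 / (a1 - D)"
    if z: "z \<in> \<Omega>1" for z
  proof -
    obtain z' where z': "z' \<in> \<Omega>1" "W z' / (a1 - V z') = - (W z / (a1 - V z))" "1 / (a1 - V z) + 1 / (a1 - V z') = K1"
      using K1[OF z] unfolding e1 using r1 by auto
    then show ?thesis using p1[OF z] p1[OF z'(1)] r1 by (intro bexI[OF _ z'(1)]) (auto simp: field_simps)
  qed
  have s2: "\<exists>z'\<in>\<Omega>1. W z' * (a2 + V z) = - (W z * (a2 + V z')) \<and> 1 / (a2 + V z) + 1 / (a2 + V z') = 1 / a2 + 1 / (a2 + D)"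
    if z: "z \<in> \<Omega>1" for z
  proof -
    obtain z' where z': "z' \<in> \<Omega>1" "W z' / (a2 + V z') = - (W z / (a2 + V z))" "1 / (a2 + V z) + 1 / (a2 + V z') = K2"
      using K2[OF z] unfolding e2 using r2 by auto
    then show ?thesis using p2[OF z] p2[OF z'(1)] r2 by (intro bexI[OF _ z'(1)]) (auto simp: field_simps)
  qed
  have QD: "Q + D *\<^sub>R n \<in> \<Omega>1" using PQ(1) P by simp
  have "\<exists>c>0. \<forall>z. z \<in> \<Omega>1 \<longleftrightarrow> c * (W z)\<^sup>2 \<le> V z * (D - V z)"
    unfolding V_def W_def \<tau>_def
    by (rule A.ellipse_of_projective_symmetries[OF C nn D a1 a2 PQ(2) QD];
        (rule bd[unfolded V_def W_def \<tau>_def] s1[unfolded V_def W_def \<tau>_def] s2[unfolded V_def W_def \<tau>_def]))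
  then obtain c where c: "c > 0" "\<And>z. z \<in> \<Omega>1 \<longleftrightarrow> c * (W z)\<^sup>2 \<le> V z * (D - V z)"
    by blast
  \<comment> \<open>Centred at the midpoint of the diameter, the inequality describes an ellipse
    with semi-axis \<open>D / 2\<close> along it and \<open>D / (2 * sqrt c)\<close> across
    it.\<close>
  define A where "A = D / 2"
  define B where "B = A / sqrt c"
  have A: "A > 0" using D by (simp add: A_def)
  have B: "B > 0" using A c(1) by (simp add: B_def)
  have B2: "c * B\<^sup>2 = A\<^sup>2" using c(1) by (simp add: B_def power_divide)
  define ctr where "ctr = Q + A *\<^sub>R n"
  have cO: "n \<bullet> (z - ctr) = V z - A" "\<tau> \<bullet> (z - ctr) = W z" for z
    by (simp_all add: ctr_def V_def W_def inner_diff_right inner_add_right n1)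
  have iff: "z \<in> \<Omega>1 \<longleftrightarrow> B\<^sup>2 * (n \<bullet> (z - ctr))\<^sup>2 + A\<^sup>2 * (\<tau> \<bullet> (z - ctr))\<^sup>2 \<le> A\<^sup>2 * B\<^sup>2" for z
  proof -
    have "z \<in> \<Omega>1 \<longleftrightarrow> B\<^sup>2 * (c * (W z)\<^sup>2) \<le> B\<^sup>2 * (V z * (D - V z))" unfolding c(2) using B by simp
    also have "B\<^sup>2 * (c * (W z)\<^sup>2) = A\<^sup>2 * (W z)\<^sup>2" by (simp add: B2[symmetric])
    also have "B\<^sup>2 * (V z * (D - V z)) = A\<^sup>2 * B\<^sup>2 - B\<^sup>2 * (V z - A)\<^sup>2"
      by (simp add: A_def power2_eq_square algebra_simps)
    finally show ?thesis unfolding cO by (simp add: algebra_simps)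
  qed
  \<comment> \<open>The chord across the ellipse has length \<open>2 * B\<close> and cannot exceed
    the diameter.\<close>
  have BA: "B \<le> A"
  proof -
    have tt: "\<tau> \<bullet> \<tau> = 1" using inner_unit[of \<tau>] nn by (simp add: \<tau>_def norm_mult)
    have "ctr + B *\<^sub>R \<tau> \<in> \<Omega>1" "ctr - B *\<^sub>R \<tau> \<in> \<Omega>1" unfolding iff by (simp_all add: n1 tt)
    then have "norm ((ctr + B *\<^sub>R \<tau>) - (ctr - B *\<^sub>R \<tau>)) \<le> D" unfolding D_def by (rule PQ(3))
    moreover have "(ctr + B *\<^sub>R \<tau>) - (ctr - B *\<^sub>R \<tau>) = (2 * B) *\<^sub>R \<tau>" by (simp add: complex_eq_iff)
    moreover have "norm \<tau> = 1" using nn by (simp add: \<tau>_def norm_mult)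
    ultimately show ?thesis using B by (simp add: A_def)
  qed
  show ?thesis using nn B BA iff unfolding \<tau>_def by blast
qed

text \<open>The two tangent lines from \<open>y\<close> to the inner ellipse are exchanged by the reflection in the
  normal at \<open>y\<close>; equivalently that normal bisects the angle under which the foci are seen.\<close>

lemma outer_normal_bisects_foci:
  assumes n0: "norm n0 = 1" and AB: "0 < B" "B \<le> A" and f: "f\<^sup>2 = A\<^sup>2 - B\<^sup>2"
    and \<Omega>1: "\<Omega>1 = {z. B\<^sup>2 * (n0 \<bullet> (z - c))\<^sup>2 + A\<^sup>2 * ((\<i> * n0) \<bullet> (z - c))\<^sup>2 \<le> A\<^sup>2 * B\<^sup>2}"
    and y: "y \<in> frontier \<Omega>2"
  defines "n \<equiv> normal \<Omega>2 y" and "v1 \<equiv> y - (c + f *\<^sub>R n0)" and "v2 \<equiv> y - (c - f *\<^sub>R n0)"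
  shows "((\<i> * n) \<bullet> v1) * (n \<bullet> v2) + (n \<bullet> v1) * ((\<i> * n) \<bullet> v2) = 0"
proof -
  have nn: "norm n = 1" using norm_normal_B[OF y] by (simp add: n_def)
  have sn: "support_normals \<Omega>2 y = {n}" using B_normal[OF y] by (simp add: n_def)
  define p where "p = n0 \<bullet> n"
  define q where "q = (\<i> * n0) \<bullet> n"
  define Y1 where "Y1 = n0 \<bullet> (y - c)"
  define Y2 where "Y2 = (\<i> * n0) \<bullet> (y - c)"
  define \<tau> where "\<tau> = \<i> * n"
  have pq: "p\<^sup>2 + q\<^sup>2 = 1" using coordinates_norm[OF n0, of n] nn by (simp add: p_def q_def)
  have tau: "n0 \<bullet> \<tau> = - q" "(\<i> * n0) \<bullet> \<tau> = p"
    by (simp_all add: \<tau>_def p_def q_def inner_complex_def)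
  have A: "A > 0" using AB by simp
  \<comment> \<open>Up to the factor \<open>A\<^sup>2 * B\<^sup>2\<close>, a quarter of the
    discriminant of the ellipse equation on the line through \<open>y\<close> with direction
    \<open>n + \<beta> *\<^sub>R \<tau>\<close>; its sign tells whether that line meets
    \<Omega>1.\<close>
  define DD where "DD \<beta> = B\<^sup>2 * (p - \<beta> * q)\<^sup>2 + A\<^sup>2 * (q + \<beta> * p)\<^sup>2 - ((p - \<beta> * q) * Y2 - (q + \<beta> * p) * Y1)\<^sup>2" for \<beta>
  have gen: "(\<exists>t. y + t *\<^sub>R e \<in> \<Omega>1) \<longleftrightarrow> B\<^sup>2 * e1\<^sup>2 + A\<^sup>2 * e2\<^sup>2 - (e1 * Y2 - e2 * Y1)\<^sup>2 \<ge> 0"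
    if e: "e1 = n0 \<bullet> e" "e2 = (\<i> * n0) \<bullet> e" "e1 \<noteq> 0 \<or> e2 \<noteq> 0" for e e1 e2
  proof -
    define a where "a = B\<^sup>2 * e1\<^sup>2 + A\<^sup>2 * e2\<^sup>2"
    define b where "b = B\<^sup>2 * (Y1 * e1) + A\<^sup>2 * (Y2 * e2)"
    define g where "g = B\<^sup>2 * Y1\<^sup>2 + A\<^sup>2 * Y2\<^sup>2 - A\<^sup>2 * B\<^sup>2"
    have a: "a > 0" using e(3) AB A unfolding a_def by (auto intro: add_pos_nonneg add_nonneg_pos)
    have "y + t *\<^sub>R e \<in> \<Omega>1 \<longleftrightarrow> a * t\<^sup>2 + 2 * b * t + g \<le> 0" for t
    proof -
      have "n0 \<bullet> (y + t *\<^sub>R e - c) = Y1 + t * e1" "(\<i> * n0) \<bullet> (y + t *\<^sub>R e - c) = Y2 + t * e2"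
        unfolding e Y1_def Y2_def by (simp_all add: inner_diff_right inner_add_right)
      then have "y + t *\<^sub>R e \<in> \<Omega>1 \<longleftrightarrow> B\<^sup>2 * (Y1 + t * e1)\<^sup>2 + A\<^sup>2 * (Y2 + t * e2)\<^sup>2 - A\<^sup>2 * B\<^sup>2 \<le> 0"
        unfolding \<Omega>1 by simp
      also have "B\<^sup>2 * (Y1 + t * e1)\<^sup>2 + A\<^sup>2 * (Y2 + t * e2)\<^sup>2 - A\<^sup>2 * B\<^sup>2 = a * t\<^sup>2 + 2 * b * t + g"
        by (simp add: a_def b_def g_def power2_eq_square algebra_simps)
      finally show ?thesis .
    qed
    then have "(\<exists>t. y + t *\<^sub>R e \<in> \<Omega>1) \<longleftrightarrow> b\<^sup>2 - a * g \<ge> 0" using quadratic_solvable[OF a] by simp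
    also have "b\<^sup>2 - a * g = (A\<^sup>2 * B\<^sup>2) * (B\<^sup>2 * e1\<^sup>2 + A\<^sup>2 * e2\<^sup>2 - (e1 * Y2 - e2 * Y1)\<^sup>2)"
      by (simp add: a_def b_def g_def power2_eq_square algebra_simps)
    finally show ?thesis using mult_pos_pos[OF zero_less_power[OF A] zero_less_power[OF AB(1)], of 2 2]
      by (simp add: zero_le_mult_iff)
  qed
  have meets: "(\<exists>t. y + t *\<^sub>R (n + \<beta> *\<^sub>R \<tau>) \<in> \<Omega>1) \<longleftrightarrow> DD \<beta> \<ge> 0" for \<beta>
  proof -
    have "n0 \<bullet> (n + \<beta> *\<^sub>R \<tau>) = p - \<beta> * q" "(\<i> * n0) \<bullet> (n + \<beta> *\<^sub>R \<tau>) = q + \<beta> * p"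
      using tau by (simp_all add: inner_add_right p_def q_def)
    moreover have "p - \<beta> * q \<noteq> 0 \<or> q + \<beta> * p \<noteq> 0"
    proof (rule ccontr)
      assume "\<not> ?thesis"
      then have "(p - \<beta> * q)\<^sup>2 + (q + \<beta> * p)\<^sup>2 = 0" by simp
      then have "(1 + \<beta>\<^sup>2) * (p\<^sup>2 + q\<^sup>2) = 0" by (simp add: power2_eq_square algebra_simps)
      moreover have "1 + \<beta>\<^sup>2 > 0" by (simp add: add_pos_nonneg)
      ultimately show False using pq by simp
    qed
    ultimately show ?thesis unfolding DD_def by (intro gen) auto
  qed
  define h where "h = (A\<^sup>2 - B\<^sup>2) * (p * q) + (p * Y2 - q * Y1) * (q * Y2 + p * Y1)"
  define k where "k = B\<^sup>2 * q\<^sup>2 + A\<^sup>2 * p\<^sup>2 - (q * Y2 + p * Y1)\<^sup>2"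
  define a where "a = B\<^sup>2 * p\<^sup>2 + A\<^sup>2 * q\<^sup>2 - (p * Y2 - q * Y1)\<^sup>2"
  have DDeq: "DD \<beta> = a + 2 * h * \<beta> + k * \<beta>\<^sup>2" for \<beta>
    by (simp add: DD_def a_def h_def k_def power2_eq_square algebra_simps)
  have inw: "n \<bullet> (z - y) < 0" if "z \<in> \<Omega>1" for z using inward[of n y z] sn that by simp
  \<comment> \<open>Otherwise the tangent line of \<Omega>2 at \<open>y\<close> would meet
    \<Omega>1.\<close>
  have "k < 0"
  proof (rule ccontr)
    assume "\<not> k < 0"
    then have "B\<^sup>2 * (- q)\<^sup>2 + A\<^sup>2 * p\<^sup>2 - ((- q) * Y2 - p * Y1)\<^sup>2 \<ge> 0"
      by (simp add: k_def power2_eq_square algebra_simps)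
    moreover have "- q \<noteq> 0 \<or> p \<noteq> 0" using pq by auto
    ultimately obtain t where "y + t *\<^sub>R \<tau> \<in> \<Omega>1" using gen[of "- q" \<tau> p] tau by auto
    then have "n \<bullet> (t *\<^sub>R \<tau>) < 0" using inw by fastforce
    then show False by (simp add: \<tau>_def inner_complex_def)
  qed
  moreover obtain b0 where "a + 2 * h * b0 + k * b0\<^sup>2 \<ge> 0"
  proof -
    obtain z where z: "z \<in> \<Omega>1" using A.interior_K interior_subset by blast
    define r where "r = n \<bullet> (z - y)"
    have r: "r < 0" using inw[OF z] by (simp add: r_def)
    have "z - y = r *\<^sub>R n + (\<tau> \<bullet> (z - y)) *\<^sub>R \<tau>" unfolding r_def \<tau>_def by (rule unit_decomp[OF nn])
    also have "\<dots> = r *\<^sub>R (n + ((\<tau> \<bullet> (z - y)) / r) *\<^sub>R \<tau>)" using r by (simp add: scaleR_add_right)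
    finally have "z = y + r *\<^sub>R (n + ((\<tau> \<bullet> (z - y)) / r) *\<^sub>R \<tau>)" by (metis add.commute diff_add_cancel)
    then have "DD ((\<tau> \<bullet> (z - y)) / r) \<ge> 0" using meets z by metis
    then show thesis using that DDeq by metis
  qed
  \<comment> \<open>Reflection in the normal at \<open>y\<close> sends slope \<open>b\<close> to
    \<open>- b\<close> and, by \<open>caustic_closed\<close>, lines meeting \<Omega>1 to such
    lines.\<close>
  moreover have "a - 2 * h * b + k * b\<^sup>2 \<ge> 0" if ge: "a + 2 * h * b + k * b\<^sup>2 \<ge> 0" for b
  proof -
    obtain t where t: "y + t *\<^sub>R (n + b *\<^sub>R \<tau>) \<in> \<Omega>1" using ge meets DDeq by metis
    obtain s where s: "y + s *\<^sub>R (n\<^sup>2 * cnj (t *\<^sub>R (n + b *\<^sub>R \<tau>))) \<in> \<Omega>1"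
      using caustic_closed[OF y sn t] by auto
    have "n\<^sup>2 * cnj (n + b *\<^sub>R \<tau>) = (n * cnj n) * (n + (- b) *\<^sub>R \<tau>)"
      by (simp add: \<tau>_def power2_eq_square algebra_simps)
    then have "n\<^sup>2 * cnj (t *\<^sub>R (n + b *\<^sub>R \<tau>)) = t *\<^sub>R (n + (- b) *\<^sub>R \<tau>)"
      using mult_cnj_unit[OF nn] by (simp add: scaleR_conv_of_real mult.left_commute)
    then have "y + s *\<^sub>R (t *\<^sub>R (n + (- b) *\<^sub>R \<tau>)) \<in> \<Omega>1" using s by (simp only:)
    then have "y + (s * t) *\<^sub>R (n + (- b) *\<^sub>R \<tau>) \<in> \<Omega>1" by (simp only: scaleR_scaleR)
    then have "DD (- b) \<ge> 0" using meets by blast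
    then show ?thesis by (simp add: DDeq)
  qed
  ultimately have h0: "h = 0" using quadratic_even[of k a h b0] by blast
  have nv: "n \<bullet> (y - c) = p * Y1 + q * Y2" "\<tau> \<bullet> (y - c) = p * Y2 - q * Y1"
  proof -
    have d: "y - c = Y1 *\<^sub>R n0 + Y2 *\<^sub>R (\<i> * n0)" unfolding Y1_def Y2_def by (rule unit_decomp[OF n0])
    show "n \<bullet> (y - c) = p * Y1 + q * Y2"
      unfolding d by (simp add: inner_add_right p_def q_def inner_commute del: mult_scaleR_right)
    have "\<tau> \<bullet> n0 = - q" "\<tau> \<bullet> (\<i> * n0) = p" using tau by (simp_all add: inner_commute)
    then show "\<tau> \<bullet> (y - c) = p * Y2 - q * Y1"
      unfolding d by (simp add: inner_add_right del: mult_scaleR_right)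
  qed
  have "n \<bullet> n0 = p" "\<tau> \<bullet> n0 = - q" using tau by (simp_all add: p_def inner_commute)
  then have v: "n \<bullet> v1 = p * Y1 + q * Y2 - f * p" "n \<bullet> v2 = p * Y1 + q * Y2 + f * p"
    "\<tau> \<bullet> v1 = p * Y2 - q * Y1 + f * q" "\<tau> \<bullet> v2 = p * Y2 - q * Y1 - f * q"
    using nv by (simp_all add: v1_def v2_def inner_diff_right inner_add_right algebra_simps)
  \<comment> \<open>As \<open>f\<^sup>2 = A\<^sup>2 - B\<^sup>2\<close>, the bisector condition for
    the foci is again the vanishing of the mixed coefficient \<open>h\<close>: tangents and focal
    rays from \<open>y\<close> have the same bisectors.\<close>
  have "(\<tau> \<bullet> v1) * (n \<bullet> v2) + (n \<bullet> v1) * (\<tau> \<bullet> v2) = 2 * (f\<^sup>2 * (p * q) + (p * Y2 - q * Y1) * (q * Y2 + p * Y1))"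
    unfolding v by (simp add: power2_eq_square algebra_simps)
  also have "\<dots> = 2 * h" unfolding f h_def ..
  finally show ?thesis using h0 by (simp add: \<tau>_def)
qed

lemma confocal:
  assumes C1: "piecewise_Ck_Jordan 4 (frontier \<Omega>1)" and C2: "piecewise_Ck_Jordan 4 (frontier \<Omega>2)"
  shows "confocal_ellipses (frontier \<Omega>1) (frontier \<Omega>2)"
proof -
  obtain c n0 A B where E: "norm n0 = 1" "0 < B" "B \<le> A"
    "\<Omega>1 = {z. B\<^sup>2 * (n0 \<bullet> (z - c))\<^sup>2 + A\<^sup>2 * ((\<i> * n0) \<bullet> (z - c))\<^sup>2 \<le> A\<^sup>2 * B\<^sup>2}"
    using inner_ellipse[OF C1] by blast
  define f where "f = sqrt (A\<^sup>2 - B\<^sup>2)"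
  have "B\<^sup>2 \<le> A\<^sup>2" using E by (intro power_mono) auto
  then have f: "f\<^sup>2 = A\<^sup>2 - B\<^sup>2" "f \<ge> 0" by (simp_all add: f_def)
  have "f\<^sup>2 < A\<^sup>2" using f(1) E(2) by simp
  then have fA: "f < A" using E(2,3) power2_less_imp_less by fastforce
  define f1 where "f1 = c + f *\<^sub>R n0"
  define f2 where "f2 = c - f *\<^sub>R n0"
  have "f1 - f2 = (2 * f) *\<^sub>R n0" by (simp add: f1_def f2_def scaleR_2[symmetric] algebra_simps)
  then have nf: "norm (f1 - f2) = 2 * f" using E(1) f(2) by simp
  have disc: "\<Omega>1 = {z. norm (z - f1) + norm (z - f2) \<le> 2 * A}"
    unfolding E(4) f1_def f2_def focal_disc_coordinates[OF E(1-3) f(1)] ..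
  have fr1: "frontier \<Omega>1 = ellipse f1 f2 (2 * A)"
    unfolding disc by (rule frontier_focal_disc) (use nf fA in simp)
  have fA1: "f1 \<in> \<Omega>1" "f2 \<in> \<Omega>1" unfolding disc using nf fA by (simp_all add: norm_minus_commute)
  obtain \<gamma> S where gam: "simple_path \<gamma>" "path_image \<gamma> = frontier \<Omega>2" "finite S" "0 \<in> S" "1 \<in> S" and
    "\<forall>s\<in>{0..1} - S. \<exists>\<eta>>0. {s - \<eta><..<s + \<eta>} \<subseteq> {0..1} \<and>
       (\<exists>g1 v2. (g1 has_vector_derivative v2) (at s) \<and> g1 s \<noteq> 0 \<and>
        (\<forall>u\<in>{s - \<eta><..<s + \<eta>}. (\<gamma> has_vector_derivative g1 u) (at u) \<and>
           (\<forall>m\<in>support_normals \<Omega>2 (\<gamma> u). m \<bullet> g1 u = 0)))"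
    by (rule B.boundary_parametrization[OF C2])
  note par = this(6)[rule_format]
  have gfr: "\<gamma> s \<in> frontier \<Omega>2" if "s \<in> {0..1}" for s using that gam(2) by (auto simp: path_image_def)
  define e where "e s = norm (\<gamma> s - f1) + norm (\<gamma> s - f2)" for s
  have conte: "continuous_on {0..1} e"
    unfolding e_def using gam(1) by (intro continuous_intros) (simp_all add: simple_path_def path_def)
  have dere: "(e has_derivative (\<lambda>h. 0)) (at s within {0..1})" if s: "s \<in> {0..1} - S" for s
  proof -
    obtain \<eta> g1 where g: "\<eta> > 0"
      "\<forall>u\<in>{s - \<eta><..<s + \<eta>}. (\<gamma> has_vector_derivative g1 u) (at u) \<and> (\<forall>m\<in>support_normals \<Omega>2 (\<gamma> u). m \<bullet> g1 u = 0)"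
      using par[OF s] by blast
    define w where "w = g1 s"
    have sm: "s \<in> {s - \<eta><..<s + \<eta>}" using g(1) by simp
    have dg: "(\<gamma> has_vector_derivative w) (at s)" using g(2) sm by (simp add: w_def)
    define y where "y = \<gamma> s"
    have yf: "y \<in> frontier \<Omega>2" using gfr s by (simp add: y_def)
    define n where "n = normal \<Omega>2 y"
    have nS: "n \<in> support_normals \<Omega>2 y" using B.normal_in[OF yf] by (simp add: n_def)
    have nn: "norm n = 1" using norm_normal_B[OF yf] by (simp add: n_def)
    have nw: "n \<bullet> w = 0" using g(2) sm nS by (simp add: w_def y_def)
    define v1 where "v1 = y - f1"
    define v2 where "v2 = y - f2"
    have pos: "n \<bullet> v1 > 0" "n \<bullet> v2 > 0"
      using inward[OF nS fA1(1)] inward[OF nS fA1(2)] by (simp_all add: v1_def v2_def inner_diff_right)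
    have "((\<i> * n) \<bullet> v1) * (n \<bullet> v2) + (n \<bullet> v1) * ((\<i> * n) \<bullet> v2) = 0"
      using outer_normal_bisects_foci[OF E(1-3) f(1) E(4) yf] unfolding n_def v1_def v2_def f1_def f2_def .
    from bisector_focal_gradient[OF this pos]
    have grad: "((\<i> * n) \<bullet> v1) / norm v1 + ((\<i> * n) \<bullet> v2) / norm v2 = 0"
      unfolding coordinates_norm[OF nn, symmetric] by simp
    have w: "w = ((\<i> * n) \<bullet> w) *\<^sub>R (\<i> * n)" using unit_decomp[OF nn, of w] nw by simp
    have vne: "v1 \<noteq> 0" "v2 \<noteq> 0" using pos by auto
    have sg: "sgn v1 \<bullet> w + sgn v2 \<bullet> w = 0"
    proof -
      have "sgn v \<bullet> w = ((\<i> * n) \<bullet> w) * (((\<i> * n) \<bullet> v) / norm v)" for v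
        by (subst w) (simp add: sgn_div_norm inner_commute divide_inverse)
      then show ?thesis using grad by (metis distrib_left mult_zero_right)
    qed
    have der: "((\<lambda>u. norm (\<gamma> u - a)) has_derivative (\<lambda>h. h * (sgn (y - a) \<bullet> w))) (at s)" if "y - a \<noteq> 0" for a
    proof -
      have "((\<lambda>u. \<gamma> u - a) has_derivative (\<lambda>h. h *\<^sub>R w)) (at s)"
        using dg unfolding has_vector_derivative_def by (auto intro!: derivative_eq_intros)
      moreover have "(norm has_derivative (\<lambda>h. sgn (y - a) \<bullet> h)) (at (\<gamma> s - a))"
        using has_derivative_norm[OF that] by (simp add: y_def inner_commute)
      ultimately have "((\<lambda>u. norm (\<gamma> u - a)) has_derivative (\<lambda>h. sgn (y - a) \<bullet> (h *\<^sub>R w))) (at s)"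
        by (rule has_derivative_compose)
      then show ?thesis by simp
    qed
    have "(e has_derivative (\<lambda>h. h * (sgn v1 \<bullet> w) + h * (sgn v2 \<bullet> w))) (at s)"
      unfolding e_def v1_def v2_def by (intro has_derivative_add der) (use vne in \<open>auto simp: v1_def v2_def\<close>)
    moreover have "(\<lambda>h. h * (sgn v1 \<bullet> w) + h * (sgn v2 \<bullet> w)) = (\<lambda>h. 0)"
      using sg by (simp add: distrib_left[symmetric])
    ultimately show ?thesis by (simp add: has_derivative_at_withinI)
  qed
  \<comment> \<open>Continuity bridges the finitely many partition parameters, so the focal sum has
    this value along the whole boundary.\<close>
  define s2 where "s2 = e 0"
  have const: "e s = s2" if "s \<in> {0..1}" for s
    by (rule has_derivative_zero_unique_strong_interval[OF gam(3) conte _ dere that]) (simp_all add: s2_def)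
  have sub: "frontier \<Omega>2 \<subseteq> ellipse f1 f2 s2"
  proof
    fix z assume "z \<in> frontier \<Omega>2"
    then have "z \<in> \<gamma> ` {0..1}" using gam(2) by (simp add: path_image_def)
    then obtain s where "s \<in> {0..1}" "z = \<gamma> s" by blast
    then show "z \<in> ellipse f1 f2 s2" using const by (simp add: ellipse_def e_def)
  qed
  \<comment> \<open>One outer boundary point outside the inner focal disc gives
    \<open>s2 > 2 * A\<close>, so the outer ellipse is not degenerate.\<close>
  have "\<gamma> 0 \<notin> \<Omega>1" using frontier_B_notin_A[OF gfr[of 0]] by simp
  then have "s2 > 2 * A" unfolding disc by (simp add: s2_def e_def)
  then have s2: "norm (f1 - f2) < s2" using nf fA by simp
  have fr2: "frontier \<Omega>2 = ellipse f1 f2 s2"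
    by (rule B.frontier_eq_ellipse[OF s2 A_in_interior_B[OF fA1(1)] sub])
  show ?thesis
    unfolding confocal_ellipses_def using fr1 fr2 nf fA s2
    by (intro exI[of _ f1] exI[of _ f2] exI[of _ "2 * A"] exI[of _ s2]) simp
qed

end

theorem theorem5p21:
  fixes \<Omega>1 \<Omega>2 :: "complex set"
  assumes "convex_compact_domain \<Omega>1" and "convex_compact_domain \<Omega>2"
    and "\<Omega>1 \<subseteq> interior \<Omega>2"
    and "piecewise_Ck_Jordan 4 (frontier \<Omega>1)" and "piecewise_Ck_Jordan 4 (frontier \<Omega>2)"
    and "billiards_commute \<Omega>1 \<Omega>2"
  shows "confocal_ellipses (frontier \<Omega>1) (frontier \<Omega>2)"
proof -
  interpret A: convex_body \<Omega>1 using assms(1) by unfold_locales (auto simp: convex_compact_domain_def)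
  interpret B: convex_body \<Omega>2 using assms(2) by unfold_locales (auto simp: convex_compact_domain_def)
  interpret commuting_billiards \<Omega>1 \<Omega>2
    using assms A.smooth_at_cofinite B.regular_at_cofinite by unfold_locales
  show ?thesis by (rule confocal[OF assms(4,5)])
qed

end
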